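(* Let $q,k\in\mathbb{N}$, $m\in\mathbb{N}_*$ and $\mathbf{e}\in\mathcal{E}$. There exists a universal constant $C$ (depending only on $q,k,m,d$ and $\mathbf{e}$) such that for every $f\in C^{2m+q}(\mathbb{R}^d)$ one has $$\|f\|_{q,\mathbf{e}}\le C\,\rho_{q,k,m,\mathbf{e}}(\mu),\qquad\text{where }\mu(dx)=f(x)\,dx .$$
   Context: $\mathbb{N}=\{0,1,2,\dots\}$, $\mathbb{N}_*=\mathbb{N}\setminus\{0\}$. $\mathcal{M}$ is the set of finite signed Borel measures on $\mathbb{R}^d$, $\mathcal{M}_a\subset\mathcal{M}$ the absolutely continuous ones (with respect to Lebesgue measure), and $p_\mu$ is the density of $\mu\in\mathcal{M}_a$. The measure $\mu(dx)=f(x)dx$ is understood to belong to $\mathcal{M}$. A Young function is a symmetric, strictly convex, non-negative function $\mathbf{e}:\mathbb{R}\to\mathbb{R}_+$ with $\mathbf{e}(0)=0$. $\mathcal{E}$ is the set of Young functions such that (i) there is $\lambda>0$ with $\mathbf{e}(2s)\le\lambda\mathbf{e}(s)$ for all $s$, and (ii) $s\mapsto\mathbf{e}(s)/s$ is non-decreasing (on $s>0$). Put $\|f\|_{\mathbf{e}}=\inf\{c>0:\int\mathbf{e}(f(x)/c)\,dx\le1\}$, and for $a,R>0$, $\mathbf{e}^{-1}(a)=\sup\{c:\mathbf{e}(c)\le a\}$, $\beta_{\mathbf{e}}(R)=R/\mathbf{e}^{-1}(R)$. For multi-indices $\alpha,\gamma\in\mathbb{N}^d$ put $|\alpha|=\sum_i\alpha_i$,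 $\partial_\alpha=\partial_{x_1}^{\alpha_1}\cdots\partial_{x_d}^{\alpha_d}$, $x^\gamma=\prod_i x_i^{\gamma_i}$. Define $\|f\|_{k,\mathbf{e}}=\sum_{0\le|\alpha|\le k}\|\partial_\alpha f\|_{\mathbf{e}}$, $\ \|f\|_{k,\infty}=\sum_{0\le|\alpha|\le k}\|\partial_\alpha f\|_\infty$, $\ \|f\|_{k,l,\mathbf{e}}=\sum_{0\le|\alpha|\le k}\sum_{0\le|\gamma|\le l}\|x^\gamma\partial_\alpha f(x)\|_{\mathbf{e}}$. For $\mu,\nu\in\mathcal{M}$: $d_k(\mu,\nu)=\sup\{|\int\phi\,d\mu-\int\phi\,d\nu|:\phi\in C^\infty(\mathbb{R}^d),\ \|\phi\|_{k,\infty}\le1\}$. For $\mu\in\mathcal{M}$ and a sequence $(\mu_n)_{n\in\mathbb{N}}\subset\mathcal{M}_a$, $$\pi_{q,k,m,\mathbf{e}}(\mu,(\mu_n)_n)=\sum_{n=0}^\infty2^{n(q+k)}\beta_{\mathbf{e}}(2^{nd})d_k(\mu,\mu_n)+\sum_{n=0}^\infty2^{-2nm}\|p_{\mu_n}\|_{2m+q,2m,\mathbf{e}},$$ and $\rho_{q,k,m,\mathbf{e}}(\mu)=\inf\pi_{q,k,m,\mathbf{e}}(\mu,(\mu_n)_n)$, the infimum being over all sequences $(\mu_n)_n$ in $\mathcal{M}_a$. *)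

theory Defs
  imports "HOL-Analysis.Analysis"
begin

section \<open>Finite signed Borel measures\<close>

text \<open>
  A finite signed Borel measure is a countably additive real-valued set function on the Borel
  sets. Its values on non-Borel sets are unconstrained and never used.
\<close>

definition signed_borel_measures :: "('a::topological_space set \<Rightarrow> real) set" where
  "signed_borel_measures = {\<mu>. \<mu> {} = 0 \<and>
     (\<forall>A :: nat \<Rightarrow> 'a set. range A \<subseteq> sets borel \<longrightarrow> disjoint_family A \<longrightarrow>
        (\<lambda>i. \<mu> (A i)) sums \<mu> (\<Union>i. A i))}"

text \<open>
  The integral is taken against the Jordan decomposition. The coercion to \<^typ>\<open>ennreal\<close> sends
  negative numbers to 0, which does not affect the supremum since \<open>B = {}\<close> is admissible.
\<close>

definition upper_variation :: "('a::topological_space set \<Rightarrow> real) \<Rightarrow> 'a measure" where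
  "upper_variation \<mu> =
     measure_of UNIV (sets borel) (\<lambda>A. SUP B\<in>{B \<in> sets borel. B \<subseteq> A}. ennreal (\<mu> B))"

definition lower_variation :: "('a::topological_space set \<Rightarrow> real) \<Rightarrow> 'a measure" where
  "lower_variation \<mu> = upper_variation (\<lambda>A. - \<mu> A)"

definition signed_integral :: "('a::topological_space set \<Rightarrow> real) \<Rightarrow> ('a \<Rightarrow> real) \<Rightarrow> real" where
  "signed_integral \<mu> \<phi> =
     (\<integral>x. \<phi> x \<partial>upper_variation \<mu>) - (\<integral>x. \<phi> x \<partial>lower_variation \<mu>)"

definition ac_signed_measures :: "('a::euclidean_space set \<Rightarrow> real) set" where
  "ac_signed_measures = {\<mu> \<in> signed_borel_measures. \<forall>A \<in> null_sets lborel. \<mu> A = 0}"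

definition measure_with_density :: "('a::euclidean_space \<Rightarrow> real) \<Rightarrow> 'a set \<Rightarrow> real" where
  "measure_with_density f A = (LINT x:A|lborel. f x)"

definition is_density_of :: "('a::euclidean_space \<Rightarrow> real) \<Rightarrow> ('a set \<Rightarrow> real) \<Rightarrow> bool" where
  "is_density_of p \<mu> \<longleftrightarrow>
     integrable lborel p \<and> (\<forall>A \<in> sets borel. \<mu> A = measure_with_density p A)"

text \<open>
  A density is unique only up to null sets, whereas its classical derivatives depend on the
  representative. We take the continuous representative if there is one; it is then unique, and
  it is of class \<open>C\<^sup>n\<close> as soon as some representative is.
\<close>

definition density_of :: "('a::euclidean_space set \<Rightarrow> real) \<Rightarrow> 'a \<Rightarrow> real" where
  "density_of \<mu> =
     (if \<exists>p. is_density_of p \<mu> \<and> continuous_on UNIV p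
      then SOME p. is_density_of p \<mu> \<and> continuous_on UNIV p
      else SOME p. is_density_of p \<mu>)"


section \<open>Young functions\<close>

definition strictly_convex :: "(real \<Rightarrow> real) \<Rightarrow> bool" where
  "strictly_convex e \<longleftrightarrow> (\<forall>x y t. x \<noteq> y \<longrightarrow> 0 < t \<longrightarrow> t < 1 \<longrightarrow>
     e ((1 - t) * x + t * y) < (1 - t) * e x + t * e y)"

definition young_function :: "(real \<Rightarrow> real) \<Rightarrow> bool" where
  "young_function e \<longleftrightarrow>
     (\<forall>s. e (- s) = e s) \<and> strictly_convex e \<and> (\<forall>s. e s \<ge> 0) \<and> e 0 = 0"

definition young_class :: "(real \<Rightarrow> real) set" where
  "young_class = {e. young_function e \<and>
     (\<exists>L>0. \<forall>s. e (2 * s) \<le> L * e s) \<and>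
     mono_on {0<..} (\<lambda>s. e s / s)}"

definition young_inverse :: "(real \<Rightarrow> real) \<Rightarrow> real \<Rightarrow> real" where
  "young_inverse e a = Sup {c. e c \<le> a}"

definition young_beta :: "(real \<Rightarrow> real) \<Rightarrow> real \<Rightarrow> real" where
  "young_beta e R = R / young_inverse e R"

text \<open>The value is \<open>\<infinity>\<close> if no \<open>c\<close> is admissible.\<close>

definition luxemburg_norm :: "(real \<Rightarrow> real) \<Rightarrow> ('a::euclidean_space \<Rightarrow> real) \<Rightarrow> ennreal" where
  "luxemburg_norm e f =
     Inf {ennreal c | c. c > 0 \<and> (\<integral>\<^sup>+x. ennreal (e (f x / c)) \<partial>lborel) \<le> 1}"


section \<open>Partial derivatives and norms\<close>

text \<open>
  The coordinates are indexed by a finite linearly ordered type, so that \<open>\<partial>\<^sub>\<alpha>\<close> has a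
  definite order of differentiation, with the smallest index outermost.
\<close>

definition partial_deriv :: "'d::finite \<Rightarrow> (real^'d \<Rightarrow> real) \<Rightarrow> real^'d \<Rightarrow> real" where
  "partial_deriv i f x = deriv (\<lambda>t. f (x + t *\<^sub>R axis i 1)) 0"

fun C_k :: "nat \<Rightarrow> (real^'d::finite \<Rightarrow> real) \<Rightarrow> bool" where
  "C_k 0 f \<longleftrightarrow> continuous_on UNIV f"
| "C_k (Suc n) f \<longleftrightarrow> continuous_on UNIV f \<and>
     (\<forall>i. (\<forall>x. (\<lambda>t. f (x + t *\<^sub>R axis i 1)) differentiable (at 0)) \<and> C_k n (partial_deriv i f))"

definition C_infinity :: "(real^'d::finite \<Rightarrow> real) \<Rightarrow> bool" where
  "C_infinity f \<longleftrightarrow> (\<forall>n. C_k n f)"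

definition multi_deriv ::
    "('d::{finite,linorder} \<Rightarrow> nat) \<Rightarrow> (real^'d::{finite,linorder} \<Rightarrow> real) \<Rightarrow> real^'d::{finite,linorder} \<Rightarrow> real" where
  "multi_deriv \<alpha> f =
     foldr (\<lambda>i. partial_deriv i ^^ \<alpha> i) (sorted_list_of_set UNIV) f"

definition multi_monom :: "('d::finite \<Rightarrow> nat) \<Rightarrow> real^'d \<Rightarrow> real" where
  "multi_monom \<gamma> x = (\<Prod>i\<in>UNIV. (x $ i) ^ \<gamma> i)"

definition multi_indices :: "nat \<Rightarrow> ('d::finite \<Rightarrow> nat) set" where
  "multi_indices k = {\<alpha>. (\<Sum>i\<in>UNIV. \<alpha> i) \<le> k}"

lemma finite_multi_indices: "finite (multi_indices k :: ('d::finite \<Rightarrow> nat) set)"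
proof (rule finite_subset)
  show "multi_indices k \<subseteq> PiE (UNIV :: 'd set) (\<lambda>_. {..k})"
  proof
    fix \<alpha> :: "'d \<Rightarrow> nat"
    assume "\<alpha> \<in> multi_indices k"
    hence "(\<Sum>i\<in>UNIV. \<alpha> i) \<le> k"
      by (simp add: multi_indices_def)
    moreover have "\<alpha> j \<le> (\<Sum>i\<in>UNIV. \<alpha> i)" for j
      by (rule member_le_sum) auto
    ultimately show "\<alpha> \<in> PiE UNIV (\<lambda>_. {..k})"
      using le_trans by fastforce
  qed
qed (simp add: finite_PiE)

text \<open>
  The two norms below are \<open>\<infinity>\<close> on functions that are not \<open>k\<close> times continuously differentiable:
  \<^const>\<open>deriv\<close> is total, and without this guard e.g. an indicator function of a box would
  have a finite norm.
\<close>

definition norm_ke :: "nat \<Rightarrow> (real \<Rightarrow> real) \<Rightarrow> (real^'d::{finite,linorder} \<Rightarrow> real) \<Rightarrow> ennreal" where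
  "norm_ke k e f =
     (if C_k k f then \<Sum>\<alpha>\<in>multi_indices k. luxemburg_norm e (multi_deriv \<alpha> f) else \<infinity>)"

definition norm_kle ::
    "nat \<Rightarrow> nat \<Rightarrow> (real \<Rightarrow> real) \<Rightarrow> (real^'d::{finite,linorder} \<Rightarrow> real) \<Rightarrow> ennreal" where
  "norm_kle k l e f =
     (if C_k k f
      then \<Sum>\<alpha>\<in>multi_indices k. \<Sum>\<gamma>\<in>multi_indices l.
             luxemburg_norm e (\<lambda>x. multi_monom \<gamma> x * multi_deriv \<alpha> f x)
      else \<infinity>)"

definition sup_norm :: "('a \<Rightarrow> real) \<Rightarrow> ennreal" where
  "sup_norm f = (SUP x. ennreal \<bar>f x\<bar>)"

text \<open>Only applied to smooth functions, so it needs no such guard.\<close>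

definition norm_kinf :: "nat \<Rightarrow> (real^'d::{finite,linorder} \<Rightarrow> real) \<Rightarrow> ennreal" where
  "norm_kinf k f = (\<Sum>\<alpha>\<in>multi_indices k. sup_norm (multi_deriv \<alpha> f))"


section \<open>The distances and the interpolation functional\<close>

definition dist_k ::
    "nat \<Rightarrow> ((real^'d::{finite,linorder}) set \<Rightarrow> real) \<Rightarrow> ((real^'d::{finite,linorder}) set \<Rightarrow> real) \<Rightarrow> ennreal" where
  "dist_k k \<mu> \<nu> =
     (SUP \<phi>\<in>{\<phi>. C_infinity \<phi> \<and> norm_kinf k \<phi> \<le> 1}.
        ennreal \<bar>signed_integral \<mu> \<phi> - signed_integral \<nu> \<phi>\<bar>)"

definition interp_pi ::
    "nat \<Rightarrow> nat \<Rightarrow> nat \<Rightarrow> (real \<Rightarrow> real) \<Rightarrow> ((real^'d::{finite,linorder}) set \<Rightarrow> real) \<Rightarrow>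
      (nat \<Rightarrow> (real^'d::{finite,linorder}) set \<Rightarrow> real) \<Rightarrow> ennreal" where
  "interp_pi q k m e \<mu> \<mu>s =
     (\<Sum>n. ennreal (2 ^ (n * (q + k)) * young_beta e (2 ^ (n * CARD('d::{finite,linorder})))) * dist_k k \<mu> (\<mu>s n)) +
     (\<Sum>n. ennreal (1 / 2 ^ (2 * n * m)) * norm_kle (2 * m + q) (2 * m) e (density_of (\<mu>s n)))"

definition interp_rho ::
    "nat \<Rightarrow> nat \<Rightarrow> nat \<Rightarrow> (real \<Rightarrow> real) \<Rightarrow> ((real^'d::{finite,linorder}) set \<Rightarrow> real) \<Rightarrow> ennreal" where
  "interp_rho q k m e \<mu> =
     (INF \<mu>s\<in>{\<mu>s. \<forall>n. \<mu>s n \<in> ac_signed_measures}. interp_pi q k m e \<mu> \<mu>s)"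

end

theory Submission
  imports Defs "HOL-Probability.Probability_Measure"
begin

text \<open>
  The function \<open>f\<close> is decomposed into dyadic blocks by smoothing. Let \<open>\<eta>\<close> be a non-negative smooth
  function of integral 1 supported in the unit ball, \<open>A\<^sub>h g x = \<integral> \<eta> y g (x + h y) dy\<close>, \<open>M = 2 m\<close>, and
  \<open>S\<^sub>n = - (\<Sum>j=1..M. (- 1) ^ j (M choose j) A\<^sub>h)\<close> with \<open>h = j / 2\<^sup>n\<close>. For a multi-index \<open>\<alpha>\<close> of order at
  most \<open>q\<close>, \<open>S\<^sub>n \<partial>\<^sub>\<alpha> f\<close> tends to \<open>\<partial>\<^sub>\<alpha> f\<close> pointwise, so that by Fatou's lemma it is enough to bound
  \<open>S\<^sub>0 \<partial>\<^sub>\<alpha> f\<close> and the increments \<open>(S\<^sub>n\<^sub>+\<^sub>1 - S\<^sub>n) \<partial>\<^sub>\<alpha> f\<close> in the Luxemburg norm by the terms of the series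
  that defines \<open>\<pi>\<close>. With \<open>f\<^sub>n\<close> the density of \<open>\<mu>\<^sub>n\<close>, write \<open>f = f\<^sub>n + (f - f\<^sub>n)\<close> in the \<open>n\<close>-th increment.

  For the regular part \<open>f\<^sub>n\<close>: \<open>g - S\<^sub>n g\<close> is an \<open>\<eta>\<close>-average of the \<open>M\<close>-th differences of \<open>g\<close> with steps
  of length at most \<open>2\<^sup>-\<^sup>n\<close>. A difference is an average of derivatives along segments, and averages do
  not increase the Luxemburg norm (\<open>luxemburg_average\<close>), so that
  \<open>\<parallel>g - S\<^sub>n g\<parallel> \<le> const 2\<^sup>-\<^sup>n\<^sup>M\<close> times the derivatives of \<open>g\<close> of order \<open>M\<close> (\<open>luxemburg_smoothing_error\<close>).
  Applied to \<open>g = \<partial>\<^sub>\<alpha> f\<^sub>n\<close>, this gives the second series; Clairaut's theorem is needed to bring the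
  derivatives into the order used by the norm. The weights \<open>x\<^sup>\<gamma>\<close> with \<open>\<gamma> \<noteq> 0\<close> play no role.

  For the small part \<open>g = f - f\<^sub>n\<close>: integrating by parts, \<open>A\<^sub>h \<partial>\<^sub>\<alpha> g\<close> is a smoothing of \<open>g\<close> by a derivative
  of \<open>\<eta>\<close>, up to a power of \<open>h\<close>. Its supremum norm is controlled by pairing \<open>g\<close> with a rescaled kernel
  (\<open>smoothing_sup_bound\<close>), its \<open>L\<^sup>1\<close> norm by pairing \<open>g\<close> with the convolution of such a kernel with a
  sign function (\<open>smoothing_L1_bound\<close>). These pairings are at most \<open>d\<^sub>k(\<mu>, \<mu>\<^sub>n)\<close> times the \<open>C\<^sup>k\<close> norms of
  the functions paired with \<open>g\<close>. The two bounds \<open>B\<close> and \<open>B 2\<^sup>n\<^sup>d\<close> of the \<open>L\<^sup>1\<close> and the supremum norm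
  interpolate to the bound \<open>B \<beta>(2\<^sup>n\<^sup>d)\<close> of the Luxemburg norm (\<open>luxemburg_interpolation\<close>), because
  \<open>e s / s\<close> is non-decreasing. This gives the first series.

  That every absolutely continuous signed measure has a density, and that integrals against it are
  integrals against the density, is proved from the definition of the variations by Radon-Nikodym.
\<close>

section \<open>Young functions and the Luxemburg norm\<close>

text \<open>A fixed Young function of the admissible class.\<close>

locale young_fun =
  fixes e :: "real \<Rightarrow> real"
  assumes young: "e \<in> young_class"
begin

lemma e_nonneg [simp]: "0 \<le> e s" and e_even: "e (- s) = e s" and e_0 [simp]: "e 0 = 0"
  and e_strictly_convex: "strictly_convex e"
  and e_mono_quotient: "0 < s \<Longrightarrow> s \<le> t \<Longrightarrow> e s / s \<le> e t / t"
  using young by (auto simp: young_class_def young_function_def mono_on_def)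

lemma e_pos: assumes "s \<noteq> 0" shows "0 < e s"
proof -
  have "e ((1 - 1/2) * s + 1/2 * (- s)) < (1 - 1/2) * e s + 1/2 * e (- s)"
    using assms by (intro e_strictly_convex[unfolded strictly_convex_def, rule_format]) auto
  thus ?thesis by (simp add: e_even)
qed

lemma e_convex: "convex_on UNIV e"
proof (rule convex_onI)
  fix t x y :: real assume "0 < t" "t < 1"
  thus "e ((1 - t) *\<^sub>R x + t *\<^sub>R y) \<le> (1 - t) * e x + t * e y"
  proof (cases "x = y")
    case False
    with \<open>0 < t\<close> \<open>t < 1\<close> have "e ((1 - t) * x + t * y) < (1 - t) * e x + t * e y"
      by (intro e_strictly_convex[unfolded strictly_convex_def, rule_format]) auto
    thus ?thesis by simp
  qed (simp add: algebra_simps)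
qed auto

lemma e_continuous: "continuous_on UNIV e"
  by (rule convex_on_continuous[OF open_UNIV e_convex])

lemma e_measurable [measurable]: "e \<in> borel_measurable borel"
  by (rule borel_measurable_continuous_onI[OF e_continuous])

lemma e_abs: "e \<bar>s\<bar> = e s"
  by (auto simp: abs_real_def e_even)

lemma e_mono_abs: assumes "\<bar>s\<bar> \<le> \<bar>t\<bar>" shows "e s \<le> e t"
proof (cases "s = 0")
  case False
  hence s: "0 < \<bar>s\<bar>" by simp
  have "e \<bar>s\<bar> / \<bar>s\<bar> \<le> e \<bar>t\<bar> / \<bar>t\<bar>" by (rule e_mono_quotient[OF s assms])
  hence "e \<bar>s\<bar> \<le> \<bar>s\<bar> * (e \<bar>t\<bar> / \<bar>t\<bar>)" using s by (simp add: field_simps)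
  also have "\<dots> \<le> \<bar>t\<bar> * (e \<bar>t\<bar> / \<bar>t\<bar>)" by (intro mult_right_mono assms) simp
  also have "\<dots> = e \<bar>t\<bar>" using s assms by simp
  finally show ?thesis by (simp add: e_abs)
qed simp

lemma e_linear_le: assumes "\<bar>s\<bar> \<le> t" "0 < t" shows "e s \<le> \<bar>s\<bar> * (e t / t)"
proof (cases "s = 0")
  case False
  hence "e \<bar>s\<bar> / \<bar>s\<bar> \<le> e t / t" using assms by (intro e_mono_quotient) auto
  thus ?thesis using False by (simp add: e_abs field_simps)
qed simp

lemma young_inverse_bounds:
  assumes "0 < a" shows "0 < young_inverse e a" and "e (young_inverse e a) \<le> a"
proof -
  let ?S = "{c. e c \<le> a}"
  define r where "r = max 1 (a / e 1)"
  have e1: "0 < e 1" by (rule e_pos) simp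
  have bdd: "bdd_above ?S"
  proof (rule bdd_aboveI[of _ r])
    fix c assume "c \<in> ?S"
    show "c \<le> r"
    proof (cases "c \<le> 1")
      case False
      have "e 1 / 1 \<le> e c / c" using False by (intro e_mono_quotient) auto
      hence "e 1 * c \<le> e c" using False by (simp add: field_simps)
      also have "\<dots> \<le> a" using \<open>c \<in> ?S\<close> by simp
      finally show ?thesis using e1 by (simp add: r_def field_simps le_max_iff_disj)
    qed (simp add: r_def)
  qed
  have ne: "0 \<in> ?S" using assms by simp
  have "closed ?S"
    using continuous_closed_preimage[OF e_continuous closed_UNIV, of "{..a}"]
    by (simp add: vimage_def)
  have "Sup ?S \<in> ?S" by (rule closed_contains_Sup[OF _ bdd \<open>closed ?S\<close>]) (use ne in blast)
  thus "e (young_inverse e a) \<le> a" unfolding young_inverse_def by simp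
  define t where "t = min 1 (a / e 1)"
  have t: "0 < t" "t \<le> 1" using assms e1 by (auto simp: t_def)
  have "e t \<le> \<bar>t\<bar> * (e 1 / 1)" using t by (intro e_linear_le) auto
  also have "\<dots> \<le> a" using t e1 by (simp add: t_def min_def field_simps split: if_splits)
  finally have "t \<in> ?S" by simp
  from cSup_upper[OF this bdd] t show "0 < young_inverse e a" unfolding young_inverse_def by simp
qed

lemma young_beta_pos: "0 < R \<Longrightarrow> 0 < young_beta e R"
  unfolding young_beta_def using young_inverse_bounds by simp

text \<open>The functional inside the infimum is antitone in \<open>c\<close>, so the infimum is a threshold.\<close>

lemma modular_antimono:
  assumes "0 < c" "c \<le> c'"
  shows "(\<integral>\<^sup>+x. ennreal (e (f x / c')) \<partial>M) \<le> (\<integral>\<^sup>+x. ennreal (e (f x / c)) \<partial>M)"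
proof (intro nn_integral_mono ennreal_leI e_mono_abs)
  fix x
  show "\<bar>f x / c'\<bar> \<le> \<bar>f x / c\<bar>"
    using assms by (simp add: abs_divide frac_le)
qed

lemma luxemburg_le:
  assumes "0 < c" "(\<integral>\<^sup>+x. ennreal (e (f x / c)) \<partial>lborel) \<le> 1"
  shows "luxemburg_norm e f \<le> ennreal c"
  unfolding luxemburg_norm_def using assms by (intro Inf_lower) auto

lemma luxemburg_lessD:
  assumes "luxemburg_norm e f < ennreal c"
  shows "(\<integral>\<^sup>+x. ennreal (e (f x / c)) \<partial>lborel) \<le> 1"
proof -
  obtain c' where c': "c' > 0" "(\<integral>\<^sup>+x. ennreal (e (f x / c')) \<partial>lborel) \<le> 1" "ennreal c' < ennreal c"
    using assms unfolding luxemburg_norm_def Inf_less_iff by auto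
  hence "c' \<le> c" by (metis ennreal_less_iff less_eq_real_def)
  from order_trans[OF modular_antimono[OF c'(1) this] c'(2)] show ?thesis .
qed

lemma luxemburg_leI:
  assumes "\<And>c. 0 < c \<Longrightarrow> B < ennreal c \<Longrightarrow> (\<integral>\<^sup>+x. ennreal (e (f x / c)) \<partial>lborel) \<le> 1"
  shows "luxemburg_norm e f \<le> B"
proof (rule dense_ge)
  fix y assume y: "B < y"
  show "luxemburg_norm e f \<le> y"
  proof (cases y)
    case (real c)
    have "0 < ennreal c" using y real by (metis bot_ennreal gr_zeroI not_less_bot)
    hence "0 < c" by (simp add: ennreal_less_zero_iff)
    thus ?thesis using luxemburg_le assms y real by auto
  qed simp
qed

lemma luxemburg_mono:
  assumes "\<And>x. \<bar>f x\<bar> \<le> \<bar>g x\<bar>"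
  shows "luxemburg_norm e f \<le> luxemburg_norm e g"
proof (rule luxemburg_leI)
  fix c :: real assume c: "0 < c" "luxemburg_norm e g < ennreal c"
  have "(\<integral>\<^sup>+x. ennreal (e (f x / c)) \<partial>lborel) \<le> (\<integral>\<^sup>+x. ennreal (e (g x / c)) \<partial>lborel)"
    using assms c by (intro nn_integral_mono ennreal_leI e_mono_abs) (simp add: abs_divide divide_right_mono)
  with luxemburg_lessD[OF c(2)] show "(\<integral>\<^sup>+x. ennreal (e (f x / c)) \<partial>lborel) \<le> 1" by simp
qed

lemma luxemburg_zero [simp]: "luxemburg_norm e (\<lambda>_. 0) = 0"
proof -
  have "luxemburg_norm e (\<lambda>_::'x::euclidean_space. 0) \<le> 0" by (rule luxemburg_leI) simp
  thus ?thesis by simp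
qed

lemma luxemburg_cmult:
  "luxemburg_norm e (\<lambda>x. a * f x) \<le> ennreal \<bar>a\<bar> * luxemburg_norm e f"
proof (cases "a = 0")
  case False
  show ?thesis
  proof (rule luxemburg_leI)
    fix c :: real assume c: "0 < c" "ennreal \<bar>a\<bar> * luxemburg_norm e f < ennreal c"
    have "luxemburg_norm e f < ennreal (c / \<bar>a\<bar>)"
    proof (rule ccontr)
      assume "\<not> ?thesis"
      hence "ennreal \<bar>a\<bar> * ennreal (c / \<bar>a\<bar>) \<le> ennreal \<bar>a\<bar> * luxemburg_norm e f"
        by (intro mult_left_mono) auto
      moreover have "ennreal \<bar>a\<bar> * ennreal (c / \<bar>a\<bar>) = ennreal c"
        using False c(1) by (simp flip: ennreal_mult)
      ultimately show False using c(2) by simp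
    qed
    from luxemburg_lessD[OF this]
    have "(\<integral>\<^sup>+x. ennreal (e (f x / (c / \<bar>a\<bar>))) \<partial>lborel) \<le> 1" .
    moreover have "e (f x / (c / \<bar>a\<bar>)) = e (a * f x / c)" for x
      by (subst (1 2) e_abs[symmetric]) (simp add: abs_mult abs_divide mult.commute)
    ultimately show "(\<integral>\<^sup>+x. ennreal (e (a * f x / c)) \<partial>lborel) \<le> 1" by simp
  qed
qed simp

lemma luxemburg_add:
  assumes [measurable]: "f \<in> borel_measurable borel" "g \<in> borel_measurable borel"
  shows "luxemburg_norm e (\<lambda>x. f x + g x) \<le> luxemburg_norm e f + luxemburg_norm e g"
proof (cases "luxemburg_norm e f = \<infinity> \<or> luxemburg_norm e g = \<infinity>")
  case False
  then obtain F G where FG: "0 \<le> F" "0 \<le> G" "luxemburg_norm e f = ennreal F" "luxemburg_norm e g = ennreal G"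
    by (metis ennreal_cases infinity_ennreal_def)
  show ?thesis
  proof (rule luxemburg_leI)
    fix c :: real assume c: "0 < c" "luxemburg_norm e f + luxemburg_norm e g < ennreal c"
    define \<delta> where "\<delta> = (c - F - G) / 2"
    have "ennreal (F + G) < ennreal c" using c FG by simp
    hence "F + G < c" using FG by (subst (asm) ennreal_less_iff) auto
    hence \<delta>: "0 < \<delta>" by (simp add: \<delta>_def)
    define a where "a = F + \<delta>"
    define b where "b = G + \<delta>"
    have ab: "0 < a" "0 < b" "a + b = c"
      using FG \<delta> unfolding a_def b_def by (auto simp: \<delta>_def field_simps)
    have f: "(\<integral>\<^sup>+x. ennreal (e (f x / a)) \<partial>lborel) \<le> 1"
      using FG \<delta> by (intro luxemburg_lessD) (simp add: a_def ennreal_less_iff)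
    have g: "(\<integral>\<^sup>+x. ennreal (e (g x / b)) \<partial>lborel) \<le> 1"
      using FG \<delta> by (intro luxemburg_lessD) (simp add: b_def ennreal_less_iff)
    have conv: "e ((f x + g x) / c) \<le> (a / c) * e (f x / a) + (b / c) * e (g x / b)" for x
    proof -
      have "e ((1 - b / c) *\<^sub>R (f x / a) + (b / c) *\<^sub>R (g x / b))
          \<le> (1 - b / c) * e (f x / a) + (b / c) * e (g x / b)"
        using ab by (intro convex_onD[OF e_convex]) auto
      moreover have "1 - b / c = a / c" using ab c by (simp add: field_simps)
      moreover have "(a / c) *\<^sub>R (f x / a) + (b / c) *\<^sub>R (g x / b) = (f x + g x) / c"
        using ab c by (simp add: field_simps)
      ultimately show ?thesis by simp
    qed
    have "(\<integral>\<^sup>+x. ennreal (e ((f x + g x) / c)) \<partial>lborel)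
       \<le> (\<integral>\<^sup>+x. ennreal (a / c) * ennreal (e (f x / a)) + ennreal (b / c) * ennreal (e (g x / b)) \<partial>lborel)"
      using conv ab c by (intro nn_integral_mono) (simp flip: ennreal_mult ennreal_plus)
    also have "\<dots> = ennreal (a / c) * (\<integral>\<^sup>+x. ennreal (e (f x / a)) \<partial>lborel)
                 + ennreal (b / c) * (\<integral>\<^sup>+x. ennreal (e (g x / b)) \<partial>lborel)"
      by (simp add: nn_integral_add nn_integral_cmult)
    also have "\<dots> \<le> ennreal (a / c) * 1 + ennreal (b / c) * 1"
      by (intro add_mono mult_left_mono f g) auto
    also have "\<dots> = ennreal (a / c + b / c)" using ab c by simp
    also have "a / c + b / c = 1" using ab c by (simp add: field_simps)
    finally show "(\<integral>\<^sup>+x. ennreal (e ((f x + g x) / c)) \<partial>lborel) \<le> 1" by simp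
  qed
qed auto

lemma luxemburg_sum:
  assumes "finite I" "\<And>i. i \<in> I \<Longrightarrow> f i \<in> borel_measurable borel"
  shows "luxemburg_norm e (\<lambda>x. \<Sum>i\<in>I. f i x) \<le> (\<Sum>i\<in>I. luxemburg_norm e (f i))"
  using assms
proof (induction I rule: finite_induct)
  case (insert i I)
  have "luxemburg_norm e (\<lambda>x. f i x + (\<Sum>i\<in>I. f i x))
     \<le> luxemburg_norm e (f i) + luxemburg_norm e (\<lambda>x. \<Sum>i\<in>I. f i x)"
    using insert by (intro luxemburg_add) auto
  also have "\<dots> \<le> luxemburg_norm e (f i) + (\<Sum>i\<in>I. luxemburg_norm e (f i))"
    using insert by (intro add_left_mono) auto
  finally show ?case using insert by simp
qed simp

lemma luxemburg_translate:
  assumes [measurable]: "f \<in> borel_measurable borel"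
  shows "luxemburg_norm e (\<lambda>x. f (x + a)) = luxemburg_norm e f"
proof -
  have "(\<integral>\<^sup>+x. ennreal (e (f (x + a) / c)) \<partial>lborel) = (\<integral>\<^sup>+x. ennreal (e (f x / c)) \<partial>lborel)" for c
  proof -
    have "(\<integral>\<^sup>+x. ennreal (e (f x / c)) \<partial>lborel)
       = (\<integral>\<^sup>+x. ennreal (e (f x / c)) \<partial>distr lborel borel (\<lambda>x. a + x))"
      using lborel_distr_plus[of a] by simp
    also have "\<dots> = (\<integral>\<^sup>+x. ennreal (e (f (x + a) / c)) \<partial>lborel)"
      by (subst nn_integral_distr) (auto simp: add.commute)
    finally show ?thesis by simp
  qed
  thus ?thesis unfolding luxemburg_norm_def by simp
qed

text \<open>Jensen's inequality without integrability of \<open>e \<circ> X\<close>.\<close>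

lemma jensen:
  assumes "prob_space N" and X: "integrable N X"
  shows "ennreal (e (\<integral>w. X w \<partial>N)) \<le> (\<integral>\<^sup>+w. ennreal (e (X w)) \<partial>N)"
proof -
  interpret prob_space N by fact
  have [measurable]: "X \<in> borel_measurable N" using X by simp
  show ?thesis
  proof (cases "integrable N (\<lambda>w. e (X w))")
    case True
    have "e (expectation X) \<le> expectation (\<lambda>w. e (X w))"
      by (rule jensens_inequality[OF X _ _ True e_convex]) auto
    thus ?thesis by (subst nn_integral_eq_integral[OF True]) (auto intro: ennreal_leI)
  next
    case False
    hence "(\<integral>\<^sup>+w. ennreal (e (X w)) \<partial>N) = \<infinity>"
      by (auto simp: integrable_iff_bounded less_top[symmetric])
    thus ?thesis by simp
  qed
qed

text \<open>Minkowski's inequality for averages over a probability space: Jensen and Tonelli.\<close>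

lemma luxemburg_average:
  fixes F :: "'b \<Rightarrow> 'a::euclidean_space \<Rightarrow> real"
  assumes N: "prob_space N"
    and F [measurable]: "(\<lambda>(w, x). F w x) \<in> borel_measurable (N \<Otimes>\<^sub>M lborel)"
    and int: "\<And>x. integrable N (\<lambda>w. F w x)"
    and bound: "AE w in N. luxemburg_norm e (F w) \<le> B"
  shows "luxemburg_norm e (\<lambda>x. \<integral>w. F w x \<partial>N) \<le> B"
proof (rule luxemburg_leI)
  fix c :: real assume c: "0 < c" "B < ennreal c"
  interpret N: prob_space N by fact
  interpret pair_sigma_finite N "lborel :: 'a measure" ..
  have "(\<integral>\<^sup>+x. ennreal (e ((\<integral>w. F w x \<partial>N) / c)) \<partial>lborel)
     = (\<integral>\<^sup>+x. ennreal (e (\<integral>w. F w x / c \<partial>N)) \<partial>lborel)" by simp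
  also have "\<dots> \<le> (\<integral>\<^sup>+x. (\<integral>\<^sup>+w. ennreal (e (F w x / c)) \<partial>N) \<partial>lborel)"
    using int by (intro nn_integral_mono jensen N) auto
  also have "\<dots> = (\<integral>\<^sup>+w. (\<integral>\<^sup>+x. ennreal (e (F w x / c)) \<partial>lborel) \<partial>N)"
    by (rule Fubini') measurable
  also have "\<dots> \<le> (\<integral>\<^sup>+w. 1 \<partial>N)"
  proof (rule nn_integral_mono_AE)
    show "AE w in N. (\<integral>\<^sup>+x. ennreal (e (F w x / c)) \<partial>lborel) \<le> 1"
      using bound
    proof eventually_elim
      case (elim w)
      thus ?case using c by (intro luxemburg_lessD) auto
    qed
  qed
  also have "\<dots> = 1" by (simp add: N.emeasure_space_1)
  finally show "(\<integral>\<^sup>+x. ennreal (e ((\<integral>w. F w x \<partial>N) / c)) \<partial>lborel) \<le> 1" .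
qed

lemma luxemburg_fatou:
  assumes [measurable]: "\<And>n. F n \<in> borel_measurable borel"
    and lim: "\<And>x. (\<lambda>n. F n x) \<longlonglongrightarrow> f x"
    and B: "\<And>n. luxemburg_norm e (F n) \<le> B"
  shows "luxemburg_norm e f \<le> B"
proof (rule luxemburg_leI)
  fix c :: real assume c: "0 < c" "B < ennreal c"
  have "(\<integral>\<^sup>+x. ennreal (e (f x / c)) \<partial>lborel)
      = (\<integral>\<^sup>+x. liminf (\<lambda>n. ennreal (e (F n x / c))) \<partial>lborel)"
  proof (intro nn_integral_cong)
    fix x
    have "isCont e (f x / c)" using e_continuous by (simp add: continuous_on_eq_continuous_at)
    hence "(\<lambda>n. e (F n x / c)) \<longlonglongrightarrow> e (f x / c)"
      by (rule isCont_tendsto_compose) (intro tendsto_intros lim, use c in auto)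
    hence "(\<lambda>n. ennreal (e (F n x / c))) \<longlonglongrightarrow> ennreal (e (f x / c))"
      by (rule tendsto_ennrealI)
    from lim_imp_Liminf[OF _ this]
    show "ennreal (e (f x / c)) = liminf (\<lambda>n. ennreal (e (F n x / c)))" by simp
  qed
  also have "\<dots> \<le> liminf (\<lambda>n. \<integral>\<^sup>+x. ennreal (e (F n x / c)) \<partial>lborel)"
    by (rule nn_integral_liminf) measurable
  also have "\<dots> \<le> liminf (\<lambda>n. 1)"
    using B c by (intro Liminf_mono always_eventually allI luxemburg_lessD) (meson le_less_trans)
  finally show "(\<integral>\<^sup>+x. ennreal (e (f x / c)) \<partial>lborel) \<le> 1" by (simp add: Liminf_const)
qed

text \<open>
  Interpolation between \<open>L\<^sup>1\<close> and \<open>L\<^sup>\<infinity>\<close>: since \<open>e s / s\<close> is non-decreasing,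
  \<open>e (H / c) \<le> (\<bar>H\<bar> / c) (e t / t)\<close> with \<open>t = e\<^sup>-\<^sup>1(R)\<close> as soon as \<open>\<bar>H\<bar> \<le> c t\<close>.
\<close>

lemma luxemburg_interpolation:
  fixes H :: "'a::euclidean_space \<Rightarrow> real"
  assumes [measurable]: "H \<in> borel_measurable borel"
    and R: "0 < R" and A: "0 < A"
    and L1: "(\<integral>\<^sup>+x. ennreal \<bar>H x\<bar> \<partial>lborel) \<le> ennreal A" and Linf: "\<And>x. \<bar>H x\<bar> \<le> A * R"
  shows "luxemburg_norm e H \<le> ennreal (A * young_beta e R)"
proof (rule luxemburg_le)
  define t where "t = young_inverse e R"
  have t: "0 < t" "e t \<le> R" unfolding t_def using young_inverse_bounds[OF R] by auto
  define c where "c = A * young_beta e R"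
  have c: "0 < c" "A * R = c * t" unfolding c_def young_beta_def t_def[symmetric] using A R t by auto
  have pt: "e (H x / c) \<le> (R / (c * t)) * \<bar>H x\<bar>" for x
  proof -
    have "\<bar>H x / c\<bar> \<le> t" using Linf[of x] c by (simp add: abs_divide field_simps)
    from e_linear_le[OF this t(1)] have "e (H x / c) \<le> (\<bar>H x\<bar> / c) * (e t / t)"
      using c by (simp add: abs_divide)
    also have "\<dots> \<le> (\<bar>H x\<bar> / c) * (R / t)"
      using t c by (intro mult_left_mono divide_right_mono) auto
    finally show ?thesis by (simp add: mult.commute)
  qed
  have "(\<integral>\<^sup>+x. ennreal (e (H x / c)) \<partial>lborel) \<le> (\<integral>\<^sup>+x. ennreal (R / (c * t)) * ennreal \<bar>H x\<bar> \<partial>lborel)"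
    using pt c t R by (intro nn_integral_mono) (simp flip: ennreal_mult)
  also have "\<dots> = ennreal (R / (c * t)) * (\<integral>\<^sup>+x. ennreal \<bar>H x\<bar> \<partial>lborel)"
    by (rule nn_integral_cmult) measurable
  also have "\<dots> \<le> ennreal (R / (c * t)) * ennreal A" by (intro mult_left_mono L1) simp
  also have "\<dots> = ennreal (R / (c * t) * A)" using c t R A by (simp flip: ennreal_mult)
  also have "R / (c * t) * A = 1" using A R by (simp flip: c(2))
  finally show "(\<integral>\<^sup>+x. ennreal (e (H x / (A * young_beta e R))) \<partial>lborel) \<le> 1"
    by (simp add: c_def)
  show "0 < A * young_beta e R" using c(1) by (simp add: c_def)
qed

end

section \<open>Calculus of iterated partial derivatives\<close>

lemma C_k_continuous: "C_k n f \<Longrightarrow> continuous_on UNIV f"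
  by (cases n) auto

lemma C_k_mono: "C_k n f \<Longrightarrow> m \<le> n \<Longrightarrow> C_k m f"
proof (induction n arbitrary: m f)
  case (Suc n)
  then show ?case by (cases m) auto
qed simp

lemma C_k_partial_deriv: "C_k (Suc n) f \<Longrightarrow> C_k n (partial_deriv i f)"
  by simp

declare C_k.simps(2) [simp del]

lemma C_k_DERIV:
  assumes "C_k (Suc n) f"
  shows "((\<lambda>t. f (x + t *\<^sub>R axis i 1)) has_real_derivative partial_deriv i f (x + s *\<^sub>R axis i 1)) (at s)"
proof -
  let ?y = "x + s *\<^sub>R axis i 1"
  have "(\<lambda>t. f (?y + t *\<^sub>R axis i 1)) differentiable (at 0)" using assms by (simp add: C_k.simps(2))
  hence "((\<lambda>t. f (?y + t *\<^sub>R axis i 1)) has_real_derivative partial_deriv i f ?y) (at 0)"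
    unfolding partial_deriv_def
    using DERIV_deriv_iff_real_differentiable by blast
  hence "((\<lambda>t. f (?y + (t - s) *\<^sub>R axis i 1)) has_real_derivative partial_deriv i f ?y) (at (0 + s))"
    using DERIV_shift[of "\<lambda>t. f (?y + (t - s) *\<^sub>R axis i 1)" "partial_deriv i f ?y" 0 s] by simp
  thus ?thesis by (simp add: algebra_simps)
qed

lemma C_k_DERIV_0:
  assumes "C_k (Suc n) f"
  shows "((\<lambda>t. f (x + t *\<^sub>R axis i 1)) has_real_derivative partial_deriv i f x) (at 0)"
  using C_k_DERIV[OF assms, of x i 0] by simp

lemma partial_deriv_eqI:
  assumes "\<And>x. ((\<lambda>t. f (x + t *\<^sub>R axis i 1)) has_real_derivative g x) (at 0)"
  shows "partial_deriv i f = g"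
  unfolding partial_deriv_def using assms by (auto intro: DERIV_imp_deriv)

lemma C_k_SucI:
  assumes "continuous_on UNIV f"
    and "\<And>i x. ((\<lambda>t. f (x + t *\<^sub>R axis i 1)) has_real_derivative g i x) (at 0)"
    and "\<And>i. C_k n (g i)"
  shows "C_k (Suc n) f"
proof -
  have "partial_deriv i f = g i" for i by (rule partial_deriv_eqI) (rule assms(2))
  thus ?thesis using assms by (auto simp: real_differentiable_def C_k.simps(2))
qed

lemma C_k_const: "C_k n (\<lambda>_. c)"
proof (induction n arbitrary: c)
  case (Suc n)
  show ?case by (rule C_k_SucI[where g = "\<lambda>_ _. 0"]) (auto intro: Suc)
qed simp

lemma
  assumes "C_k (Suc n) f" "C_k (Suc n) g"
  shows partial_deriv_mult: "partial_deriv i (\<lambda>x. f x * g x) = (\<lambda>x. partial_deriv i f x * g x + f x * partial_deriv i g x)"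
    and partial_deriv_cmult: "partial_deriv i (\<lambda>x. c * f x) = (\<lambda>x. c * partial_deriv i f x)"
  using C_k_DERIV_0[OF assms(1), of _ i] C_k_DERIV_0[OF assms(2), of _ i]
  by (intro partial_deriv_eqI; auto intro!: derivative_eq_intros)+

lemma C_k_add: "C_k n f \<Longrightarrow> C_k n g \<Longrightarrow> C_k n (\<lambda>x. f x + g x)"
proof (induction n arbitrary: f g)
  case (Suc n)
  show ?case
  proof (rule C_k_SucI[where g = "\<lambda>i x. partial_deriv i f x + partial_deriv i g x"])
    show "continuous_on UNIV (\<lambda>x. f x + g x)"
      using Suc.prems[THEN C_k_continuous] by (intro continuous_intros)
  qed (intro DERIV_add C_k_DERIV_0[OF Suc.prems(1)] C_k_DERIV_0[OF Suc.prems(2)] Suc.IH C_k_partial_deriv Suc.prems)+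
qed (auto intro: continuous_intros)

lemma C_k_mult: "C_k n f \<Longrightarrow> C_k n g \<Longrightarrow> C_k n (\<lambda>x. f x * g x)"
proof (induction n arbitrary: f g)
  case (Suc n)
  have fg: "C_k n f" "C_k n g" using Suc.prems by (auto intro: C_k_mono)
  show ?case
  proof (rule C_k_SucI[where g = "\<lambda>i x. partial_deriv i f x * g x + f x * partial_deriv i g x"])
    show "continuous_on UNIV (\<lambda>x. f x * g x)"
      using Suc.prems[THEN C_k_continuous] by (intro continuous_intros)
    fix i
    show "C_k n (\<lambda>x. partial_deriv i f x * g x + f x * partial_deriv i g x)"
      using Suc.prems fg by (intro C_k_add Suc.IH C_k_partial_deriv)
    fix x
    show "((\<lambda>t. f (x + t *\<^sub>R axis i 1) * g (x + t *\<^sub>R axis i 1)) has_real_derivative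
        partial_deriv i f x * g x + f x * partial_deriv i g x) (at 0)"
      using C_k_DERIV_0[OF Suc.prems(1), of x i] C_k_DERIV_0[OF Suc.prems(2), of x i]
      by (auto intro!: derivative_eq_intros)
  qed
qed (auto intro: continuous_intros)

lemma C_k_cmult: "C_k n f \<Longrightarrow> C_k n (\<lambda>x. c * f x)"
  by (intro C_k_mult C_k_const)

lemma C_k_diff: "C_k n f \<Longrightarrow> C_k n g \<Longrightarrow> C_k n (\<lambda>x. f x - g x)"
  using C_k_add[OF _ C_k_cmult[of n g "-1"]] by simp

lemma C_k_component: "C_k n (\<lambda>x. x $ i)"
proof (cases n)
  case (Suc k)
  show ?thesis unfolding Suc
  proof (rule C_k_SucI[where g = "\<lambda>j _. axis j 1 $ i"])
    show "((\<lambda>t. (x + t *\<^sub>R axis j 1) $ i) has_real_derivative axis j 1 $ i) (at 0)" for x :: "real^'a" and j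
      by (auto intro!: derivative_eq_intros)
  qed (auto intro: continuous_intros C_k_const)
qed (auto intro: continuous_intros)

lemma DERIV_affine:
  assumes "C_k (Suc n) f"
  shows "((\<lambda>t. f (a + h *\<^sub>R (x + t *\<^sub>R axis i 1))) has_real_derivative h * partial_deriv i f (a + h *\<^sub>R x)) (at 0)"
proof -
  have 1: "((\<lambda>t. f ((a + h *\<^sub>R x) + t *\<^sub>R axis i 1)) has_real_derivative partial_deriv i f (a + h *\<^sub>R x)) (at (h * 0))"
    using C_k_DERIV_0[OF assms] by simp
  have 2: "((\<lambda>t. h * t) has_real_derivative h) (at 0)"
    by (auto intro!: derivative_eq_intros)
  have "((\<lambda>t. f ((a + h *\<^sub>R x) + (h * t) *\<^sub>R axis i 1)) has_real_derivative partial_deriv i f (a + h *\<^sub>R x) * h) (at 0)"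
    by (rule DERIV_chain2[OF 1 2])
  thus ?thesis by (simp add: algebra_simps)
qed

lemma partial_deriv_affine:
  "C_k (Suc n) f \<Longrightarrow> partial_deriv i (\<lambda>x. f (a + h *\<^sub>R x)) = (\<lambda>x. h * partial_deriv i f (a + h *\<^sub>R x))"
  by (intro partial_deriv_eqI DERIV_affine)

lemma C_k_affine: "C_k n f \<Longrightarrow> C_k n (\<lambda>x. f (a + h *\<^sub>R x))"
proof (induction n arbitrary: f)
  case 0
  thus ?case by (auto intro!: continuous_intros continuous_on_compose2[of UNIV f])
next
  case (Suc n)
  show ?case
  proof (rule C_k_SucI[where g = "\<lambda>i x. h * partial_deriv i f (a + h *\<^sub>R x)"])
    show "continuous_on UNIV (\<lambda>x. f (a + h *\<^sub>R x))"
      by (intro continuous_intros continuous_on_compose2[OF C_k_continuous[OF Suc.prems]]) auto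
  qed (intro DERIV_affine[OF Suc.prems] C_k_cmult Suc.IH C_k_partial_deriv Suc.prems)+
qed

text \<open>Clairaut's theorem: both mixed derivatives are limits of the same second difference quotient.\<close>

lemma second_difference_mean_value:
  assumes f: "C_k 2 f" and s: "0 < s"
  shows "\<exists>y. dist y x \<le> 2 * s \<and>
    f (x + s *\<^sub>R axis i 1 + s *\<^sub>R axis j 1) - f (x + s *\<^sub>R axis i 1) - f (x + s *\<^sub>R axis j 1) + f x
      = s\<^sup>2 * partial_deriv j (partial_deriv i f) y"
proof -
  let ?i = "axis i (1::real)" and ?j = "axis j (1::real)"
  have f2: "C_k (Suc (Suc 0)) f" using f by (simp add: numeral_2_eq_2)
  define \<phi> where "\<phi> t = f ((x + s *\<^sub>R ?j) + t *\<^sub>R ?i) - f (x + t *\<^sub>R ?i)" for t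
  have "\<exists>z>0. z < s \<and> \<phi> s - \<phi> 0 = (s - 0) *
      (partial_deriv i f ((x + s *\<^sub>R ?j) + z *\<^sub>R ?i) - partial_deriv i f (x + z *\<^sub>R ?i))"
    unfolding \<phi>_def by (intro MVT2 s DERIV_diff C_k_DERIV[OF f2])
  then obtain z where z: "0 < z" "z < s" and 1: "\<phi> s - \<phi> 0 = s *
      (partial_deriv i f ((x + s *\<^sub>R ?j) + z *\<^sub>R ?i) - partial_deriv i f (x + z *\<^sub>R ?i))" by auto
  have "\<exists>w>0. w < s \<and> partial_deriv i f ((x + z *\<^sub>R ?i) + s *\<^sub>R ?j) - partial_deriv i f ((x + z *\<^sub>R ?i) + 0 *\<^sub>R ?j)
      = (s - 0) * partial_deriv j (partial_deriv i f) ((x + z *\<^sub>R ?i) + w *\<^sub>R ?j)"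
    by (intro MVT2 s C_k_DERIV[OF C_k_partial_deriv[OF f2]])
  then obtain w where w: "0 < w" "w < s" and 2:
    "partial_deriv i f ((x + z *\<^sub>R ?i) + s *\<^sub>R ?j) - partial_deriv i f (x + z *\<^sub>R ?i)
      = s * partial_deriv j (partial_deriv i f) ((x + z *\<^sub>R ?i) + w *\<^sub>R ?j)" by auto
  show ?thesis
  proof (intro exI conjI)
    let ?y = "(x + z *\<^sub>R ?i) + w *\<^sub>R ?j"
    have "norm (z *\<^sub>R ?i + w *\<^sub>R ?j) \<le> z + w"
      using z w by (intro norm_triangle_le) simp
    thus "dist ?y x \<le> 2 * s" using z w by (simp add: dist_norm algebra_simps)
    have "partial_deriv i f ((x + s *\<^sub>R ?j) + z *\<^sub>R ?i) = partial_deriv i f ((x + z *\<^sub>R ?i) + s *\<^sub>R ?j)"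
      by (simp add: algebra_simps)
    with 1 2 have "\<phi> s - \<phi> 0 = s\<^sup>2 * partial_deriv j (partial_deriv i f) ?y"
      by (simp add: power2_eq_square)
    thus "f (x + s *\<^sub>R ?i + s *\<^sub>R ?j) - f (x + s *\<^sub>R ?i) - f (x + s *\<^sub>R ?j) + f x
      = s\<^sup>2 * partial_deriv j (partial_deriv i f) ?y"
      by (simp add: \<phi>_def algebra_simps)
  qed
qed

lemma partial_deriv_commute:
  assumes "C_k 2 f"
  shows "partial_deriv i (partial_deriv j f) = partial_deriv j (partial_deriv i f)"
proof
  fix x
  let ?s = "\<lambda>n. inverse (real (Suc n))"
  let ?D = "\<lambda>i j s. f (x + s *\<^sub>R axis i 1 + s *\<^sub>R axis j 1) - f (x + s *\<^sub>R axis i 1) - f (x + s *\<^sub>R axis j 1) + f x"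
  have ex: "\<exists>Y. (\<forall>n. dist (Y n) x \<le> 2 * ?s n \<and> ?D i j (?s n) = (?s n)\<^sup>2 * partial_deriv j (partial_deriv i f) (Y n))"
    for i j
    by (intro choice allI second_difference_mean_value[OF assms]) simp
  obtain Y where Y: "\<And>n. dist (Y n) x \<le> 2 * ?s n"
    "\<And>n. ?D i j (?s n) = (?s n)\<^sup>2 * partial_deriv j (partial_deriv i f) (Y n)" using ex[of i j] by blast
  obtain Z where Z: "\<And>n. dist (Z n) x \<le> 2 * ?s n"
    "\<And>n. ?D j i (?s n) = (?s n)\<^sup>2 * partial_deriv i (partial_deriv j f) (Z n)" using ex[of j i] by blast
  have eq: "partial_deriv j (partial_deriv i f) (Y n) = partial_deriv i (partial_deriv j f) (Z n)" for n
  proof -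
    have "?D i j (?s n) = ?D j i (?s n)" by (simp add: algebra_simps)
    hence "(?s n)\<^sup>2 * partial_deriv j (partial_deriv i f) (Y n) = (?s n)\<^sup>2 * partial_deriv i (partial_deriv j f) (Z n)"
      by (simp only: Y(2) Z(2))
    thus ?thesis by simp
  qed
  have lim: "W \<longlonglongrightarrow> x" if "\<And>n. dist (W n) x \<le> 2 * ?s n" for W
  proof (rule metric_tendsto_imp_tendsto[of "\<lambda>n. 2 * ?s n" 0])
    have "(\<lambda>n. 2 * ?s n) \<longlonglongrightarrow> 2 * 0" by (intro tendsto_intros LIMSEQ_inverse_real_of_nat)
    thus "(\<lambda>n. 2 * ?s n) \<longlonglongrightarrow> 0" by simp
  qed (use that in auto)
  have cont: "isCont (partial_deriv i (partial_deriv j f)) x" for i j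
    using assms by (simp add: numeral_2_eq_2 C_k.simps continuous_on_eq_continuous_at)
  have "(\<lambda>n. partial_deriv j (partial_deriv i f) (Y n)) \<longlonglongrightarrow> partial_deriv j (partial_deriv i f) x"
    by (rule isCont_tendsto_compose[OF cont lim[OF Y(1)]])
  moreover have "(\<lambda>n. partial_deriv i (partial_deriv j f) (Z n)) \<longlonglongrightarrow> partial_deriv i (partial_deriv j f) x"
    by (rule isCont_tendsto_compose[OF cont lim[OF Z(1)]])
  ultimately show "partial_deriv i (partial_deriv j f) x = partial_deriv j (partial_deriv i f) x"
    unfolding eq by (metis LIMSEQ_unique)
qed

text \<open>
  Iterated derivatives are indexed by words of coordinates, the head being applied last. A
  multi-index corresponds to the sorted word in which each coordinate has the prescribed
  multiplicity.
\<close>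

abbreviation word_deriv :: "'d::finite list \<Rightarrow> (real^'d \<Rightarrow> real) \<Rightarrow> real^'d \<Rightarrow> real" where
  "word_deriv w f \<equiv> foldr partial_deriv w f"

definition index_word :: "('d::{finite,linorder} \<Rightarrow> nat) \<Rightarrow> 'd list" where
  "index_word \<alpha> = concat (map (\<lambda>i. replicate (\<alpha> i) i) (sorted_list_of_set UNIV))"

lemma multi_deriv_eq_word_deriv: "multi_deriv \<alpha> f = word_deriv (index_word \<alpha>) f"
proof -
  have "foldr (\<lambda>i. partial_deriv i ^^ \<alpha> i) is f = foldr partial_deriv (concat (map (\<lambda>i. replicate (\<alpha> i) i) is)) f" for "is"
  proof (induction "is")
    case (Cons i js)
    have "(partial_deriv i ^^ n) g = foldr partial_deriv (replicate n i) g" for n g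
      by (induction n) auto
    with Cons show ?case by simp
  qed simp
  thus ?thesis by (simp add: multi_deriv_def index_word_def)
qed

lemma count_index_word: "count (mset (index_word \<alpha>)) i = \<alpha> i"
proof -
  have "count (mset (concat (map (\<lambda>i. replicate (\<alpha> i) i) xs))) i = (if i \<in> set xs then \<alpha> i else 0)"
    if "distinct xs" for xs
    using that by (induction xs) auto
  from this[of "sorted_list_of_set UNIV"] show ?thesis by (simp add: index_word_def)
qed

lemma length_index_word: "length (index_word \<alpha>) = (\<Sum>i\<in>UNIV. \<alpha> i)"
proof -
  have "length (index_word \<alpha>) = size (mset (index_word \<alpha>))" by simp
  also have "\<dots> = (\<Sum>i\<in>set_mset (mset (index_word \<alpha>)). \<alpha> i)"
    by (subst size_multiset_overloaded_eq) (auto intro!: sum.cong count_index_word)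
  also have "\<dots> = (\<Sum>i\<in>UNIV. \<alpha> i)"
  proof (rule sum.mono_neutral_left)
    show "\<forall>i\<in>UNIV - set_mset (mset (index_word \<alpha>)). \<alpha> i = 0"
      using count_index_word[of \<alpha>] by (metis DiffD2 count_eq_zero_iff)
  qed auto
  finally show ?thesis .
qed

lemma index_word_length_le: "\<alpha> \<in> multi_indices k \<longleftrightarrow> length (index_word \<alpha>) \<le> k"
  by (simp add: multi_indices_def length_index_word)

lemma C_k_word_deriv: "C_k (n + length w) f \<Longrightarrow> C_k n (word_deriv w f)"
proof (induction w arbitrary: n)
  case (Cons i w)
  have "C_k (Suc n) (word_deriv w f)" using Cons.prems by (intro Cons.IH) simp
  thus ?case by (simp add: C_k_partial_deriv)
qed simp

lemma word_deriv_continuous: "C_k n f \<Longrightarrow> length w \<le> n \<Longrightarrow> continuous_on UNIV (word_deriv w f)"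
  by (rule C_k_continuous[of 0], rule C_k_word_deriv) (auto intro: C_k_mono)

lemma partial_deriv_word_deriv_commute:
  "C_k (Suc (length w)) f \<Longrightarrow> word_deriv w (partial_deriv i f) = partial_deriv i (word_deriv w f)"
proof (induction w)
  case (Cons j w)
  have "C_k (2 + length w) f" using Cons.prems by (simp add: numeral_2_eq_2)
  hence C: "C_k 2 (word_deriv w f)" by (rule C_k_word_deriv)
  have "C_k (Suc (length w)) f" using Cons.prems by (rule C_k_mono) simp
  from Cons.IH[OF this] show ?case by (simp add: partial_deriv_commute[OF C, of i j])
qed simp

lemma word_deriv_mset_cong:
  assumes "mset v = mset w" "C_k (length v) f"
  shows "word_deriv v f = word_deriv w f"
  using assms
proof (induction v arbitrary: w)
  case (Cons i v)
  have "i \<in> set w" using Cons.prems(1) by (metis list.set_intros(1) set_mset_mset)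
  then obtain us vs where w: "w = us @ i # vs" by (meson split_list)
  have m: "mset v = mset (us @ vs)" using Cons.prems(1) by (simp add: w)
  have len: "length v = length us + length vs" using mset_eq_length[OF m] by simp
  have "C_k (Suc (length us)) (word_deriv vs f)"
    using Cons.prems(2) len by (intro C_k_word_deriv) (simp only: length_Cons add_Suc)
  from partial_deriv_word_deriv_commute[OF this, of i]
  have "word_deriv w f = partial_deriv i (word_deriv (us @ vs) f)" by (simp add: w)
  also have "word_deriv (us @ vs) f = word_deriv v f"
    using Cons.prems(2) by (intro Cons.IH[symmetric] m) (rule C_k_mono, assumption, simp)
  finally show ?case by simp
qed simp

lemma word_deriv_eq_multi_deriv:
  fixes f :: "real^'d::{finite,linorder} \<Rightarrow> real"
  assumes "C_k (length w) f"
  shows "\<exists>\<alpha>. (\<Sum>i\<in>UNIV. \<alpha> i) = length w \<and> word_deriv w f = multi_deriv \<alpha> f"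
proof -
  define \<alpha> where "\<alpha> i = count (mset w) i" for i
  have m: "mset w = mset (index_word \<alpha>)"
    by (rule multiset_eqI) (simp add: count_index_word \<alpha>_def)
  hence "length w = (\<Sum>i\<in>UNIV. \<alpha> i)" using mset_eq_length[OF m] by (simp add: length_index_word)
  with word_deriv_mset_cong[OF m assms] show ?thesis
    unfolding multi_deriv_eq_word_deriv by metis
qed

lemma word_deriv_diff:
  "C_k (length w) f \<Longrightarrow> C_k (length w) g \<Longrightarrow>
    word_deriv w (\<lambda>x. f x - g x) = (\<lambda>x. word_deriv w f x - word_deriv w g x)"
proof (induction w)
  case (Cons i w)
  have C: "C_k (Suc 0) (word_deriv w f)" "C_k (Suc 0) (word_deriv w g)"
    using Cons.prems by (intro C_k_word_deriv; simp)+
  have "word_deriv w (\<lambda>x. f x - g x) = (\<lambda>x. word_deriv w f x - word_deriv w g x)"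
    by (rule Cons.IH) (use Cons.prems in \<open>auto intro: C_k_mono\<close>)
  moreover have "partial_deriv i (\<lambda>x. word_deriv w f x - word_deriv w g x)
      = (\<lambda>x. partial_deriv i (word_deriv w f) x - partial_deriv i (word_deriv w g) x)"
    by (intro partial_deriv_eqI DERIV_diff C_k_DERIV_0[OF C(1)] C_k_DERIV_0[OF C(2)])
  ultimately show ?case by simp
qed simp

lemma word_deriv_cmult: "C_k (length w) f \<Longrightarrow> word_deriv w (\<lambda>x. c * f x) = (\<lambda>x. c * word_deriv w f x)"
proof (induction w)
  case (Cons i w)
  have C: "C_k (Suc 0) (word_deriv w f)" "C_k (length w) f"
    using Cons.prems by (auto intro: C_k_word_deriv C_k_mono)
  show ?case using Cons.IH[OF C(2)] partial_deriv_cmult[OF C(1) C(1), of i c] by simp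
qed simp

lemma word_deriv_translate:
  "C_k (length w) f \<Longrightarrow> word_deriv w (\<lambda>x. f (x + y)) = (\<lambda>x. word_deriv w f (x + y))"
proof (induction w)
  case (Cons i w)
  have C: "C_k (Suc 0) (word_deriv w f)" using Cons.prems by (intro C_k_word_deriv) simp
  have "word_deriv w (\<lambda>x. f (x + y)) = (\<lambda>x. word_deriv w f (x + y))"
    by (rule Cons.IH) (use Cons.prems in \<open>auto intro: C_k_mono\<close>)
  with partial_deriv_affine[OF C, of i y 1] show ?case by (simp add: add.commute)
qed simp

lemma C_k_translate: "C_k n f \<Longrightarrow> C_k n (\<lambda>x. f (x + y))"
  using C_k_affine[of n f y 1] by (simp add: add.commute)

section \<open>Compactly supported smooth functions\<close>

text \<open>
  The functions \<open>p (1 / x) exp (- 1 / x)\<close> for \<open>x > 0\<close>, extended by 0, where \<open>p\<close> is a polynomial.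
  They are closed under differentiation.
\<close>

definition flat :: "real poly \<Rightarrow> real \<Rightarrow> real" where
  "flat p x = (if 0 < x then poly p (1 / x) * exp (- (1 / x)) else 0)"

lemma poly_times_exp_tendsto_0: "((\<lambda>t. poly p t * exp (- t)) \<longlongrightarrow> (0::real)) at_top"
proof -
  have "((\<lambda>t. \<Sum>k\<le>degree p. coeff p k * (t ^ k / exp t)) \<longlongrightarrow> (\<Sum>k\<le>degree p. coeff p k * 0)) at_top"
    by (intro tendsto_intros tendsto_power_div_exp_0)
  thus ?thesis by (simp add: poly_altdef sum_distrib_right exp_minus divide_inverse mult.assoc)
qed

lemma flat_DERIV: "(flat p has_real_derivative flat ([:0, 0, 1:] * (p - pderiv p)) x) (at x)"
proof (cases x "0::real" rule: linorder_cases)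
  case less
  have "((\<lambda>_. 0) has_real_derivative 0) (at x)" by simp
  moreover have "eventually (\<lambda>y. y < 0) (nhds x)" using less by (intro eventually_nhds_in_open[of "{..<0}", simplified]) auto
  hence "eventually (\<lambda>y. flat p y = 0) (nhds x)" by eventually_elim (simp add: flat_def)
  ultimately have "(flat p has_real_derivative 0) (at x)"
    using DERIV_cong_ev[of x x "flat p" "\<lambda>_. 0" 0 0] by simp
  thus ?thesis using less by (simp add: flat_def)
next
  case greater
  have "((\<lambda>x. poly p (1 / x) * exp (- (1 / x))) has_real_derivative
      flat ([:0, 0, 1:] * (p - pderiv p)) x) (at x)"
    using greater
    by (auto intro!: derivative_eq_intros DERIV_chain2[OF poly_DERIV] simp: flat_def field_simps power2_eq_square)
  moreover have "eventually (\<lambda>y. 0 < y) (nhds x)" using greater by (intro eventually_nhds_in_open[of "{0<..}", simplified]) auto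
  hence "eventually (\<lambda>y. flat p y = poly p (1 / y) * exp (- (1 / y))) (nhds x)" by eventually_elim (simp add: flat_def)
  ultimately show ?thesis
    using DERIV_cong_ev[of x x "flat p" "\<lambda>x. poly p (1 / x) * exp (- (1 / x))"] by simp
next
  case equal
  have "((\<lambda>h. flat p h / h) \<longlongrightarrow> 0) (at 0)"
    unfolding filterlim_at_split
  proof
    show "((\<lambda>h. flat p h / h) \<longlongrightarrow> 0) (at_left 0)"
      by (rule tendsto_eventually) (auto simp: eventually_at_filter flat_def)
    have "((\<lambda>h. poly (pCons 0 p) (inverse h) * exp (- inverse h)) \<longlongrightarrow> 0) (at_right 0)"
      by (rule filterlim_compose[OF poly_times_exp_tendsto_0 filterlim_inverse_at_top_right])
    moreover have "eventually (\<lambda>h. poly (pCons 0 p) (inverse h) * exp (- inverse h) = flat p h / h) (at_right 0)"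
      by (auto simp: eventually_at_filter flat_def field_simps)
    ultimately show "((\<lambda>h. flat p h / h) \<longlongrightarrow> 0) (at_right 0)"
      by (rule Lim_transform_eventually)
  qed
  thus ?thesis unfolding DERIV_def by (simp add: equal flat_def)
qed

text \<open>Smooth functions supported in the closed unit ball.\<close>

definition test_functions :: "(real^'d::finite \<Rightarrow> real) set" where
  "test_functions = {G. C_infinity G \<and> (\<forall>x. 1 < norm x \<longrightarrow> G x = 0)}"

lemma test_function_C_k: "G \<in> test_functions \<Longrightarrow> C_k n G"
  by (simp add: test_functions_def C_infinity_def)

lemma test_function_support: "G \<in> test_functions \<Longrightarrow> 1 < norm x \<Longrightarrow> G x = 0"
  by (simp add: test_functions_def)

lemma integrable_unit_ball_support:
  fixes u :: "'a::euclidean_space \<Rightarrow> real"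
  assumes "continuous_on UNIV u" and "\<And>x. 1 < norm x \<Longrightarrow> u x = 0"
  shows "integrable lborel u"
proof -
  have "integrable lborel (\<lambda>x. indicator (cball 0 1) x *\<^sub>R u x)"
    using assms(1) by (intro borel_integrable_compact) (auto intro: continuous_on_subset)
  also have "(\<lambda>x. indicator (cball 0 1) x *\<^sub>R u x) = u"
    using assms(2) by (intro ext) (auto simp: indicator_def not_le)
  finally show ?thesis .
qed

lemma bounded_unit_ball_support:
  fixes u :: "'a::euclidean_space \<Rightarrow> real"
  assumes "continuous_on UNIV u" and "\<And>x. 1 < norm x \<Longrightarrow> u x = 0"
  obtains B where "0 < B" "\<And>x. \<bar>u x\<bar> \<le> B"
proof -
  have "bounded (u ` cball 0 1)"
    using assms(1) by (intro compact_imp_bounded compact_continuous_image) (auto intro: continuous_on_subset)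
  then obtain B where B: "0 < B" "\<And>x. x \<in> cball 0 1 \<Longrightarrow> \<bar>u x\<bar> \<le> B"
    unfolding bounded_pos by auto
  have "\<bar>u x\<bar> \<le> B" for x
    using B assms(2)[of x] by (cases "norm x \<le> 1") auto
  with B(1) show ?thesis by (rule that)
qed

lemma test_function_continuous: "G \<in> test_functions \<Longrightarrow> continuous_on UNIV G"
  using C_k_continuous[OF test_function_C_k[of G 0]] .

lemma test_function_integrable: "G \<in> test_functions \<Longrightarrow> integrable lborel G"
  by (intro integrable_unit_ball_support test_function_continuous test_function_support)

lemma test_function_measurable: "G \<in> test_functions \<Longrightarrow> G \<in> borel_measurable borel"
  by (intro borel_measurable_continuous_onI test_function_continuous)

lemma test_function_bounded:
  assumes "G \<in> test_functions" obtains B where "0 < B" "\<And>x. \<bar>G x\<bar> \<le> B"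
  using bounded_unit_ball_support[OF test_function_continuous[OF assms] test_function_support[OF assms]] by blast

lemma partial_deriv_test_function:
  assumes "G \<in> test_functions" shows "partial_deriv i G \<in> test_functions"
proof -
  have "partial_deriv i G x = 0" if x: "1 < norm x" for x
  proof -
    have "open {t. 1 < norm (x + t *\<^sub>R axis i (1::real))}"
      by (intro open_Collect_less continuous_intros)
    moreover have "0 \<in> {t. 1 < norm (x + t *\<^sub>R axis i (1::real))}" using x by simp
    ultimately have "eventually (\<lambda>t. t \<in> {t. 1 < norm (x + t *\<^sub>R axis i (1::real))}) (nhds 0)"
      by (rule eventually_nhds_in_open)
    hence ev: "eventually (\<lambda>t. G (x + t *\<^sub>R axis i 1) = 0) (nhds 0)"
      by eventually_elim (use assms in \<open>auto intro: test_function_support\<close>)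
    have "((\<lambda>t. G (x + t *\<^sub>R axis i 1)) has_real_derivative 0) (at 0)"
      using DERIV_cong_ev[OF refl ev refl, of 0] by simp
    thus ?thesis unfolding partial_deriv_def by (rule DERIV_imp_deriv)
  qed
  moreover have "C_k n (partial_deriv i G)" for n
    by (rule C_k_partial_deriv[OF test_function_C_k[OF assms]])
  ultimately show ?thesis by (simp add: test_functions_def C_infinity_def)
qed

lemma word_deriv_test_function: "G \<in> test_functions \<Longrightarrow> word_deriv w G \<in> test_functions"
  by (induction w) (auto intro: partial_deriv_test_function)

lemma C_k_flat_radial: "C_k n (\<lambda>x::real^'d::finite. flat p (1 - x \<bullet> x))"
proof (induction n arbitrary: p)
  case 0
  have "continuous_on UNIV (flat p)"
    using flat_DERIV by (auto intro!: DERIV_isCont simp: continuous_on_eq_continuous_at)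
  thus ?case by (auto intro!: continuous_intros continuous_on_compose2[of UNIV "flat p"])
next
  case (Suc n)
  let ?q = "[:0, 0, 1:] * (p - pderiv p)"
  show ?case
  proof (rule C_k_SucI[where g = "\<lambda>i x. flat ?q (1 - x \<bullet> x) * (- 2 * x $ i)"])
    show "continuous_on UNIV (\<lambda>x::real^'d. flat p (1 - x \<bullet> x))" by (rule C_k_continuous[OF Suc])
  next
    show "C_k n (\<lambda>x::real^'d. flat ?q (1 - x \<bullet> x) * (- 2 * x $ i))" for i
      by (intro C_k_mult Suc C_k_cmult C_k_component)
  next
    fix i and x :: "real^'d"
    have 1: "(flat p has_real_derivative flat ?q (1 - x \<bullet> x))
        (at (1 - (x + 0 *\<^sub>R axis i 1) \<bullet> (x + 0 *\<^sub>R axis i 1)))"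
      using flat_DERIV[of p "1 - x \<bullet> x"] by simp
    have "(\<lambda>t. 1 - (x + t *\<^sub>R axis i 1) \<bullet> (x + t *\<^sub>R axis i 1)) = (\<lambda>t. 1 - x \<bullet> x - 2 * t * x $ i - t * t)"
      by (rule ext) (simp add: inner_add_left inner_add_right inner_axis inner_axis' algebra_simps)
    moreover have "((\<lambda>t. 1 - x \<bullet> x - 2 * t * x $ i - t * t) has_real_derivative (- 2 * x $ i)) (at 0)"
      by (auto intro!: derivative_eq_intros)
    ultimately have 2: "((\<lambda>t. 1 - (x + t *\<^sub>R axis i 1) \<bullet> (x + t *\<^sub>R axis i 1)) has_real_derivative (- 2 * x $ i)) (at 0)"
      by simp
    show "((\<lambda>t. flat p (1 - (x + t *\<^sub>R axis i 1) \<bullet> (x + t *\<^sub>R axis i 1))) has_real_derivative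
        flat ?q (1 - x \<bullet> x) * (- 2 * x $ i)) (at 0)"
      by (rule DERIV_chain2[OF 1 2])
  qed
qed

text \<open>The normalisation of \<open>x \<mapsto> exp (- 1 / (1 - \<bar>x\<bar>\<^sup>2))\<close>.\<close>

lemma mollifier_exists:
  obtains \<eta> :: "real^'d::finite \<Rightarrow> real"
  where "\<eta> \<in> test_functions" "\<And>x. 0 \<le> \<eta> x" "integral\<^sup>L lborel \<eta> = 1"
proof -
  define u :: "real^'d \<Rightarrow> real" where "u x = flat 1 (1 - x \<bullet> x)" for x
  have C: "C_k n u" for n unfolding u_def by (rule C_k_flat_radial)
  have supp: "u x = 0" if "1 < norm x" for x
  proof -
    have "1 < x \<bullet> x" using that by (simp add: dot_square_norm one_less_power)
    thus ?thesis by (simp add: u_def flat_def)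
  qed
  have nonneg: "0 \<le> u x" for x by (simp add: u_def flat_def)
  have int: "integrable lborel u"
    by (rule integrable_unit_ball_support[OF C_k_continuous[OF C[of 0]] supp])
  have "integral\<^sup>L lborel u \<noteq> 0"
  proof
    assume "integral\<^sup>L lborel u = 0"
    hence "AE x in lborel. u x = 0" using integral_nonneg_eq_0_iff_AE[OF int] nonneg by simp
    hence "AE x in lborel. x \<notin> ball (0::real^'d) 1"
    proof eventually_elim
      case (elim x)
      show ?case
      proof
        assume "x \<in> ball 0 1"
        hence "0 < 1 - x \<bullet> x" by (simp add: dot_square_norm abs_square_less_1)
        hence "0 < u x" by (simp add: u_def flat_def)
        with elim show False by simp
      qed
    qed
    hence "emeasure lborel (ball (0::real^'d) 1) = 0"
      by (subst (asm) AE_iff_measurable[OF _ refl]) (auto simp: ball_def)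
    thus False using emeasure_ball[of 1 "0::real^'d"] unit_ball_vol_pos[of "real CARD('d)"] by simp
  qed
  moreover have "0 \<le> integral\<^sup>L lborel u" using nonneg by simp
  ultimately have I: "0 < integral\<^sup>L lborel u" by simp
  show thesis
  proof (rule that[of "\<lambda>x. inverse (integral\<^sup>L lborel u) * u x"])
    show "(\<lambda>x. inverse (integral\<^sup>L lborel u) * u x) \<in> test_functions"
      using supp C by (auto simp: test_functions_def C_infinity_def intro: C_k_cmult)
  qed (use I nonneg in auto)
qed

lemma
  fixes f :: "'a::euclidean_space \<Rightarrow> real"
  assumes "f \<in> borel_measurable borel"
  shows lborel_integral_translate: "integral\<^sup>L lborel (\<lambda>y. f (y + a)) = integral\<^sup>L lborel f"
    and lborel_integrable_translate: "integrable lborel (\<lambda>y. f (y + a)) \<longleftrightarrow> integrable lborel f"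
  using assms integral_distr[of "\<lambda>x. a + x" lborel borel f] integrable_distr_eq[of "\<lambda>x. a + x" lborel borel f]
  by (simp_all add: lborel_distr_plus add.commute[of _ a])

text \<open>
  Integration by parts. The integral of \<open>\<partial>\<^sub>i u\<close> over the space is that of
  \<open>u (y + e\<^sub>i) - u y\<close>, by Fubini and the fundamental theorem of calculus.
\<close>

lemma integral_partial_deriv_eq_0:
  fixes u :: "real^'d::finite \<Rightarrow> real"
  assumes u: "C_k (Suc 0) u" and supp: "\<And>x. 1 < norm x \<Longrightarrow> u x = 0" "\<And>x. 1 < norm x \<Longrightarrow> partial_deriv i u x = 0"
  shows "integral\<^sup>L lborel (partial_deriv i u) = 0"
proof -
  let ?v = "partial_deriv i u" and ?e = "axis i (1::real)"
  have v: "continuous_on UNIV ?v" using C_k_partial_deriv[OF u] by simp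
  have [measurable]: "?v \<in> borel_measurable borel" by (rule borel_measurable_continuous_onI[OF v])
  have iu: "integrable lborel u" by (rule integrable_unit_ball_support[OF C_k_continuous[OF u] supp(1)])
  have iv: "integrable lborel ?v" by (rule integrable_unit_ball_support[OF v supp(2)])
  let ?f = "\<lambda>t y. indicator {0..1::real} t * ?v (y + t *\<^sub>R ?e)"
  have int: "integrable (lborel \<Otimes>\<^sub>M lborel) (\<lambda>(t, y). ?f t y)"
  proof (rule lborel_pair.Fubini_integrable)
    show "AE t in lborel. integrable lborel (\<lambda>y. case (t, y) of (t, y) \<Rightarrow> ?f t y)"
      using iv by (auto simp: lborel_integrable_translate)
    have "(\<integral>y. norm (?f t y) \<partial>lborel) = indicator {0..1} t * (\<integral>y. norm (?v y) \<partial>lborel)" for t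
      using lborel_integral_translate[of "\<lambda>y. norm (?v y)"] by (simp add: abs_mult)
    thus "integrable lborel (\<lambda>t. \<integral>y. norm (case (t, y) of (t, y) \<Rightarrow> ?f t y) \<partial>lborel)"
      by simp
  qed measurable
  have inner: "(\<integral>t. ?f t y \<partial>lborel) = u (y + ?e) - u y" for y
  proof -
    have "(\<integral>t. ?v (y + t *\<^sub>R ?e) * indicator {0..1::real} t \<partial>lborel) = u (y + 1 *\<^sub>R ?e) - u (y + 0 *\<^sub>R ?e)"
      using v by (intro integral_FTC_Icc_real C_k_DERIV[OF u])
        (auto intro!: continuous_intros simp: continuous_on_eq_continuous_at intro: isCont_o2)
    thus ?thesis by (simp add: mult.commute)
  qed
  have "integral\<^sup>L lborel ?v = (\<integral>t. indicator {0..1::real} t * integral\<^sup>L lborel ?v \<partial>lborel)" by simp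
  also have "\<dots> = (\<integral>t. (\<integral>y. ?f t y \<partial>lborel) \<partial>lborel)"
    using lborel_integral_translate[of ?v] by simp
  also have "\<dots> = (\<integral>y. (\<integral>t. ?f t y \<partial>lborel) \<partial>lborel)"
    by (rule lborel_pair.Fubini_integral[symmetric, OF int])
  also have "\<dots> = (\<integral>y. u (y + ?e) - u y \<partial>lborel)" by (simp only: inner)
  also have "\<dots> = 0"
    using iu lborel_integral_translate[of u ?e] lborel_integrable_translate[of u ?e] by simp
  finally show ?thesis .
qed

lemma integration_by_parts:
  assumes G: "G \<in> test_functions" and g: "C_k (Suc 0) g" and h: "h \<noteq> 0"
  shows "(\<integral>y. G y * partial_deriv i g (x + h *\<^sub>R y) \<partial>lborel)
       = - (1 / h) * (\<integral>y. partial_deriv i G y * g (x + h *\<^sub>R y) \<partial>lborel)"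
proof -
  let ?g = "\<lambda>y. g (x + h *\<^sub>R y)"
  have G1: "C_k (Suc 0) G" and G': "partial_deriv i G \<in> test_functions"
    using G by (auto intro: test_function_C_k partial_deriv_test_function)
  have g1: "C_k (Suc 0) ?g" by (rule C_k_affine[OF g])
  have pg: "partial_deriv i ?g = (\<lambda>y. h * partial_deriv i g (x + h *\<^sub>R y))" by (rule partial_deriv_affine[OF g])
  have eq: "partial_deriv i (\<lambda>y. G y * ?g y) = (\<lambda>y. partial_deriv i G y * ?g y + h * (G y * partial_deriv i g (x + h *\<^sub>R y)))"
    unfolding partial_deriv_mult[OF G1 g1] pg by (simp add: algebra_simps)
  have cont: "continuous_on UNIV (\<lambda>y. partial_deriv i g (x + h *\<^sub>R y))"
    using C_k_affine[OF C_k_partial_deriv[OF g], of i x h] by simp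
  have i1: "integrable lborel (\<lambda>y. partial_deriv i G y * ?g y)"
    by (rule integrable_unit_ball_support)
       (auto intro!: continuous_intros test_function_continuous[OF G'] C_k_continuous[OF g1] simp: test_function_support[OF G'])
  have i2: "integrable lborel (\<lambda>y. G y * partial_deriv i g (x + h *\<^sub>R y))"
    by (rule integrable_unit_ball_support)
       (auto intro!: continuous_on_mult test_function_continuous[OF G] cont simp: test_function_support[OF G])
  have "integral\<^sup>L lborel (partial_deriv i (\<lambda>y. G y * ?g y)) = 0"
  proof (rule integral_partial_deriv_eq_0)
    show "C_k (Suc 0) (\<lambda>y. G y * ?g y)" by (rule C_k_mult[OF G1 g1])
  qed (simp_all add: eq test_function_support[OF G] test_function_support[OF G'])
  hence "(\<integral>y. partial_deriv i G y * ?g y \<partial>lborel) + h * (\<integral>y. G y * partial_deriv i g (x + h *\<^sub>R y) \<partial>lborel) = 0"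
    unfolding eq using i1 i2 by simp
  thus ?thesis using h by (simp add: field_simps)
qed

text \<open>The kernel is differentiated in the reverse order, the outermost derivative of \<open>g\<close> being moved first.\<close>

lemma integration_by_parts_word:
  assumes "G \<in> test_functions" "C_k (length w) g" "h \<noteq> 0"
  shows "(\<integral>y. G y * word_deriv w g (x + h *\<^sub>R y) \<partial>lborel)
       = (- (1 / h)) ^ length w * (\<integral>y. word_deriv (rev w) G y * g (x + h *\<^sub>R y) \<partial>lborel)"
  using assms
proof (induction w arbitrary: G)
  case (Cons i w)
  have C: "C_k (Suc 0) (word_deriv w g)" "C_k (length w) g"
    using Cons.prems(2) by (auto intro: C_k_word_deriv C_k_mono)
  show ?case
    using integration_by_parts[OF Cons.prems(1) C(1) \<open>h \<noteq> 0\<close>, of i x]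
      Cons.IH[OF partial_deriv_test_function[OF Cons.prems(1)] C(2) \<open>h \<noteq> 0\<close>, of i]
    by simp
qed simp

section \<open>Test functions for the distances\<close>

text \<open>
  Operators that commute with differentiation up to a factor preserve smoothness. They are
  applied below to rescaled test functions and to their convolutions with bounded functions.
\<close>

lemma
  fixes L :: "(real^'d::finite \<Rightarrow> real) \<Rightarrow> real^'d \<Rightarrow> real"
  assumes cont: "\<And>G. G \<in> test_functions \<Longrightarrow> continuous_on UNIV (L G)"
    and deriv: "\<And>G i x. G \<in> test_functions \<Longrightarrow>
      ((\<lambda>t. L G (x + t *\<^sub>R axis i 1)) has_real_derivative c * L (partial_deriv i G) x) (at 0)"
    and G: "G \<in> test_functions"
  shows C_infinity_intertwining: "C_infinity (L G)"
    and word_deriv_intertwining: "word_deriv w (L G) = (\<lambda>x. c ^ length w * L (word_deriv w G) x)"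
proof -
  have C: "C_k n (L G)" if "G \<in> test_functions" for n G
    using that
  proof (induction n arbitrary: G)
    case (Suc n)
    show ?case
      by (rule C_k_SucI[where g = "\<lambda>i x. c * L (partial_deriv i G) x"])
         (auto intro!: cont deriv Suc C_k_cmult partial_deriv_test_function)
  qed (simp add: cont)
  thus "C_infinity (L G)" using G by (simp add: C_infinity_def)
  show "word_deriv w (L G) = (\<lambda>x. c ^ length w * L (word_deriv w G) x)"
  proof (induction w)
    case (Cons i w)
    have G': "word_deriv w G \<in> test_functions" using G by (rule word_deriv_test_function)
    have "partial_deriv i (L (word_deriv w G)) = (\<lambda>x. c * L (word_deriv (i # w) G) x)"
      using deriv[OF G'] by (intro partial_deriv_eqI) simp
    moreover have "partial_deriv i (\<lambda>x. c ^ length w * L (word_deriv w G) x)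
        = (\<lambda>x. c ^ length w * partial_deriv i (L (word_deriv w G)) x)"
      using C[OF G', of "Suc 0"] by (intro partial_deriv_cmult)
    ultimately show ?case using Cons by (simp add: mult_ac)
  qed simp
qed


lemma integrable_mult_bounded:
  fixes f g :: "'a \<Rightarrow> real"
  assumes "integrable M f" and "g \<in> borel_measurable M" "\<And>x. \<bar>g x\<bar> \<le> B"
  shows "integrable M (\<lambda>x. f x * g x)"
proof (rule Bochner_Integration.integrable_bound)
  show "integrable M (\<lambda>x. B * f x)" using assms(1) by simp
  have "\<bar>f x * g x\<bar> \<le> \<bar>B * f x\<bar>" for x
  proof -
    have "\<bar>f x * g x\<bar> \<le> \<bar>f x\<bar> * B" unfolding abs_mult by (intro mult_left_mono assms) simp
    also have "\<dots> \<le> \<bar>B * f x\<bar>" by (simp add: abs_mult mult.commute mult_right_mono)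
    finally show ?thesis .
  qed
  thus "AE x in M. norm (f x * g x) \<le> norm (B * f x)" by simp
qed (use assms in measurable)

text \<open>Translating the kernel turns the increments of the convolution into increments of \<open>G\<close>.\<close>

lemma convolution_shift:
  fixes G \<sigma> :: "'a::euclidean_space \<Rightarrow> real"
  assumes [measurable]: "G \<in> borel_measurable borel" "\<sigma> \<in> borel_measurable borel" and h: "h \<noteq> 0"
  shows "(\<integral>y. G y * \<sigma> (z + v - h *\<^sub>R y) \<partial>lborel) = (\<integral>y. G (y + (1 / h) *\<^sub>R v) * \<sigma> (z - h *\<^sub>R y) \<partial>lborel)"
proof -
  have "(\<integral>y. G y * \<sigma> (z + v - h *\<^sub>R y) \<partial>lborel)
      = (\<integral>y. G (y + (1 / h) *\<^sub>R v) * \<sigma> (z + v - h *\<^sub>R (y + (1 / h) *\<^sub>R v)) \<partial>lborel)"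
    by (rule lborel_integral_translate[symmetric]) measurable
  also have "(\<lambda>y. z + v - h *\<^sub>R (y + (1 / h) *\<^sub>R v)) = (\<lambda>y. z - h *\<^sub>R y)"
    using h by (auto simp: algebra_simps)
  finally show ?thesis by (simp add: fun_eq_iff)
qed

lemma
  fixes \<sigma> :: "real^'d::finite \<Rightarrow> real"
  assumes \<sigma> [measurable]: "\<sigma> \<in> borel_measurable borel" and \<sigma>_le: "\<And>x. \<bar>\<sigma> x\<bar> \<le> 1" and h: "h \<noteq> 0"
    and G: "G \<in> test_functions"
  shows convolution_continuous: "continuous_on UNIV (\<lambda>z. \<integral>y. G y * \<sigma> (z - h *\<^sub>R y) \<partial>lborel)"
    and convolution_DERIV: "((\<lambda>t. \<integral>y. G y * \<sigma> (x + t *\<^sub>R axis i 1 - h *\<^sub>R y) \<partial>lborel) has_real_derivative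
      (1 / h) * (\<integral>y. partial_deriv i G y * \<sigma> (x - h *\<^sub>R y) \<partial>lborel)) (at 0)"
proof -
  let ?L = "\<lambda>G z. \<integral>y. G y * \<sigma> (z - h *\<^sub>R y) \<partial>lborel"
  note [measurable] = test_function_measurable[OF G] test_function_measurable[OF partial_deriv_test_function[OF G]]
  have dom: "integrable lborel (\<lambda>y::real^'d. C * indicator (cball 0 K) y)" for C K :: real
    using emeasure_bounded_finite[of "cball (0::real^'d) K"]
    by (intro integrable_mult_right integrable_real_indicator) auto
  obtain B where B: "0 < B" "\<And>y. \<bar>G y\<bar> \<le> B" using test_function_bounded[OF G] by metis
  obtain B' where B': "0 < B'" "\<And>y. \<bar>partial_deriv i G y\<bar> \<le> B'"
    using test_function_bounded[OF partial_deriv_test_function[OF G]] by metis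
  have outside: "G (y + w) = 0" if "norm w \<le> K" "y \<notin> cball 0 (1 + K)" for y w K
  proof -
    have "norm y \<le> norm (y + w) + norm w" using norm_triangle_ineq4[of "y + w" w] by simp
    hence "1 < norm (y + w)" using that by simp
    thus ?thesis by (rule test_function_support[OF G])
  qed
  have "isCont (?L G) z" for z
    unfolding continuous_at_sequentially
  proof (intro allI impI)
    fix X assume X: "X \<longlonglongrightarrow> z"
    define W where "W n = (1 / h) *\<^sub>R (X n - z)" for n
    have "W \<longlonglongrightarrow> (1 / h) *\<^sub>R (z - z)" unfolding W_def by (intro tendsto_intros X)
    hence W: "W \<longlonglongrightarrow> 0" by simp
    hence "Bseq W" by (intro convergent_imp_Bseq) (auto simp: convergent_def)
    then obtain K where K: "\<And>n. norm (W n) \<le> K" unfolding Bseq_def by auto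
    have L: "(?L G \<circ> X) n = (\<integral>y. G (y + W n) * \<sigma> (z - h *\<^sub>R y) \<partial>lborel)" for n
      using convolution_shift[of G \<sigma> h z "X n - z"] h by (simp add: W_def)
    have "(\<lambda>n. \<integral>y. G (y + W n) * \<sigma> (z - h *\<^sub>R y) \<partial>lborel) \<longlonglongrightarrow> ?L G z"
    proof (rule integral_dominated_convergence[where w = "\<lambda>y. B * indicator (cball 0 (1 + K)) y"])
      show "AE y in lborel. norm (G (y + W n) * \<sigma> (z - h *\<^sub>R y)) \<le> B * indicator (cball 0 (1 + K)) y" for n
      proof (intro AE_I2)
        fix y
        show "norm (G (y + W n) * \<sigma> (z - h *\<^sub>R y)) \<le> B * indicator (cball 0 (1 + K)) y"
        proof (cases "y \<in> cball 0 (1 + K)")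
          case True
          have "\<bar>G (y + W n)\<bar> * \<bar>\<sigma> (z - h *\<^sub>R y)\<bar> \<le> B * 1" using B \<sigma>_le by (intro mult_mono) auto
          with True show ?thesis by (simp add: abs_mult)
        qed (simp add: outside[OF K])
      qed
      show "AE y in lborel. (\<lambda>n. G (y + W n) * \<sigma> (z - h *\<^sub>R y)) \<longlonglongrightarrow> G y * \<sigma> (z - h *\<^sub>R y)"
      proof (intro AE_I2 tendsto_mult tendsto_const)
        fix y
        have "isCont G y" using test_function_continuous[OF G] by (simp add: continuous_on_eq_continuous_at)
        moreover have "(\<lambda>n. y + W n) \<longlonglongrightarrow> y + 0" by (intro tendsto_intros W)
        ultimately show "(\<lambda>n. G (y + W n)) \<longlonglongrightarrow> G y" by (intro isCont_tendsto_compose[of y G]) auto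
      qed
    qed (measurable, rule dom)
    thus "(?L G \<circ> X) \<longlonglongrightarrow> ?L G z" using L by (simp add: fun_eq_iff comp_def)
  qed
  thus "continuous_on UNIV (?L G)" by (simp add: continuous_on_eq_continuous_at)
  let ?e = "axis i (1::real)"
  have "((\<lambda>t. (?L G (x + t *\<^sub>R ?e) - ?L G x) / t) \<longlongrightarrow> (1 / h) * ?L (partial_deriv i G) x) (at 0)"
    unfolding tendsto_at_iff_sequentially
  proof (intro allI impI)
    fix T :: "nat \<Rightarrow> real" assume T0: "\<forall>n. T n \<in> UNIV - {0}" and T: "T \<longlonglongrightarrow> 0"
    define S where "S n = T n / h" for n
    have S0: "S n \<noteq> 0" for n using T0 h by (simp add: S_def)
    have "S \<longlonglongrightarrow> 0 / h" unfolding S_def using h by (intro tendsto_intros T)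
    hence S: "S \<longlonglongrightarrow> 0" by simp
    hence "Bseq S" by (intro convergent_imp_Bseq) (auto simp: convergent_def)
    then obtain K where K: "\<And>n. norm (S n) \<le> K" unfolding Bseq_def by auto
    have i1: "integrable lborel (\<lambda>y. G (y + w) * \<sigma> (x - h *\<^sub>R y))" for w
      using \<sigma>_le test_function_integrable[OF G] by (intro integrable_mult_bounded[where B = 1]) (auto simp: lborel_integrable_translate)
    let ?q = "\<lambda>n y. (1 / h) * ((G (y + S n *\<^sub>R ?e) - G y) / S n * \<sigma> (x - h *\<^sub>R y))"
    have L: "(?L G (x + T n *\<^sub>R ?e) - ?L G x) / T n = (\<integral>y. ?q n y \<partial>lborel)" for n
    proof -
      have "?L G (x + T n *\<^sub>R ?e) = (\<integral>y. G (y + S n *\<^sub>R ?e) * \<sigma> (x - h *\<^sub>R y) \<partial>lborel)"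
        using convolution_shift[of G \<sigma> h x "T n *\<^sub>R ?e"] h by (simp add: S_def)
      hence "?L G (x + T n *\<^sub>R ?e) - ?L G x
          = (\<integral>y. G (y + S n *\<^sub>R ?e) * \<sigma> (x - h *\<^sub>R y) - G y * \<sigma> (x - h *\<^sub>R y) \<partial>lborel)"
        using i1[of "S n *\<^sub>R ?e"] i1[of 0] by simp
      hence "(?L G (x + T n *\<^sub>R ?e) - ?L G x) / T n
          = (\<integral>y. (G (y + S n *\<^sub>R ?e) * \<sigma> (x - h *\<^sub>R y) - G y * \<sigma> (x - h *\<^sub>R y)) / T n \<partial>lborel)"
        by simp
      also have "(\<lambda>y. (G (y + S n *\<^sub>R ?e) * \<sigma> (x - h *\<^sub>R y) - G y * \<sigma> (x - h *\<^sub>R y)) / T n) = ?q n"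
        using h T0 by (auto simp: S_def field_simps)
      finally show ?thesis .
    qed
    have "(\<lambda>n. \<integral>y. ?q n y \<partial>lborel) \<longlonglongrightarrow> (\<integral>y. (1 / h) * (partial_deriv i G y * \<sigma> (x - h *\<^sub>R y)) \<partial>lborel)"
    proof (rule integral_dominated_convergence[where w = "\<lambda>y. (B' / \<bar>h\<bar>) * indicator (cball 0 (1 + K)) y"])
      show "AE y in lborel. norm (?q n y) \<le> (B' / \<bar>h\<bar>) * indicator (cball 0 (1 + K)) y" for n
      proof (intro AE_I2)
        fix y
        show "norm (?q n y) \<le> (B' / \<bar>h\<bar>) * indicator (cball 0 (1 + K)) y"
        proof (cases "y \<in> cball 0 (1 + K)")
          case True
          have "norm (G (y + S n *\<^sub>R ?e) - G (y + 0 *\<^sub>R ?e)) \<le> B' * norm (S n - 0)"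
            using B'(2) by (intro field_differentiable_bound[of UNIV "\<lambda>t. G (y + t *\<^sub>R ?e)" "\<lambda>t. partial_deriv i G (y + t *\<^sub>R ?e)"]
                C_k_DERIV[OF test_function_C_k[OF G]]) auto
          hence "\<bar>(G (y + S n *\<^sub>R ?e) - G y) / S n\<bar> \<le> B'" using S0[of n] by (simp add: abs_divide field_simps)
          hence "\<bar>(G (y + S n *\<^sub>R ?e) - G y) / S n\<bar> * \<bar>\<sigma> (x - h *\<^sub>R y)\<bar> \<le> B' * 1"
            using \<sigma>_le B' by (intro mult_mono) auto
          hence "\<bar>1 / h\<bar> * (\<bar>(G (y + S n *\<^sub>R ?e) - G y) / S n\<bar> * \<bar>\<sigma> (x - h *\<^sub>R y)\<bar>) \<le> \<bar>1 / h\<bar> * (B' * 1)"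
            by (rule mult_left_mono) simp
          with True show ?thesis by (simp only: abs_mult real_norm_def) (simp add: mult.commute)
        next
          case False
          have "norm (S n *\<^sub>R ?e) \<le> K" "norm (0::real^'d) \<le> K"
            using K[of n] order_trans[OF norm_ge_zero K[of n]] by auto
          from outside[OF this(1) False] outside[OF this(2) False] False show ?thesis by simp
        qed
      qed
      show "AE y in lborel. (\<lambda>n. ?q n y) \<longlonglongrightarrow> (1 / h) * (partial_deriv i G y * \<sigma> (x - h *\<^sub>R y))"
      proof (intro AE_I2 tendsto_mult tendsto_const)
        fix y
        have "((\<lambda>t. (G (y + t *\<^sub>R ?e) - G y) / t) \<longlongrightarrow> partial_deriv i G y) (at 0)"
          using C_k_DERIV_0[OF test_function_C_k[OF G], of y i] by (simp add: DERIV_def)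
        thus "(\<lambda>n. (G (y + S n *\<^sub>R ?e) - G y) / S n) \<longlonglongrightarrow> partial_deriv i G y"
          by (rule filterlim_compose) (use S S0 in \<open>auto simp: filterlim_at\<close>)
      qed
    qed (measurable, rule dom)
    thus "((\<lambda>t. (?L G (x + t *\<^sub>R ?e) - ?L G x) / t) \<circ> T) \<longlonglongrightarrow> (1 / h) * ?L (partial_deriv i G) x"
      using L by (simp add: comp_def)
  qed
  thus "((\<lambda>t. ?L G (x + t *\<^sub>R ?e)) has_real_derivative (1 / h) * ?L (partial_deriv i G) x) (at 0)"
    unfolding DERIV_def by simp
qed

text \<open>
  \<open>D\<close> bounds the functional \<open>\<Phi> \<mapsto> \<integral> g \<Phi>\<close> on the smooth functions in the unit ball of
  \<^const>\<open>norm_kinf\<close>. For \<open>g\<close> the difference of the densities of two signed measures, this holds if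
  \<open>D\<close> is at least their distance.
\<close>

definition dual_bound :: "nat \<Rightarrow> (real^'d::{finite,linorder} \<Rightarrow> real) \<Rightarrow> real \<Rightarrow> bool" where
  "dual_bound k g D \<longleftrightarrow> integrable lborel g \<and>
     (\<forall>\<Phi>. C_infinity \<Phi> \<longrightarrow> norm_kinf k \<Phi> \<le> 1 \<longrightarrow> \<bar>\<integral>x. g x * \<Phi> x \<partial>lborel\<bar> \<le> D)"

lemma card_multi_indices_pos: "0 < card (multi_indices k :: ('d::finite \<Rightarrow> nat) set)"
proof -
  have "(\<lambda>_. 0) \<in> (multi_indices k :: ('d \<Rightarrow> nat) set)" by (simp add: multi_indices_def)
  thus ?thesis by (auto simp: card_gt_0_iff finite_multi_indices)
qed

text \<open>The cardinality enters because \<^const>\<open>norm_kinf\<close> sums the supremum norms of the derivatives.\<close>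

lemma dual_bound_scaled:
  fixes g \<Phi> :: "real^'d::{finite,linorder} \<Rightarrow> real"
  assumes D: "dual_bound k g D" and \<Phi>: "C_infinity \<Phi>" and B: "0 < B"
    and le: "\<And>w x. length w \<le> k \<Longrightarrow> \<bar>word_deriv w \<Phi> x\<bar> \<le> B"
  shows "\<bar>\<integral>x. g x * \<Phi> x \<partial>lborel\<bar> \<le> real (card (multi_indices k :: ('d \<Rightarrow> nat) set)) * B * D"
proof -
  define N where "N = card (multi_indices k :: ('d \<Rightarrow> nat) set)"
  have N: "0 < N" unfolding N_def by (rule card_multi_indices_pos)
  define c where "c = 1 / (real N * B)"
  have c: "0 < c" using N B by (simp add: c_def)
  let ?\<Psi> = "\<lambda>x. c * \<Phi> x"
  have C: "C_k n \<Phi>" for n using \<Phi> by (simp add: C_infinity_def)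
  have "norm_kinf k ?\<Psi> \<le> (\<Sum>\<alpha>\<in>(multi_indices k :: ('d \<Rightarrow> nat) set). ennreal (1 / real N))"
    unfolding norm_kinf_def
  proof (rule sum_mono)
    fix \<alpha> :: "'d \<Rightarrow> nat" assume "\<alpha> \<in> multi_indices k"
    hence l: "length (index_word \<alpha>) \<le> k" by (simp add: index_word_length_le)
    show "sup_norm (multi_deriv \<alpha> ?\<Psi>) \<le> ennreal (1 / real N)"
      unfolding sup_norm_def multi_deriv_eq_word_deriv word_deriv_cmult[OF C]
    proof (intro SUP_least ennreal_leI)
      fix x
      have "\<bar>c * word_deriv (index_word \<alpha>) \<Phi> x\<bar> \<le> c * B"
        using le[OF l] c by (simp add: abs_mult)
      also have "c * B = 1 / real N" using B by (simp add: c_def)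
      finally show "\<bar>c * word_deriv (index_word \<alpha>) \<Phi> x\<bar> \<le> 1 / real N" .
    qed
  qed
  also have "\<dots> = of_nat N * ennreal (1 / real N)" by (simp add: N_def)
  also have "\<dots> = ennreal (real N * (1 / real N))"
    by (subst ennreal_mult) (auto simp: ennreal_of_nat_eq_real_of_nat)
  also have "real N * (1 / real N) = 1" using N by simp
  finally have "norm_kinf k ?\<Psi> \<le> 1" by simp
  moreover have "C_infinity ?\<Psi>" using C by (auto simp: C_infinity_def intro: C_k_cmult)
  ultimately have "\<bar>\<integral>x. g x * ?\<Psi> x \<partial>lborel\<bar> \<le> D" using D by (simp add: dual_bound_def)
  moreover have "(\<integral>x. g x * ?\<Psi> x \<partial>lborel) = c * (\<integral>x. g x * \<Phi> x \<partial>lborel)"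
    by (simp add: mult.left_commute)
  ultimately have "c * \<bar>\<integral>x. g x * \<Phi> x \<partial>lborel\<bar> \<le> D" using c by (simp add: abs_mult)
  thus ?thesis using N B by (simp add: c_def N_def[symmetric] field_simps)
qed

lemma word_deriv_bounds:
  assumes "G \<in> test_functions"
  obtains B where "0 < B" "\<And>w x. length w \<le> k \<Longrightarrow> \<bar>word_deriv w G x\<bar> \<le> B"
    "\<And>w. length w \<le> k \<Longrightarrow> (\<integral>x. \<bar>word_deriv w G x\<bar> \<partial>lborel) \<le> B"
proof -
  let ?W = "{w :: 'a list. set w \<subseteq> UNIV \<and> length w \<le> k}"
  have fin: "finite ?W" by (rule finite_lists_length_le) simp
  have "\<exists>b>0. \<forall>x. \<bar>word_deriv w G x\<bar> \<le> b" for w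
    using test_function_bounded[OF word_deriv_test_function[OF assms]] by metis
  then obtain b where b: "\<And>w. 0 < b w" "\<And>w x. \<bar>word_deriv w G x\<bar> \<le> b w" by metis
  let ?I = "\<lambda>w. \<integral>x. \<bar>word_deriv w G x\<bar> \<partial>lborel"
  have I: "0 \<le> ?I w" for w by simp
  define B where "B = (\<Sum>w\<in>?W. b w + ?I w)"
  have le: "b w + ?I w \<le> B" if "length w \<le> k" for w
    unfolding B_def using that fin b(1) I by (intro member_le_sum) (auto intro: add_nonneg_nonneg[OF less_imp_le[OF b(1)]])
  show thesis
  proof (rule that)
    show "0 < B" using add_pos_nonneg[OF b(1) I, of "[]" "[]"] le[of "[]"] by simp
    fix w :: "'a list" assume w: "length w \<le> k"
    show "\<bar>word_deriv w G x\<bar> \<le> B" for x using le[OF w] b(2)[of w x] I[of w] by linarith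
    show "?I w \<le> B" using le[OF w] b(1)[of w] by linarith
  qed
qed

lemma lborel_integral_affine:
  fixes F :: "'a::euclidean_space \<Rightarrow> real"
  assumes [measurable]: "F \<in> borel_measurable borel" and h: "0 < h"
  shows "(\<integral>y. F (x + h *\<^sub>R y) \<partial>lborel) = (1 / h) ^ DIM('a) * integral\<^sup>L lborel F"
proof -
  have "integral\<^sup>L lborel F = integral\<^sup>L (density (distr lborel borel (\<lambda>y. x + h *\<^sub>R y)) (\<lambda>_. ennreal (h ^ DIM('a)))) F"
    using lborel_affine[of h x] h by simp
  also have "\<dots> = h ^ DIM('a) * (\<integral>y. F (x + h *\<^sub>R y) \<partial>lborel)"
    using h by (subst integral_density) (auto simp: integral_distr)
  finally show ?thesis using h by (simp add: field_simps)
qed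

lemma power_le_power_of_inverse:
  assumes "0 < h" "1 / h \<le> r" "1 \<le> r" "n \<le> k"
  shows "(1 / h :: real) ^ n \<le> r ^ k"
proof -
  have "(1 / h) ^ n \<le> r ^ n" using assms by (intro power_mono) auto
  also have "\<dots> \<le> r ^ k" using assms by (intro power_increasing) auto
  finally show ?thesis .
qed

text \<open>The value of the smoothed function at a point is the pairing with one rescaled kernel.\<close>

lemma smoothing_sup_bound:
  fixes G :: "real^'d::{finite,linorder} \<Rightarrow> real"
  assumes G: "G \<in> test_functions"
  shows "\<exists>C>0. \<forall>h r g D x. 0 < h \<longrightarrow> 1 / h \<le> r \<longrightarrow> 1 \<le> r \<longrightarrow> dual_bound k g D \<longrightarrow>
    \<bar>\<integral>y. G y * g (x + h *\<^sub>R y) \<partial>lborel\<bar> \<le> C * r ^ (k + CARD('d)) * D"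
proof -
  obtain B where B: "0 < B" "\<And>w x. length w \<le> k \<Longrightarrow> \<bar>word_deriv w G x\<bar> \<le> B"
    using word_deriv_bounds[OF G] by metis
  define N where "N = real (card (multi_indices k :: ('d \<Rightarrow> nat) set))"
  have N: "0 < N" using card_multi_indices_pos by (simp add: N_def)
  show ?thesis
  proof (intro exI[of _ "N * B"] conjI allI impI)
    show "0 < N * B" using N B by simp
    fix h r D :: real and g :: "real^'d::{finite,linorder} \<Rightarrow> real" and x :: "real^'d::{finite,linorder}"
    assume h: "0 < h" "1 / h \<le> r" and r: "1 \<le> r" and D: "dual_bound k g D"
    have [measurable]: "g \<in> borel_measurable borel" using D by (auto simp: dual_bound_def)
    have [measurable]: "G \<in> borel_measurable borel" by (rule test_function_measurable[OF G])
    define L where "L K z = K (- (1 / h) *\<^sub>R x + (1 / h) *\<^sub>R z)" for K :: "real^'d::{finite,linorder} \<Rightarrow> real" and z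
    have cont: "continuous_on UNIV (L K)" if "K \<in> test_functions" for K
      unfolding L_def using C_k_affine[OF test_function_C_k[OF that, of 0], of "- (1 / h) *\<^sub>R x" "1 / h"] by simp
    have deriv: "((\<lambda>t. L K (z + t *\<^sub>R axis i 1)) has_real_derivative 1 / h * L (partial_deriv i K) z) (at 0)"
      if "K \<in> test_functions" for K i z
      unfolding L_def by (rule DERIV_affine[OF test_function_C_k[OF that]])
    have "\<bar>\<integral>z. g z * L G z \<partial>lborel\<bar> \<le> N * (r ^ k * B) * D"
      unfolding N_def
    proof (rule dual_bound_scaled[OF D C_infinity_intertwining[where L = L, OF cont deriv G]])
      show "0 < r ^ k * B" using r B by simp
      fix w :: "'d list" and z :: "real^'d::{finite,linorder}" assume w: "length w \<le> k"
      have "word_deriv w (L G) z = (1 / h) ^ length w * L (word_deriv w G) z"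
        by (simp only: word_deriv_intertwining[where L = L, OF cont deriv G])
      moreover have "\<bar>(1 / h) ^ length w\<bar> \<le> r ^ k"
        using power_le_power_of_inverse[OF h r w] h by simp
      moreover have "\<bar>L (word_deriv w G) z\<bar> \<le> B" unfolding L_def by (rule B(2)[OF w])
      ultimately show "\<bar>word_deriv w (L G) z\<bar> \<le> r ^ k * B"
        using r by (simp only: abs_mult) (intro mult_mono, auto)
    qed
    moreover have "(\<integral>y. G y * g (x + h *\<^sub>R y) \<partial>lborel) = (1 / h) ^ CARD('d) * (\<integral>z. g z * L G z \<partial>lborel)"
    proof -
      have "L G (x + h *\<^sub>R y) = G y" for y using h by (simp add: L_def algebra_simps)
      thus ?thesis using lborel_integral_affine[of "\<lambda>z. g z * L G z" h x] h by (simp add: L_def mult.commute)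
    qed
    moreover have "\<bar>(1 / h) ^ CARD('d)\<bar> \<le> r ^ CARD('d)"
      using power_le_power_of_inverse[OF h r order_refl] h by simp
    ultimately have "\<bar>\<integral>y. G y * g (x + h *\<^sub>R y) \<partial>lborel\<bar> \<le> r ^ CARD('d) * (N * (r ^ k * B) * D)"
      using r by (simp only: abs_mult) (intro mult_mono, auto)
    thus "\<bar>\<integral>y. G y * g (x + h *\<^sub>R y) \<partial>lborel\<bar> \<le> N * B * r ^ (k + CARD('d)) * D"
      by (simp add: power_add mult_ac)
  qed
qed

text \<open>The cases \<open>s = 1\<close> and \<open>s = 0\<close> justify the exchanges of integrals before and after the substitution \<open>z = x + h y\<close>.\<close>

lemma integrable_smoothing_product:
  fixes G g :: "real^'d::finite \<Rightarrow> real"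
  assumes G: "G \<in> test_functions" and g: "integrable lborel g" and s: "s = 0 \<or> s = 1"
  shows "integrable (lborel \<Otimes>\<^sub>M lborel) (\<lambda>(y, x). G y * g (x + s *\<^sub>R h *\<^sub>R y))"
proof -
  have [measurable]: "g \<in> borel_measurable borel" using g by auto
  note [measurable] = test_function_measurable[OF G]
  have "(\<integral>x. norm (G y * g (x + s *\<^sub>R h *\<^sub>R y)) \<partial>lborel) = \<bar>G y\<bar> * (\<integral>x. \<bar>g x\<bar> \<partial>lborel)" for y
    using lborel_integral_translate[of "\<lambda>x. \<bar>g x\<bar>" "s *\<^sub>R h *\<^sub>R y"] by (simp add: abs_mult)
  thus ?thesis
    using g test_function_integrable[OF G]
    by (intro lborel_pair.Fubini_integrable) (auto simp: lborel_integrable_translate)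
qed

text \<open>
  The \<open>L\<^sup>1\<close> norm of the smoothed function is its pairing with its sign \<open>\<sigma>\<close>, that is, the pairing of
  \<open>g\<close> with a smoothed \<open>\<sigma>\<close>; compared with the supremum norm no power of \<open>r\<close> is lost to the dimension.
\<close>

lemma smoothing_L1_bound:
  fixes G :: "real^'d::{finite,linorder} \<Rightarrow> real"
  assumes G: "G \<in> test_functions"
  shows "\<exists>C>0. \<forall>h r g D. 0 < h \<longrightarrow> 1 / h \<le> r \<longrightarrow> 1 \<le> r \<longrightarrow> dual_bound k g D \<longrightarrow>
    (\<integral>\<^sup>+x. ennreal \<bar>\<integral>y. G y * g (x + h *\<^sub>R y) \<partial>lborel\<bar> \<partial>lborel) \<le> ennreal (C * r ^ k * D)"
proof -
  obtain B where B: "0 < B" "\<And>w. length w \<le> k \<Longrightarrow> (\<integral>x. \<bar>word_deriv w G x\<bar> \<partial>lborel) \<le> B"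
    using word_deriv_bounds[OF G] by metis
  define N where "N = real (card (multi_indices k :: ('d \<Rightarrow> nat) set))"
  have N: "0 < N" using card_multi_indices_pos by (simp add: N_def)
  show ?thesis
  proof (intro exI[of _ "N * B"] conjI allI impI)
    show "0 < N * B" using N B by simp
    fix h r D :: real and g :: "real^'d::{finite,linorder} \<Rightarrow> real"
    assume h: "0 < h" "1 / h \<le> r" and r: "1 \<le> r" and D: "dual_bound k g D"
    have g: "integrable lborel g" using D by (simp add: dual_bound_def)
    have [measurable]: "g \<in> borel_measurable borel" using g by auto
    note [measurable] = test_function_measurable[OF G]
    define H where "H x = (\<integral>y. G y * g (x + h *\<^sub>R y) \<partial>lborel)" for x
    have i1: "integrable (lborel \<Otimes>\<^sub>M lborel) (\<lambda>(y, x). G y * g (x + h *\<^sub>R y))"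
      using integrable_smoothing_product[OF G g, of 1 h] by simp
    have i2: "integrable (lborel \<Otimes>\<^sub>M lborel) (\<lambda>(y, z). G y * g z)"
      using integrable_smoothing_product[OF G g, of 0 h] by simp
    have H: "integrable lborel H"
      using lborel_pair.integrable_snd[OF i1] by (simp add: H_def[abs_def])
    have [measurable]: "H \<in> borel_measurable borel" using H by auto
    define \<sigma> where "\<sigma> x = sgn (H x)" for x
    have \<sigma> [measurable]: "\<sigma> \<in> borel_measurable borel" unfolding \<sigma>_def by measurable
    have \<sigma>_le: "\<bar>\<sigma> x\<bar> \<le> 1" for x by (simp add: \<sigma>_def sgn_if)
    define L where "L K z = (\<integral>y. K y * \<sigma> (z - h *\<^sub>R y) \<partial>lborel)" for K :: "real^'d::{finite,linorder} \<Rightarrow> real" and z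
    have "(\<integral>x. \<bar>H x\<bar> \<partial>lborel) = (\<integral>x. (\<integral>y. (G y * g (x + h *\<^sub>R y)) * \<sigma> x \<partial>lborel) \<partial>lborel)"
      by (simp add: H_def[symmetric] \<sigma>_def flip: abs_sgn)
    also have "\<dots> = (\<integral>y. (\<integral>x. (G y * g (x + h *\<^sub>R y)) * \<sigma> x \<partial>lborel) \<partial>lborel)"
    proof (rule lborel_pair.Fubini_integral)
      have "integrable (lborel \<Otimes>\<^sub>M lborel) (\<lambda>p. (case p of (y, x) \<Rightarrow> G y * g (x + h *\<^sub>R y)) * \<sigma> (snd p))"
        by (rule integrable_mult_bounded[OF i1 _ \<sigma>_le]) measurable
      thus "integrable (lborel \<Otimes>\<^sub>M lborel) (\<lambda>(y, x). (G y * g (x + h *\<^sub>R y)) * \<sigma> x)"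
        by (simp add: case_prod_unfold)
    qed
    also have "\<dots> = (\<integral>y. (\<integral>z. (G y * g z) * \<sigma> (z - h *\<^sub>R y) \<partial>lborel) \<partial>lborel)"
    proof (rule Bochner_Integration.integral_cong[OF refl])
      fix y :: "real^'d::{finite,linorder}"
      have "(\<integral>x. (G y * g (x + h *\<^sub>R y)) * \<sigma> (x + h *\<^sub>R y - h *\<^sub>R y) \<partial>lborel) = (\<integral>z. (G y * g z) * \<sigma> (z - h *\<^sub>R y) \<partial>lborel)"
        by (rule lborel_integral_translate) measurable
      thus "(\<integral>x. (G y * g (x + h *\<^sub>R y)) * \<sigma> x \<partial>lborel) = (\<integral>z. (G y * g z) * \<sigma> (z - h *\<^sub>R y) \<partial>lborel)" by simp
    qed
    also have "\<dots> = (\<integral>z. (\<integral>y. (G y * g z) * \<sigma> (z - h *\<^sub>R y) \<partial>lborel) \<partial>lborel)"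
    proof (rule lborel_pair.Fubini_integral[symmetric])
      have "integrable (lborel \<Otimes>\<^sub>M lborel) (\<lambda>p. (case p of (y, z) \<Rightarrow> G y * g z) * \<sigma> (snd p - h *\<^sub>R fst p))"
        by (rule integrable_mult_bounded[OF i2 _ \<sigma>_le]) measurable
      thus "integrable (lborel \<Otimes>\<^sub>M lborel) (\<lambda>(y, z). (G y * g z) * \<sigma> (z - h *\<^sub>R y))"
        by (simp add: case_prod_unfold)
    qed
    also have "\<dots> = (\<integral>z. (\<integral>y. g z * (G y * \<sigma> (z - h *\<^sub>R y)) \<partial>lborel) \<partial>lborel)"
      by (simp add: mult_ac)
    also have "\<dots> = (\<integral>z. g z * L G z \<partial>lborel)" by (simp add: L_def)
    finally have eq: "(\<integral>x. \<bar>H x\<bar> \<partial>lborel) = (\<integral>z. g z * L G z \<partial>lborel)" .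
    have h0: "h \<noteq> 0" using h by simp
    have cont: "continuous_on UNIV (L K)" if "K \<in> test_functions" for K
      unfolding L_def by (rule convolution_continuous[OF \<sigma> \<sigma>_le h0 that])
    have deriv: "((\<lambda>t. L K (z + t *\<^sub>R axis i 1)) has_real_derivative 1 / h * L (partial_deriv i K) z) (at 0)"
      if "K \<in> test_functions" for K i z
      unfolding L_def by (rule convolution_DERIV[OF \<sigma> \<sigma>_le h0 that])
    have "\<bar>\<integral>z. g z * L G z \<partial>lborel\<bar> \<le> N * (r ^ k * B) * D"
      unfolding N_def
    proof (rule dual_bound_scaled[OF D C_infinity_intertwining[where L = L, OF cont deriv G]])
      show "0 < r ^ k * B" using r B by simp
      fix w :: "'d list" and z :: "real^'d::{finite,linorder}" assume w: "length w \<le> k"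
      have "word_deriv w (L G) z = (1 / h) ^ length w * L (word_deriv w G) z"
        by (simp only: word_deriv_intertwining[where L = L, OF cont deriv G])
      moreover have "\<bar>(1 / h) ^ length w\<bar> \<le> r ^ k"
        using power_le_power_of_inverse[OF h r w] h by simp
      moreover have "\<bar>L (word_deriv w G) z\<bar> \<le> B"
      proof -
        note G' = word_deriv_test_function[OF G, of w]
        have "\<bar>L (word_deriv w G) z\<bar> \<le> (\<integral>y. \<bar>word_deriv w G y * \<sigma> (z - h *\<^sub>R y)\<bar> \<partial>lborel)"
          unfolding L_def by (rule integral_abs_bound)
        also have "\<dots> \<le> (\<integral>y. \<bar>word_deriv w G y\<bar> \<partial>lborel)"
        proof (rule integral_mono)
          show "integrable lborel (\<lambda>y. \<bar>word_deriv w G y * \<sigma> (z - h *\<^sub>R y)\<bar>)"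
            by (intro integrable_abs integrable_mult_bounded[OF test_function_integrable[OF G'] _ \<sigma>_le]) measurable
          show "\<bar>word_deriv w G y * \<sigma> (z - h *\<^sub>R y)\<bar> \<le> \<bar>word_deriv w G y\<bar>" for y
            using mult_left_mono[OF \<sigma>_le[of "z - h *\<^sub>R y"], of "\<bar>word_deriv w G y\<bar>"] by (simp add: abs_mult)
        qed (intro integrable_abs test_function_integrable[OF G'])
        also have "\<dots> \<le> B" by (rule B(2)[OF w])
        finally show ?thesis .
      qed
      ultimately show "\<bar>word_deriv w (L G) z\<bar> \<le> r ^ k * B"
        using r by (simp only: abs_mult) (intro mult_mono, auto)
    qed
    hence "(\<integral>x. \<bar>H x\<bar> \<partial>lborel) \<le> N * B * r ^ k * D" unfolding eq by (simp add: mult_ac)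
    moreover have "(\<integral>\<^sup>+x. ennreal \<bar>H x\<bar> \<partial>lborel) = ennreal (\<integral>x. \<bar>H x\<bar> \<partial>lborel)"
      by (rule nn_integral_eq_integral) (use H in auto)
    ultimately show "(\<integral>\<^sup>+x. ennreal \<bar>\<integral>y. G y * g (x + h *\<^sub>R y) \<partial>lborel\<bar> \<partial>lborel) \<le> ennreal (N * B * r ^ k * D)"
      unfolding H_def by (simp add: ennreal_leI)
  qed
qed

section \<open>Densities of absolutely continuous signed measures\<close>

lemma signed_measure_empty: "\<mu> \<in> signed_borel_measures \<Longrightarrow> \<mu> {} = 0"
  by (simp add: signed_borel_measures_def)

lemma signed_measure_sums:
  "\<mu> \<in> signed_borel_measures \<Longrightarrow> range A \<subseteq> sets borel \<Longrightarrow> disjoint_family A \<Longrightarrow> (\<lambda>i. \<mu> (A i)) sums \<mu> (\<Union>i. A i)"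
  by (simp add: signed_borel_measures_def)

lemma signed_measure_uminus: "\<mu> \<in> signed_borel_measures \<Longrightarrow> (\<lambda>A. - \<mu> A) \<in> signed_borel_measures"
  by (auto simp: signed_borel_measures_def intro: sums_minus)

lemma signed_measure_Un:
  assumes \<mu>: "\<mu> \<in> signed_borel_measures" and A: "A \<in> sets borel" "B \<in> sets borel" "A \<inter> B = {}"
  shows "\<mu> (A \<union> B) = \<mu> A + \<mu> B"
proof -
  have "(\<lambda>i. \<mu> (binaryset A B i)) sums \<mu> (\<Union>i. binaryset A B i)"
    using A by (intro signed_measure_sums[OF \<mu>]) (auto simp: range_binaryset_eq disjoint_family_on_def binaryset_def)
  moreover have "(\<lambda>i. \<mu> (binaryset A B i)) sums (\<mu> A + \<mu> B)"
    by (rule binaryset_sums) (rule signed_measure_empty[OF \<mu>])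
  ultimately show ?thesis by (simp add: UN_binaryset_eq sums_unique2)
qed

lemma signed_measure_Diff:
  assumes "\<mu> \<in> signed_borel_measures" "A \<in> sets borel" "B \<in> sets borel" "B \<subseteq> A"
  shows "\<mu> (A - B) = \<mu> A - \<mu> B"
proof -
  have "\<mu> (B \<union> (A - B)) = \<mu> B + \<mu> (A - B)" using assms by (intro signed_measure_Un) auto
  moreover have "B \<union> (A - B) = A" using assms(4) by auto
  ultimately show ?thesis by simp
qed

text \<open>
  The set function underlying \<^const>\<open>upper_variation\<close>. For a finite signed measure it is a finite
  measure on the Borel sets.
\<close>

definition positive_part :: "('a::topological_space set \<Rightarrow> real) \<Rightarrow> 'a set \<Rightarrow> ennreal" where
  "positive_part \<mu> A = (SUP B\<in>{B \<in> sets borel. B \<subseteq> A}. ennreal (\<mu> B))"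

lemma positive_part_upper: "B \<in> sets borel \<Longrightarrow> B \<subseteq> A \<Longrightarrow> ennreal (\<mu> B) \<le> positive_part \<mu> A"
  unfolding positive_part_def by (intro SUP_upper) auto

lemma positive_part_mono: "A \<subseteq> B \<Longrightarrow> positive_part \<mu> A \<le> positive_part \<mu> B"
  unfolding positive_part_def by (intro SUP_subset_mono) auto

lemma positive_part_empty: "\<mu> \<in> signed_borel_measures \<Longrightarrow> positive_part \<mu> {} = 0"
proof -
  assume \<mu>: "\<mu> \<in> signed_borel_measures"
  have "positive_part \<mu> {} \<le> 0"
    unfolding positive_part_def
  proof (rule SUP_least)
    fix B assume "B \<in> {B \<in> sets borel. B \<subseteq> ({}::'a set)}"
    hence "B = {}" by simp
    thus "ennreal (\<mu> B) \<le> 0" using signed_measure_empty[OF \<mu>] by simp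
  qed
  thus ?thesis by simp
qed

lemma positive_part_superadditive:
  assumes \<mu>: "\<mu> \<in> signed_borel_measures" and AB: "A \<inter> B = {}"
  shows "positive_part \<mu> A + positive_part \<mu> B \<le> positive_part \<mu> (A \<union> B)"
proof -
  have le: "ennreal (\<mu> X) + ennreal (\<mu> Y) \<le> positive_part \<mu> (A \<union> B)"
    if X: "X \<in> sets borel" "X \<subseteq> A" and Y: "Y \<in> sets borel" "Y \<subseteq> B" for X Y
  proof -
    have [simp]: "\<mu> {} = 0" by (rule signed_measure_empty[OF \<mu>])
    define X' where "X' = (if 0 \<le> \<mu> X then X else {})"
    define Y' where "Y' = (if 0 \<le> \<mu> Y then Y else {})"
    have X': "X' \<in> sets borel" "X' \<subseteq> A" "0 \<le> \<mu> X'" "ennreal (\<mu> X) = ennreal (\<mu> X')"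
      using X by (auto simp: X'_def ennreal_neg)
    have Y': "Y' \<in> sets borel" "Y' \<subseteq> B" "0 \<le> \<mu> Y'" "ennreal (\<mu> Y) = ennreal (\<mu> Y')"
      using Y by (auto simp: Y'_def ennreal_neg)
    have "ennreal (\<mu> X) + ennreal (\<mu> Y) = ennreal (\<mu> (X' \<union> Y'))"
      using X' Y' AB by (subst signed_measure_Un[OF \<mu>]) auto
    also have "\<dots> \<le> positive_part \<mu> (A \<union> B)" using X' Y' by (intro positive_part_upper) auto
    finally show ?thesis .
  qed
  have "positive_part \<mu> A + positive_part \<mu> B
     = (SUP X\<in>{X \<in> sets borel. X \<subseteq> A}. ennreal (\<mu> X) + positive_part \<mu> B)"
    unfolding positive_part_def[of \<mu> A] by (rule ennreal_SUP_add_left[symmetric]) auto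
  also have "\<dots> \<le> positive_part \<mu> (A \<union> B)"
  proof (rule SUP_least)
    fix X assume X: "X \<in> {X \<in> sets borel. X \<subseteq> A}"
    have "ennreal (\<mu> X) + positive_part \<mu> B
        = (SUP Y\<in>{Y \<in> sets borel. Y \<subseteq> B}. ennreal (\<mu> X) + ennreal (\<mu> Y))"
      unfolding positive_part_def[of \<mu> B] by (rule ennreal_SUP_add_right) auto
    also have "\<dots> \<le> positive_part \<mu> (A \<union> B)" using X le by (intro SUP_least) auto
    finally show "ennreal (\<mu> X) + positive_part \<mu> B \<le> positive_part \<mu> (A \<union> B)" .
  qed
  finally show ?thesis .
qed

lemma positive_part_countably_additive:
  fixes \<mu> :: "'a::topological_space set \<Rightarrow> real"
  assumes \<mu>: "\<mu> \<in> signed_borel_measures"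
  shows "countably_additive (sets borel) (positive_part \<mu>)"
  unfolding countably_additive_def
proof (intro allI impI)
  fix A :: "nat \<Rightarrow> 'a set" assume A: "range A \<subseteq> sets borel" and disj: "disjoint_family A"
  show "(\<Sum>i. positive_part \<mu> (A i)) = positive_part \<mu> (\<Union>i. A i)"
  proof (rule antisym)
    have fin: "(\<Sum>i<n. positive_part \<mu> (A i)) \<le> positive_part \<mu> (\<Union>i<n. A i)" for n
    proof (induction n)
      case (Suc n)
      have "A i \<inter> A n = {}" if "i < n" for i
        using that by (intro disjoint_family_onD[OF disj]) auto
      hence "(\<Union>i<n. A i) \<inter> A n = {}" by blast
      from positive_part_superadditive[OF \<mu> this]
      have *: "positive_part \<mu> (\<Union>i<n. A i) + positive_part \<mu> (A n) \<le> positive_part \<mu> (\<Union>i<Suc n. A i)"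
        by (simp add: lessThan_Suc Un_commute)
      from order_trans[OF add_right_mono[OF Suc] *] show ?case by simp
    qed simp
    show "(\<Sum>i. positive_part \<mu> (A i)) \<le> positive_part \<mu> (\<Union>i. A i)"
    proof (rule suminf_le_const)
      show "(\<Sum>i<n. positive_part \<mu> (A i)) \<le> positive_part \<mu> (\<Union>i. A i)" for n
        by (rule order_trans[OF fin positive_part_mono]) auto
    qed simp
    show "positive_part \<mu> (\<Union>i. A i) \<le> (\<Sum>i. positive_part \<mu> (A i))"
      unfolding positive_part_def[of \<mu> "\<Union>i. A i"]
    proof (rule SUP_least)
      fix B assume "B \<in> {B \<in> sets borel. B \<subseteq> (\<Union>i. A i)}"
      hence B: "B \<in> sets borel" "B \<subseteq> (\<Union>i. A i)" by auto
      have "(\<lambda>i. \<mu> (B \<inter> A i)) sums \<mu> (\<Union>i. B \<inter> A i)"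
        using A B disjoint_family_subset[OF disj, of "\<lambda>i. B \<inter> A i"]
        by (intro signed_measure_sums[OF \<mu>]) auto
      also have "(\<Union>i. B \<inter> A i) = B" using B(2) by auto
      finally have "(\<lambda>n. ennreal (\<Sum>i<n. \<mu> (B \<inter> A i))) \<longlonglongrightarrow> ennreal (\<mu> B)"
        unfolding sums_def by (rule tendsto_ennrealI)
      thus "ennreal (\<mu> B) \<le> (\<Sum>i. positive_part \<mu> (A i))"
      proof (rule LIMSEQ_le_const2, intro exI allI impI)
        fix n
        have "ennreal (sum a {..<n}) \<le> (\<Sum>i<n. ennreal (a i))" for a :: "nat \<Rightarrow> real"
        proof (induction n)
          case (Suc n)
          have "ennreal (sum a {..<n} + a n) \<le> ennreal (sum a {..<n}) + ennreal (a n)"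
            by (cases "0 \<le> sum a {..<n}"; cases "0 \<le> a n") (auto simp: ennreal_neg intro!: ennreal_leI simp flip: ennreal_plus)
          also have "\<dots> \<le> (\<Sum>i<n. ennreal (a i)) + ennreal (a n)" by (intro add_right_mono Suc)
          finally show ?case by simp
        qed simp
        hence "ennreal (\<Sum>i<n. \<mu> (B \<inter> A i)) \<le> (\<Sum>i<n. ennreal (\<mu> (B \<inter> A i)))" .
        also have "\<dots> \<le> (\<Sum>i<n. positive_part \<mu> (A i))"
          using A B by (intro sum_mono positive_part_upper) auto
        also have "\<dots> \<le> (\<Sum>i. positive_part \<mu> (A i))" by (rule sum_le_suminf) auto
        finally show "ennreal (\<Sum>i<n. \<mu> (B \<inter> A i)) \<le> (\<Sum>i. positive_part \<mu> (A i))" .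
      qed
    qed
  qed
qed

lemma emeasure_upper_variation:
  assumes "\<mu> \<in> signed_borel_measures" "A \<in> sets borel"
  shows "emeasure (upper_variation \<mu>) A = positive_part \<mu> A"
  unfolding upper_variation_def positive_part_def[symmetric]
  by (rule emeasure_measure_of_sigma)
     (use assms sets.sigma_algebra_axioms[of borel] in
       \<open>auto simp: positive_def positive_part_empty positive_part_countably_additive\<close>)

lemma sets_upper_variation: "sets (upper_variation \<mu>) = sets borel"
  and space_upper_variation: "space (upper_variation \<mu>) = UNIV"
  unfolding upper_variation_def using sets.sigma_sets_eq[of borel] by auto

text \<open>
  If the positive part of the whole space were infinite, one could split off infinitely many
  disjoint sets whose measures do not tend to 0.
\<close>

lemma positive_part_finite:
  fixes \<mu> :: "'a::topological_space set \<Rightarrow> real"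
  assumes \<mu>: "\<mu> \<in> signed_borel_measures"
  shows "positive_part \<mu> UNIV < \<infinity>"
proof (rule ccontr)
  assume "\<not> ?thesis"
  hence inf: "positive_part \<mu> UNIV = \<infinity>" by (simp add: less_top[symmetric])
  let ?P = "\<lambda>A. A \<in> sets borel \<and> positive_part \<mu> A = \<infinity>"
  have step: "\<exists>B. ?P B \<and> B \<subseteq> A \<and> 1 \<le> \<bar>\<mu> (A - B)\<bar>" if A: "?P A" for A
  proof -
    have "ennreal (\<bar>\<mu> A\<bar> + 1) < positive_part \<mu> A" using A by (simp del: ennreal_plus)
    then obtain C where C: "C \<in> sets borel" "C \<subseteq> A" "ennreal (\<bar>\<mu> A\<bar> + 1) < ennreal (\<mu> C)"
      unfolding positive_part_def less_SUP_iff by auto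
    have gt: "\<bar>\<mu> A\<bar> + 1 < \<mu> C" using C(3) by (subst (asm) ennreal_less_iff) auto
    have D: "\<mu> (A - C) = \<mu> A - \<mu> C" using A C by (intro signed_measure_Diff[OF \<mu>]) auto
    have "emeasure (upper_variation \<mu>) C + emeasure (upper_variation \<mu>) (A - C) = emeasure (upper_variation \<mu>) (C \<union> (A - C))"
      using A C by (intro plus_emeasure) (auto simp: sets_upper_variation)
    moreover have "C \<union> (A - C) = A" using C by auto
    ultimately have "positive_part \<mu> C + positive_part \<mu> (A - C) = \<infinity>"
      using A C sets.Diff[of A borel C] by (simp only: emeasure_upper_variation[OF \<mu>])
    then consider "positive_part \<mu> C = \<infinity>" | "positive_part \<mu> (A - C) = \<infinity>" by (auto simp: ennreal_add_eq_top)
    thus ?thesis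
    proof cases
      case 1
      have "1 \<le> \<bar>\<mu> (A - C)\<bar>" using D gt by linarith
      thus ?thesis using 1 C by blast
    next
      case 2
      have "A - (A - C) = C" using C by auto
      moreover have "1 \<le> \<bar>\<mu> C\<bar>" using gt by linarith
      ultimately show ?thesis using 2 A C by (intro exI[of _ "A - C"]) auto
    qed
  qed
  have "\<exists>S. \<forall>n. ?P (S n) \<and> (S (Suc n) \<subseteq> S n \<and> 1 \<le> \<bar>\<mu> (S n - S (Suc n))\<bar>)"
  proof (rule dependent_nat_choice)
    show "\<exists>A. ?P A" using inf by (intro exI[of _ UNIV]) simp
  qed (use step in blast)
  then obtain S where S: "\<And>n. S n \<in> sets borel" "\<And>n. S (Suc n) \<subseteq> S n" "\<And>n. 1 \<le> \<bar>\<mu> (S n - S (Suc n))\<bar>"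
    by auto
  have dec: "S n \<subseteq> S m" if "m \<le> n" for m n
    using S(2) that by (rule lift_Suc_antimono_le)
  define D where "D n = S n - S (Suc n)" for n
  have "disjoint_family D"
    unfolding disjoint_family_on_def
  proof (intro ballI impI)
    fix m n :: nat assume "m \<noteq> n"
    thus "D m \<inter> D n = {}"
    proof (induction m n rule: linorder_wlog)
      case (le m n)
      hence "S n \<subseteq> S (Suc m)" by (intro dec) simp
      thus ?case by (auto simp: D_def)
    qed (auto simp: Int_commute)
  qed
  moreover have "range D \<subseteq> sets borel" using S(1) by (auto simp: D_def)
  ultimately have "(\<lambda>n. \<mu> (D n)) sums \<mu> (\<Union>n. D n)"
    by (intro signed_measure_sums[OF \<mu>])
  hence "(\<lambda>n. \<mu> (D n)) \<longlonglongrightarrow> 0" by (intro summable_LIMSEQ_zero) (rule sums_summable)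
  hence "eventually (\<lambda>n. dist (\<mu> (D n)) 0 < 1) sequentially" by (rule tendstoD) simp
  then obtain n where "\<bar>\<mu> (D n)\<bar> < 1" by (auto simp: eventually_sequentially)
  with S(3)[of n] show False by (simp add: D_def)
qed

lemma finite_measure_upper_variation:
  "\<mu> \<in> signed_borel_measures \<Longrightarrow> finite_measure (upper_variation \<mu>)"
  using positive_part_finite[of \<mu>]
  by (intro finite_measureI) (simp add: emeasure_upper_variation space_upper_variation)

text \<open>The Jordan decomposition.\<close>

lemma signed_measure_eq_variations:
  assumes \<mu>: "\<mu> \<in> signed_borel_measures" and A: "A \<in> sets borel"
  shows "\<mu> A = measure (upper_variation \<mu>) A - measure (lower_variation \<mu>) A"
proof -
  have le: "measure (upper_variation \<nu>) A \<le> \<nu> A + measure (upper_variation (\<lambda>A. - \<nu> A)) A"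
    if \<nu>: "\<nu> \<in> signed_borel_measures" for \<nu> :: "'a set \<Rightarrow> real"
  proof -
    let ?\<nu> = "\<lambda>A. - \<nu> A"
    have \<nu>': "?\<nu> \<in> signed_borel_measures" by (rule signed_measure_uminus[OF \<nu>])
    interpret U: finite_measure "upper_variation \<nu>" by (rule finite_measure_upper_variation[OF \<nu>])
    interpret L: finite_measure "upper_variation ?\<nu>" by (rule finite_measure_upper_variation[OF \<nu>'])
    have L: "ennreal (?\<nu> B) \<le> ennreal (measure (upper_variation ?\<nu>) A)" if "B \<in> sets borel" "B \<subseteq> A" for B
      using positive_part_upper[OF that, of ?\<nu>] emeasure_upper_variation[OF \<nu>' A] L.emeasure_eq_measure[of A] by simp
    have pt: "\<nu> B \<le> \<nu> A + measure (upper_variation ?\<nu>) A" if B: "B \<in> sets borel" "B \<subseteq> A" for B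
    proof -
      have "ennreal (?\<nu> (A - B)) \<le> ennreal (measure (upper_variation ?\<nu>) A)" using A B by (intro L) auto
      hence "?\<nu> (A - B) \<le> measure (upper_variation ?\<nu>) A"
        by (subst (asm) ennreal_le_iff) auto
      thus ?thesis using signed_measure_Diff[OF \<nu> A B] by simp
    qed
    have "0 \<le> \<nu> A + measure (upper_variation ?\<nu>) A"
      using pt[of "{}"] signed_measure_empty[OF \<nu>] by simp
    moreover have "ennreal (measure (upper_variation \<nu>) A) \<le> ennreal (\<nu> A + measure (upper_variation ?\<nu>) A)"
      unfolding U.emeasure_eq_measure[symmetric] emeasure_upper_variation[OF \<nu> A] positive_part_def
      using pt by (intro SUP_least ennreal_leI) auto
    ultimately show ?thesis by (simp add: ennreal_le_iff)
  qed
  from le[OF \<mu>] le[OF signed_measure_uminus[OF \<mu>]] show ?thesis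
    by (simp add: lower_variation_def)
qed

lemma finite_measure_density:
  fixes N :: "'a::euclidean_space measure"
  assumes "finite_measure N" "sets N = sets borel" "absolutely_continuous lborel N"
  obtains p where "integrable lborel p" "\<And>A. A \<in> sets borel \<Longrightarrow> measure N A = (LINT x:A|lborel. p x)"
proof -
  interpret N: finite_measure N by fact
  obtain f where f [measurable]: "f \<in> borel_measurable lborel" and N: "density lborel f = N"
    using sigma_finite_measure.Radon_Nikodym[OF lborel.sigma_finite_measure_axioms assms(3)] assms(2) by auto
  have em: "emeasure N A = (\<integral>\<^sup>+x. f x * indicator A x \<partial>lborel)" if "A \<in> sets borel" for A
    using that by (simp add: N[symmetric] emeasure_density)
  have fin: "(\<integral>\<^sup>+x. f x \<partial>lborel) \<noteq> \<infinity>"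
    using em[of UNIV] N.emeasure_finite[of UNIV] by simp
  have AE: "AE x in lborel. ennreal (enn2real (f x)) = f x"
    using nn_integral_PInf_AE[OF f fin] by eventually_elim (auto simp: less_top)
  show thesis
  proof (rule that[of "\<lambda>x. enn2real (f x)"])
    have "(\<integral>\<^sup>+x. ennreal (enn2real (f x)) \<partial>lborel) = (\<integral>\<^sup>+x. f x \<partial>lborel)"
      by (rule nn_integral_cong_AE) (rule AE)
    thus "integrable lborel (\<lambda>x. enn2real (f x))"
      using fin by (intro integrableI_nonneg) (auto simp: less_top)
    fix A :: "'a set" assume A [measurable]: "A \<in> sets borel"
    have "(LINT x:A|lborel. enn2real (f x)) = enn2real (\<integral>\<^sup>+x. ennreal (indicator A x *\<^sub>R enn2real (f x)) \<partial>lborel)"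
      unfolding set_lebesgue_integral_def by (rule integral_eq_nn_integral) auto
    also have "(\<integral>\<^sup>+x. ennreal (indicator A x *\<^sub>R enn2real (f x)) \<partial>lborel) = (\<integral>\<^sup>+x. f x * indicator A x \<partial>lborel)"
      by (rule nn_integral_cong_AE) (use AE in eventually_elim, auto simp: indicator_def)
    also have "enn2real \<dots> = measure N A" by (simp add: em measure_def)
    finally show "measure N A = (LINT x:A|lborel. enn2real (f x))" by simp
  qed
qed

lemma is_density_of_exists:
  fixes \<mu> :: "'a::euclidean_space set \<Rightarrow> real"
  assumes "\<mu> \<in> ac_signed_measures"
  shows "\<exists>p. is_density_of p \<mu>"
proof -
  have \<mu>: "\<mu> \<in> signed_borel_measures" and ac: "\<And>A. A \<in> null_sets lborel \<Longrightarrow> \<mu> A = 0"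
    using assms by (auto simp: ac_signed_measures_def)
  have abs: "absolutely_continuous lborel (upper_variation \<nu>)"
    if \<nu>: "\<nu> \<in> signed_borel_measures" and "\<And>A. A \<in> null_sets lborel \<Longrightarrow> \<nu> A = 0" for \<nu> :: "'a set \<Rightarrow> real"
    unfolding absolutely_continuous_def
  proof
    fix A :: "'a set" assume A: "A \<in> null_sets lborel"
    hence "A \<in> sets borel" by auto
    moreover have "positive_part \<nu> A \<le> 0"
      unfolding positive_part_def
    proof (rule SUP_least)
      fix B assume "B \<in> {B \<in> sets borel. B \<subseteq> A}"
      hence "B \<in> null_sets lborel" using A by (auto intro: null_sets_subset)
      thus "ennreal (\<nu> B) \<le> 0" using that(2) by simp
    qed
    ultimately show "A \<in> null_sets (upper_variation \<nu>)"
      by (intro null_setsI) (auto simp: emeasure_upper_variation[OF \<nu>] sets_upper_variation)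
  qed
  have \<mu>': "(\<lambda>A. - \<mu> A) \<in> signed_borel_measures" by (rule signed_measure_uminus[OF \<mu>])
  obtain p where p: "integrable lborel p" "\<And>A. A \<in> sets borel \<Longrightarrow> measure (upper_variation \<mu>) A = (LINT x:A|lborel. p x)"
    using finite_measure_density[OF finite_measure_upper_variation[OF \<mu>] sets_upper_variation abs[OF \<mu> ac]] by metis
  obtain q where q: "integrable lborel q" "\<And>A. A \<in> sets borel \<Longrightarrow> measure (lower_variation \<mu>) A = (LINT x:A|lborel. q x)"
    unfolding lower_variation_def
    using finite_measure_density[OF finite_measure_upper_variation[OF \<mu>'] sets_upper_variation abs[OF \<mu>']] ac
    by (metis neg_equal_0_iff_equal)
  have "is_density_of (\<lambda>x. p x - q x) \<mu>"
    unfolding is_density_of_def measure_with_density_def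
  proof (intro conjI ballI)
    fix A :: "'a set" assume A [measurable]: "A \<in> sets borel"
    have "set_integrable lborel A p" "set_integrable lborel A q"
      unfolding set_integrable_def using p(1) q(1) A by (intro integrable_mult_indicator; simp)+
    thus "\<mu> A = (LINT x:A|lborel. p x - q x)"
      using signed_measure_eq_variations[OF \<mu> A] p(2)[OF A] q(2)[OF A] by (simp add: set_integral_diff)
  qed (use p q in auto)
  thus ?thesis by blast
qed

lemma density_of_is_density:
  assumes "\<mu> \<in> ac_signed_measures" shows "is_density_of (density_of \<mu>) \<mu>"
proof (cases "\<exists>p. is_density_of p \<mu> \<and> continuous_on UNIV p")
  case True
  from someI_ex[OF this] show ?thesis by (simp only: density_of_def if_P[OF True])
next
  case False
  from someI_ex[OF is_density_of_exists[OF assms]] show ?thesis by (simp only: density_of_def if_not_P[OF False])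
qed

section \<open>Integration against a signed measure with a density\<close>

lemma upper_variation_density:
  fixes p :: "'a::euclidean_space \<Rightarrow> real"
  assumes "is_density_of p \<mu>"
  shows "upper_variation \<mu> = density lborel (\<lambda>x. ennreal (p x))"
proof -
  have p: "integrable lborel p" and \<mu>: "\<And>A. A \<in> sets borel \<Longrightarrow> \<mu> A = (LINT x:A|lborel. p x)"
    using assms by (auto simp: is_density_of_def measure_with_density_def)
  have [measurable]: "p \<in> borel_measurable borel" using p by auto
  let ?N = "density lborel (\<lambda>x. ennreal (p x))"
  have eq: "positive_part \<mu> A = emeasure ?N A" if A [measurable]: "A \<in> sets borel" for A
  proof (rule antisym)
    show "positive_part \<mu> A \<le> emeasure ?N A"
      unfolding positive_part_def
    proof (rule SUP_least)
      fix B assume "B \<in> {B \<in> sets borel. B \<subseteq> A}"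
      hence B [measurable]: "B \<in> sets borel" and "B \<subseteq> A" by auto
      have "\<mu> B = (\<integral>x. indicator B x *\<^sub>R p x \<partial>lborel)" by (simp add: \<mu> set_lebesgue_integral_def)
      also have "\<dots> \<le> enn2real (\<integral>\<^sup>+x. ennreal (indicator B x *\<^sub>R p x) \<partial>lborel)"
      proof -
        have "integrable lborel (\<lambda>x. indicator B x *\<^sub>R p x)" using p by (intro integrable_mult_indicator) auto
        thus ?thesis by (subst real_lebesgue_integral_def) auto
      qed
      finally have "ennreal (\<mu> B) \<le> ennreal (enn2real (\<integral>\<^sup>+x. ennreal (indicator B x *\<^sub>R p x) \<partial>lborel))"
        by (rule ennreal_leI)
      also have "\<dots> \<le> (\<integral>\<^sup>+x. ennreal (indicator B x *\<^sub>R p x) \<partial>lborel)" by (simp add: ennreal_enn2real_if)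
      also have "\<dots> \<le> (\<integral>\<^sup>+x. ennreal (p x) * indicator A x \<partial>lborel)"
        using \<open>B \<subseteq> A\<close> by (intro nn_integral_mono) (auto simp: indicator_def)
      also have "\<dots> = emeasure ?N A" by (simp add: emeasure_density)
      finally show "ennreal (\<mu> B) \<le> emeasure ?N A" .
    qed
    define B where "B = A \<inter> {x. 0 < p x}"
    have B [measurable]: "B \<in> sets borel" unfolding B_def by measurable
    have "emeasure ?N A = (\<integral>\<^sup>+x. ennreal (indicator B x *\<^sub>R p x) \<partial>lborel)"
      by (subst emeasure_density) (auto intro!: nn_integral_cong simp: B_def indicator_def ennreal_neg not_less)
    also have "\<dots> = ennreal (\<integral>x. indicator B x *\<^sub>R p x \<partial>lborel)"
    proof (rule nn_integral_eq_integral)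
      show "integrable lborel (\<lambda>x. indicator B x *\<^sub>R p x)" using p by (intro integrable_mult_indicator) auto
    qed (auto simp: B_def indicator_def)
    also have "\<dots> = ennreal (\<mu> B)" by (simp add: \<mu> set_lebesgue_integral_def)
    also have "\<dots> \<le> positive_part \<mu> A" by (rule positive_part_upper) (auto simp: B_def)
    finally show "emeasure ?N A \<le> positive_part \<mu> A" .
  qed
  have "upper_variation \<mu> = measure_of UNIV (sets borel) (emeasure ?N)"
    unfolding upper_variation_def positive_part_def[symmetric]
    by (rule measure_of_eq) (use eq sets.sigma_sets_eq[of borel] in auto)
  also have "\<dots> = ?N" using measure_of_of_measure[of ?N] by simp
  finally show ?thesis .
qed

lemma signed_integral_density:
  fixes p \<phi> :: "'a::euclidean_space \<Rightarrow> real"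
  assumes p: "is_density_of p \<mu>" and [measurable]: "\<phi> \<in> borel_measurable borel" and b: "\<And>x. \<bar>\<phi> x\<bar> \<le> B"
  shows "signed_integral \<mu> \<phi> = (\<integral>x. p x * \<phi> x \<partial>lborel)"
proof -
  have ip: "integrable lborel p" using p by (simp add: is_density_of_def)
  have [measurable]: "p \<in> borel_measurable borel" using ip by auto
  have p': "is_density_of (\<lambda>x. - p x) (\<lambda>A. - \<mu> A)"
    using p by (auto simp: is_density_of_def measure_with_density_def set_lebesgue_integral_def)
  have eq: "(\<integral>x. \<phi> x \<partial>density lborel (\<lambda>x. ennreal (g x))) = (\<integral>x. max 0 (g x) * \<phi> x \<partial>lborel)"
    if [measurable]: "g \<in> borel_measurable borel" for g :: "'a \<Rightarrow> real"
  proof -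
    have "density lborel (\<lambda>x. ennreal (g x)) = density lborel (\<lambda>x. ennreal (max 0 (g x)))"
      by (auto simp: max_def ennreal_neg intro!: density_cong)
    thus ?thesis by (simp add: integral_density)
  qed
  have i: "integrable lborel (\<lambda>x. max 0 (p x) * \<phi> x)" "integrable lborel (\<lambda>x. max 0 (- p x) * \<phi> x)"
    using ip b by (auto intro!: integrable_mult_bounded integrable_max)
  have "signed_integral \<mu> \<phi> = (\<integral>x. max 0 (p x) * \<phi> x \<partial>lborel) - (\<integral>x. max 0 (- p x) * \<phi> x \<partial>lborel)"
    unfolding signed_integral_def lower_variation_def upper_variation_density[OF p] upper_variation_density[OF p']
    by (simp add: eq)
  also have "\<dots> = (\<integral>x. max 0 (p x) * \<phi> x - max 0 (- p x) * \<phi> x \<partial>lborel)" using i by simp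
  also have "\<dots> = (\<integral>x. p x * \<phi> x \<partial>lborel)"
    by (rule Bochner_Integration.integral_cong) (auto simp: max_def algebra_simps)
  finally show ?thesis .
qed

lemma dual_bound_dist_k:
  fixes f g :: "real^'d::{finite,linorder} \<Rightarrow> real"
  assumes f: "is_density_of f \<mu>" and g: "is_density_of g \<nu>" and D: "dist_k k \<mu> \<nu> \<le> ennreal D" "0 \<le> D"
  shows "dual_bound k (\<lambda>x. f x - g x) D"
  unfolding dual_bound_def
proof (intro conjI allI impI)
  have i: "integrable lborel f" "integrable lborel g" using f g by (auto simp: is_density_of_def)
  thus "integrable lborel (\<lambda>x. f x - g x)" by simp
  fix \<Phi> :: "real^'d::{finite,linorder} \<Rightarrow> real" assume \<Phi>: "C_infinity \<Phi>" "norm_kinf k \<Phi> \<le> 1"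
  have "C_k 0 \<Phi>" using \<Phi>(1) by (auto simp: C_infinity_def)
  hence m [measurable]: "\<Phi> \<in> borel_measurable borel" by (intro borel_measurable_continuous_onI) simp
  have b: "\<bar>\<Phi> x\<bar> \<le> 1" for x
  proof -
    let ?z = "(\<lambda>_. 0) :: 'd \<Rightarrow> nat"
    have z: "?z \<in> multi_indices k" by (simp add: multi_indices_def)
    have "index_word ?z = []" by (simp add: length_index_word flip: length_0_conv)
    hence "multi_deriv ?z \<Phi> = \<Phi>" by (simp add: multi_deriv_eq_word_deriv)
    hence "ennreal \<bar>\<Phi> x\<bar> \<le> sup_norm (multi_deriv ?z \<Phi>)" unfolding sup_norm_def by (auto intro: SUP_upper)
    also have "\<dots> \<le> norm_kinf k \<Phi>"
      unfolding norm_kinf_def by (rule member_le_sum[OF z]) (auto simp: finite_multi_indices)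
    also note \<Phi>(2)
    finally show ?thesis by simp
  qed
  have "(\<integral>x. (f x - g x) * \<Phi> x \<partial>lborel) = signed_integral \<mu> \<Phi> - signed_integral \<nu> \<Phi>"
    using integrable_mult_bounded[OF i(1) _ b] integrable_mult_bounded[OF i(2) _ b]
    by (simp add: signed_integral_density[OF f m b] signed_integral_density[OF g m b] left_diff_distrib)
  moreover have "ennreal \<bar>signed_integral \<mu> \<Phi> - signed_integral \<nu> \<Phi>\<bar> \<le> dist_k k \<mu> \<nu>"
    unfolding dist_k_def using \<Phi> by (intro SUP_upper) auto
  ultimately have "ennreal \<bar>\<integral>x. (f x - g x) * \<Phi> x \<partial>lborel\<bar> \<le> ennreal D" using D(1) by (simp add: order_trans)
  thus "\<bar>\<integral>x. (f x - g x) * \<Phi> x \<partial>lborel\<bar> \<le> D" using D(2) by (simp add: ennreal_le_iff)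
qed

section \<open>Iterated differences\<close>

definition backward_diff :: "'a::real_vector \<Rightarrow> ('a \<Rightarrow> real) \<Rightarrow> 'a \<Rightarrow> real" where
  "backward_diff y g x = g x - g (x + y)"

lemma iterated_diff_eq_sum:
  "(backward_diff y ^^ M) g x = (\<Sum>j\<le>M. (- 1) ^ j * real (M choose j) * g (x + real j *\<^sub>R y))"
proof (induction M arbitrary: x)
  case (Suc M)
  let ?a = "\<lambda>j. g (x + real j *\<^sub>R y)"
  let ?c = "\<lambda>M j. (- 1) ^ j * real (M choose j)"
  have "(backward_diff y ^^ Suc M) g x = (backward_diff y ^^ M) g x - (backward_diff y ^^ M) g (x + y)"
    by (simp add: backward_diff_def)
  also have "\<dots> = (\<Sum>j\<le>M. ?c M j * ?a j) - (\<Sum>j\<le>M. ?c M j * ?a (Suc j))"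
    unfolding Suc by (simp add: algebra_simps)
  also have "(\<Sum>j\<le>M. ?c M j * ?a j) = (\<Sum>j\<le>Suc M. ?c M j * ?a j)" by simp
  also have "\<dots> = ?a 0 + (\<Sum>j\<le>M. ?c M (Suc j) * ?a (Suc j))"
    by (subst sum.atMost_Suc_shift) simp
  also have "?a 0 + (\<Sum>j\<le>M. ?c M (Suc j) * ?a (Suc j)) - (\<Sum>j\<le>M. ?c M j * ?a (Suc j))
      = ?a 0 + (\<Sum>j\<le>M. ?c (Suc M) (Suc j) * ?a (Suc j))"
  proof -
    have "?c (Suc M) (Suc j) * ?a (Suc j) = ?c M (Suc j) * ?a (Suc j) - ?c M j * ?a (Suc j)" for j
      by (simp add: algebra_simps)
    thus ?thesis by (simp only: sum_subtractf add_diff_eq)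
  qed
  also have "\<dots> = (\<Sum>j\<le>Suc M. ?c (Suc M) j * ?a j)"
    by (subst sum.atMost_Suc_shift) simp
  finally show ?case .
qed simp

lemma C_k_backward_diff: "C_k n g \<Longrightarrow> C_k n (backward_diff y g)"
  unfolding backward_diff_def[abs_def] by (intro C_k_diff C_k_translate)

lemma C_k_iterated_diff: "C_k n g \<Longrightarrow> C_k n ((backward_diff y ^^ M) g)"
  by (induction M) (auto intro: C_k_backward_diff)

lemma partial_deriv_backward_diff:
  assumes "C_k (Suc 0) g"
  shows "partial_deriv i (backward_diff y g) = backward_diff y (partial_deriv i g)"
proof -
  have "word_deriv [i] (\<lambda>x. g x - g (x + y)) = (\<lambda>x. word_deriv [i] g x - word_deriv [i] (\<lambda>x. g (x + y)) x)"
    using assms by (intro word_deriv_diff C_k_translate) auto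
  also have "word_deriv [i] (\<lambda>x. g (x + y)) = (\<lambda>x. word_deriv [i] g (x + y))"
    using assms by (intro word_deriv_translate) simp
  finally show ?thesis by (simp add: backward_diff_def[abs_def])
qed

lemma partial_deriv_iterated_diff:
  assumes "C_k (Suc 0) g"
  shows "partial_deriv i ((backward_diff y ^^ M) g) = (backward_diff y ^^ M) (partial_deriv i g)"
proof (induction M)
  case (Suc M)
  show ?case using partial_deriv_backward_diff[OF C_k_iterated_diff[OF assms]] Suc by simp
qed simp

context young_fun
begin

lemma luxemburg_uminus: "luxemburg_norm e (\<lambda>x. - f x) = luxemburg_norm e f"
  by (intro antisym luxemburg_mono) auto

lemma luxemburg_diff:
  assumes "f \<in> borel_measurable borel" "g \<in> borel_measurable borel"
  shows "luxemburg_norm e (\<lambda>x. f x - g x) \<le> luxemburg_norm e f + luxemburg_norm e g"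
  using luxemburg_add[OF assms(1), of "\<lambda>x. - g x"] assms(2) by (simp add: luxemburg_uminus)

text \<open>An increment is the average of a derivative along a segment.\<close>

lemma luxemburg_axis_diff:
  fixes g :: "real^'d::finite \<Rightarrow> real"
  assumes g: "C_k (Suc 0) g"
  shows "luxemburg_norm e (backward_diff (s *\<^sub>R axis i 1) g) \<le> ennreal \<bar>s\<bar> * luxemburg_norm e (partial_deriv i g)"
proof -
  let ?e = "axis i (1::real)" and ?g = "partial_deriv i g"
  let ?N = "density lborel (indicator {0..1::real})"
  have N: "prob_space ?N" by (rule prob_spaceI) (simp add: emeasure_density)
  have c: "continuous_on UNIV ?g" using C_k_partial_deriv[OF g] by simp
  have [measurable]: "?g \<in> borel_measurable borel" by (rule borel_measurable_continuous_onI[OF c])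
  let ?F = "\<lambda>t x. - s * ?g (x + t *\<^sub>R (s *\<^sub>R ?e))"
  have cont: "continuous_on UNIV (\<lambda>t. ?F t x)" for x
    by (intro continuous_intros continuous_on_compose2[OF c]) auto
  have has: "has_bochner_integral lborel (\<lambda>t. ?F t x * indicator {0..1} t) (- g (x + 1 *\<^sub>R (s *\<^sub>R ?e)) - - g (x + 0 *\<^sub>R (s *\<^sub>R ?e)))" for x
  proof (rule has_bochner_integral_FTC_Icc_real)
    fix t
    have 1: "((\<lambda>t. g (x + t *\<^sub>R ?e)) has_real_derivative ?g (x + (t * s) *\<^sub>R ?e)) (at (t * s))" by (rule C_k_DERIV[OF g])
    have 2: "((\<lambda>t. t * s) has_real_derivative s) (at t)" by (auto intro!: derivative_eq_intros)
    have "((\<lambda>t. g (x + (t * s) *\<^sub>R ?e)) has_real_derivative ?g (x + (t * s) *\<^sub>R ?e) * s) (at t)"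
      by (rule DERIV_chain2[OF 1 2])
    from DERIV_minus[OF this]
    show "((\<lambda>t. - g (x + t *\<^sub>R (s *\<^sub>R ?e))) has_real_derivative ?F t x) (at t)" by (simp add: mult.commute)
    show "isCont (\<lambda>t. ?F t x) t" using cont[of x] by (simp add: continuous_on_eq_continuous_at)
  qed simp
  have eq: "backward_diff (s *\<^sub>R ?e) g = (\<lambda>x. \<integral>t. ?F t x \<partial>?N)"
  proof
    fix x
    have "(\<integral>t. ?F t x \<partial>?N) = (\<integral>t. indicator {0..1} t *\<^sub>R ?F t x \<partial>lborel)"
      using integral_density[of "\<lambda>t. ?F t x" lborel "indicator {0..1}"] by (simp add: ennreal_indicator)
    also have "\<dots> = g x - g (x + s *\<^sub>R ?e)"
      using has[of x, THEN has_bochner_integral_integral_eq] by (simp add: mult.commute)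
    finally show "backward_diff (s *\<^sub>R ?e) g x = (\<integral>t. ?F t x \<partial>?N)" by (simp add: backward_diff_def)
  qed
  show ?thesis unfolding eq
  proof (rule luxemburg_average[OF N])
    show "(\<lambda>(t, x). ?F t x) \<in> borel_measurable (?N \<Otimes>\<^sub>M lborel)" by measurable
    show "integrable ?N (\<lambda>t. ?F t x)" for x
      using has[of x, THEN integrable.intros] integrable_density[of "\<lambda>t. ?F t x" lborel "indicator {0..1}"]
      by (simp add: mult.commute ennreal_indicator)
    have "luxemburg_norm e (?F t) \<le> ennreal \<bar>- s\<bar> * luxemburg_norm e ?g" for t
      using luxemburg_cmult[of "- s" "\<lambda>x. ?g (x + t *\<^sub>R (s *\<^sub>R ?e))"] luxemburg_translate[of ?g "t *\<^sub>R (s *\<^sub>R ?e)"] by simp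
    thus "AE t in ?N. luxemburg_norm e (?F t) \<le> ennreal \<bar>s\<bar> * luxemburg_norm e ?g" by simp
  qed
qed

lemma luxemburg_backward_diff:
  fixes g :: "real^'d::finite \<Rightarrow> real"
  assumes g: "C_k (Suc 0) g" and B: "\<And>i. luxemburg_norm e (partial_deriv i g) \<le> B"
  shows "luxemburg_norm e (backward_diff y g) \<le> ennreal (real CARD('d) * norm y) * B"
proof -
  have [measurable]: "g \<in> borel_measurable borel" using C_k_continuous[OF g] by (rule borel_measurable_continuous_onI)
  have "luxemburg_norm e (backward_diff (\<Sum>i\<in>I. y $ i *\<^sub>R axis i 1) g) \<le> (\<Sum>i\<in>I. ennreal (norm y) * B)"
    if "finite I" for I
    using that
  proof (induction I)
    case empty
    have "backward_diff 0 g = (\<lambda>_. 0)" by (simp add: backward_diff_def[abs_def])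
    thus ?case by simp
  next
    case (insert i I)
    let ?z = "\<Sum>i\<in>I. y $ i *\<^sub>R axis i (1::real)" and ?d = "backward_diff (y $ i *\<^sub>R axis i 1) g"
    have [measurable]: "backward_diff z g \<in> borel_measurable borel" for z
      unfolding backward_diff_def by measurable
    have eq: "backward_diff (\<Sum>i\<in>insert i I. y $ i *\<^sub>R axis i 1) g = (\<lambda>x. ?d (x + ?z) + backward_diff ?z g x)"
      using insert by (simp add: backward_diff_def fun_eq_iff add_ac)
    have "luxemburg_norm e (backward_diff (\<Sum>i\<in>insert i I. y $ i *\<^sub>R axis i 1) g) \<le> luxemburg_norm e (\<lambda>x. ?d (x + ?z)) + luxemburg_norm e (backward_diff ?z g)"
      unfolding eq by (rule luxemburg_add) measurable
    also have "\<dots> \<le> ennreal (norm y) * B + (\<Sum>i\<in>I. ennreal (norm y) * B)"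
    proof (rule add_mono[OF _ insert.IH])
      have "luxemburg_norm e (\<lambda>x. ?d (x + ?z)) = luxemburg_norm e ?d" by (rule luxemburg_translate) measurable
      also have "\<dots> \<le> ennreal \<bar>y $ i\<bar> * luxemburg_norm e (partial_deriv i g)" by (rule luxemburg_axis_diff[OF g])
      also have "\<dots> \<le> ennreal (norm y) * B" by (intro mult_mono ennreal_leI component_le_norm_cart B) auto
      finally show "luxemburg_norm e (\<lambda>x. ?d (x + ?z)) \<le> ennreal (norm y) * B" .
    qed
    finally show ?case by (simp only: sum.insert[OF insert.hyps])
  qed
  from this[of UNIV]
  have "luxemburg_norm e (backward_diff (\<Sum>i\<in>UNIV. y $ i *\<^sub>R axis i 1) g) \<le> of_nat CARD('d) * (ennreal (norm y) * B)" by simp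
  moreover have "(\<Sum>i\<in>UNIV. y $ i *\<^sub>R axis i 1) = y"
    by (simp add: vec_eq_iff axis_def if_distrib cong: if_cong)
  ultimately show ?thesis by (simp add: ennreal_mult ennreal_of_nat_eq_real_of_nat mult.assoc)
qed

lemma luxemburg_iterated_diff:
  fixes g :: "real^'d::finite \<Rightarrow> real"
  assumes "C_k M g" and "\<And>w. length w = M \<Longrightarrow> luxemburg_norm e (word_deriv w g) \<le> B"
  shows "luxemburg_norm e ((backward_diff y ^^ M) g) \<le> ennreal ((real CARD('d) * norm y) ^ M) * B"
  using assms
proof (induction M arbitrary: g)
  case (Suc M)
  let ?r = "real CARD('d) * norm y"
  have g1: "C_k (Suc 0) g" using Suc.prems(1) by (rule C_k_mono) simp
  have "luxemburg_norm e (backward_diff y ((backward_diff y ^^ M) g)) \<le> ennreal ?r * (ennreal (?r ^ M) * B)"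
  proof (rule luxemburg_backward_diff[OF C_k_iterated_diff[OF g1]])
    fix i
    have "luxemburg_norm e ((backward_diff y ^^ M) (partial_deriv i g)) \<le> ennreal (?r ^ M) * B"
    proof (rule Suc.IH[OF C_k_partial_deriv[OF Suc.prems(1)]])
      fix w :: "'d list" assume "length w = M"
      thus "luxemburg_norm e (word_deriv w (partial_deriv i g)) \<le> B" using Suc.prems(2)[of "w @ [i]"] by simp
    qed
    thus "luxemburg_norm e (partial_deriv i ((backward_diff y ^^ M) g)) \<le> ennreal (?r ^ M) * B"
      by (simp add: partial_deriv_iterated_diff[OF g1])
  qed
  thus ?case by (simp add: ennreal_mult mult.assoc)
qed (use assms(2)[of "[]"] in simp)

end

section \<open>Smoothing operators\<close>

text \<open>
  The average of \<open>g\<close> over the ball of radius \<open>h\<close> with weight \<open>\<eta>\<close>, and the combination of such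
  averages that reproduces \<open>g\<close> up to an averaged difference of order \<open>M\<close>, at scale \<open>2\<^sup>-\<^sup>n\<close>.
\<close>

definition average :: "('a::euclidean_space \<Rightarrow> real) \<Rightarrow> real \<Rightarrow> ('a \<Rightarrow> real) \<Rightarrow> 'a \<Rightarrow> real" where
  "average \<eta> h g x = (\<integral>y. \<eta> y * g (x + h *\<^sub>R y) \<partial>lborel)"

definition smoothing :: "('a::euclidean_space \<Rightarrow> real) \<Rightarrow> nat \<Rightarrow> nat \<Rightarrow> ('a \<Rightarrow> real) \<Rightarrow> 'a \<Rightarrow> real" where
  "smoothing \<eta> M n g x = - (\<Sum>j=1..M. (- 1) ^ j * real (M choose j) * average \<eta> (real j / 2 ^ n) g x)"

lemma average_integrable:
  assumes "\<eta> \<in> test_functions" "continuous_on UNIV g"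
  shows "integrable lborel (\<lambda>y. \<eta> y * g (x + h *\<^sub>R y))"
proof (rule integrable_unit_ball_support)
  show "continuous_on UNIV (\<lambda>y. \<eta> y * g (x + h *\<^sub>R y))"
    by (intro continuous_intros test_function_continuous[OF assms(1)] continuous_on_compose2[OF assms(2)]) auto
qed (simp add: test_function_support[OF assms(1)])

lemma average_measurable:
  assumes "\<eta> \<in> test_functions" "continuous_on UNIV g"
  shows "average \<eta> h g \<in> borel_measurable borel"
proof -
  have [measurable]: "\<eta> \<in> borel_measurable borel" "g \<in> borel_measurable borel"
    using assms by (auto intro: test_function_measurable borel_measurable_continuous_onI)
  show ?thesis unfolding average_def by measurable
qed

lemma smoothing_measurable:
  assumes "\<eta> \<in> test_functions" "continuous_on UNIV g"
  shows "smoothing \<eta> M n g \<in> borel_measurable borel"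
  unfolding smoothing_def using average_measurable[OF assms] by measurable

lemma smoothing_add:
  assumes "\<eta> \<in> test_functions" "continuous_on UNIV f" "continuous_on UNIV g"
  shows "smoothing \<eta> M n (\<lambda>x. f x + g x) x = smoothing \<eta> M n f x + smoothing \<eta> M n g x"
proof -
  have "average \<eta> h (\<lambda>x. f x + g x) x = average \<eta> h f x + average \<eta> h g x" for h
    using average_integrable[OF assms(1,2)] average_integrable[OF assms(1,3)]
    by (simp add: average_def distrib_left)
  thus ?thesis by (simp add: smoothing_def distrib_left sum.distrib)
qed

text \<open>A smooth probability density supported in the unit ball.\<close>

locale mollifier =
  fixes \<eta> :: "real^'d::{finite,linorder} \<Rightarrow> real"
  assumes \<eta>: "\<eta> \<in> test_functions" and \<eta>_nonneg: "\<And>x. 0 \<le> \<eta> x" and \<eta>_integral: "integral\<^sup>L lborel \<eta> = 1"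
begin

lemma average_tendsto:
  assumes g: "continuous_on UNIV g"
  shows "(\<lambda>n. average \<eta> (real j / 2 ^ n) g x) \<longlonglongrightarrow> g x"
proof -
  note [measurable] = test_function_measurable[OF \<eta>] borel_measurable_continuous_onI[OF g]
  have "bounded (g ` cball x (real j))"
    using g by (intro compact_imp_bounded compact_continuous_image) (auto intro: continuous_on_subset)
  then obtain B where "\<forall>z\<in>cball x (real j). \<bar>g z\<bar> \<le> B" unfolding bounded_iff by auto
  hence B: "\<bar>g z\<bar> \<le> B" if "z \<in> cball x (real j)" for z using that by blast
  have "(\<lambda>n. \<integral>y. \<eta> y * g (x + (real j / 2 ^ n) *\<^sub>R y) \<partial>lborel) \<longlonglongrightarrow> (\<integral>y. \<eta> y * g x \<partial>lborel)"
  proof (rule integral_dominated_convergence[where w = "\<lambda>y. \<eta> y * B"])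
    show "AE y in lborel. norm (\<eta> y * g (x + (real j / 2 ^ n) *\<^sub>R y)) \<le> \<eta> y * B" for n
    proof (intro AE_I2)
      fix y
      show "norm (\<eta> y * g (x + (real j / 2 ^ n) *\<^sub>R y)) \<le> \<eta> y * B"
      proof (cases "1 < norm y")
        case False
        have "real j / 2 ^ n * norm y \<le> real j * 1"
          using False by (intro mult_mono) (auto simp: divide_le_eq mult_le_cancel_left1)
        hence "\<bar>g (x + (real j / 2 ^ n) *\<^sub>R y)\<bar> \<le> B" by (intro B) (simp add: dist_norm)
        thus ?thesis using \<eta>_nonneg[of y] by (simp add: abs_mult mult_left_mono)
      qed (simp add: test_function_support[OF \<eta>])
    qed
    show "AE y in lborel. (\<lambda>n. \<eta> y * g (x + (real j / 2 ^ n) *\<^sub>R y)) \<longlonglongrightarrow> \<eta> y * g x"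
    proof (intro AE_I2 tendsto_mult tendsto_const)
      fix y
      have "(\<lambda>n. real j * (1 / 2) ^ n) \<longlonglongrightarrow> real j * 0" by (intro tendsto_intros LIMSEQ_power_zero) simp
      hence "(\<lambda>n. real j / 2 ^ n) \<longlonglongrightarrow> 0" by (simp add: power_divide)
      hence "(\<lambda>n. x + (real j / 2 ^ n) *\<^sub>R y) \<longlonglongrightarrow> x + 0 *\<^sub>R y" by (intro tendsto_intros)
      moreover have "isCont g x" using g by (simp add: continuous_on_eq_continuous_at)
      ultimately show "(\<lambda>n. g (x + (real j / 2 ^ n) *\<^sub>R y)) \<longlonglongrightarrow> g x"
        by (intro isCont_tendsto_compose[of x g]) auto
    qed
  qed (use test_function_integrable[OF \<eta>] in auto)
  thus ?thesis by (simp add: average_def \<eta>_integral)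
qed

lemma smoothing_tendsto:
  assumes g: "continuous_on UNIV g" and M: "0 < M"
  shows "(\<lambda>n. smoothing \<eta> M n g x) \<longlonglongrightarrow> g x"
proof -
  have "(\<lambda>n. smoothing \<eta> M n g x) \<longlonglongrightarrow> - (\<Sum>j=1..M. (- 1) ^ j * real (M choose j) * g x)"
    unfolding smoothing_def by (intro tendsto_intros average_tendsto g)
  also have "- (\<Sum>j=1..M. (- 1) ^ j * real (M choose j) * g x) = g x"
  proof -
    have "(\<Sum>j\<le>M. (- 1) ^ j * real (M choose j)) = 0" using choose_alternating_sum[OF M, where 'a = real] .
    moreover have "{..M} = insert 0 {1..M}" by auto
    ultimately have "(\<Sum>j=1..M. (- 1) ^ j * real (M choose j)) = - 1" by simp
    thus ?thesis by (simp flip: sum_distrib_right)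
  qed
  finally show ?thesis .
qed

lemma smoothing_error_eq:
  assumes g: "continuous_on UNIV g"
  shows "g x - smoothing \<eta> M n g x = (\<integral>y. \<eta> y * (backward_diff ((1 / 2 ^ n) *\<^sub>R y) ^^ M) g x \<partial>lborel)"
proof -
  have "(\<integral>y. \<eta> y * (backward_diff ((1 / 2 ^ n) *\<^sub>R y) ^^ M) g x \<partial>lborel)
      = (\<integral>y. (\<Sum>j\<le>M. (- 1) ^ j * real (M choose j) * (\<eta> y * g (x + (real j / 2 ^ n) *\<^sub>R y))) \<partial>lborel)"
    by (simp add: iterated_diff_eq_sum sum_distrib_left mult_ac)
  also have "\<dots> = (\<Sum>j\<le>M. (- 1) ^ j * real (M choose j) * average \<eta> (real j / 2 ^ n) g x)"
    using average_integrable[OF \<eta> g] by (subst Bochner_Integration.integral_sum) (auto simp: average_def)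
  also have "{..M} = insert 0 {1..M}" by auto
  also have "(\<Sum>j\<in>insert 0 {1..M}. (- 1) ^ j * real (M choose j) * average \<eta> (real j / 2 ^ n) g x)
      = average \<eta> 0 g x - smoothing \<eta> M n g x"
    by (simp add: smoothing_def)
  also have "average \<eta> 0 g x = g x" by (simp add: average_def \<eta>_integral)
  finally show ?thesis by simp
qed

end

locale young_mollifier = young_fun e + mollifier \<eta> for e :: "real \<Rightarrow> real" and \<eta> :: "real^'d::{finite,linorder} \<Rightarrow> real"
begin

text \<open>The order of approximation: \<open>\<parallel>g - S\<^sub>n g\<parallel>\<close> is at most \<open>2\<^sup>-\<^sup>n\<^sup>M\<close> times the derivatives of order \<open>M\<close>.\<close>

lemma luxemburg_smoothing_error:
  assumes g: "C_k M g" and B: "\<And>w. length w = M \<Longrightarrow> luxemburg_norm e (word_deriv w g) \<le> B"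
  shows "luxemburg_norm e (\<lambda>x. g x - smoothing \<eta> M n g x) \<le> ennreal ((real CARD('d) / 2 ^ n) ^ M) * B"
proof -
  have gc: "continuous_on UNIV g" by (rule C_k_continuous[OF g])
  note [measurable] = test_function_measurable[OF \<eta>] borel_measurable_continuous_onI[OF gc]
  let ?N = "density lborel (\<lambda>y. ennreal (\<eta> y))"
  let ?F = "\<lambda>y x. (backward_diff ((1 / 2 ^ n) *\<^sub>R y) ^^ M) g x"
  have N: "prob_space ?N"
  proof (rule prob_spaceI)
    have "(\<integral>\<^sup>+y. ennreal (\<eta> y) \<partial>lborel) = ennreal 1"
      using nn_integral_eq_integral[OF test_function_integrable[OF \<eta>]] \<eta>_nonneg \<eta>_integral by simp
    thus "emeasure ?N (space ?N) = 1" by (simp add: emeasure_density)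
  qed
  have [measurable]: "(\<lambda>(y, x). ?F y x) \<in> borel_measurable (lborel \<Otimes>\<^sub>M lborel)"
    unfolding iterated_diff_eq_sum by measurable
  have [measurable]: "(\<lambda>y. ?F y x) \<in> borel_measurable lborel" for x
    unfolding iterated_diff_eq_sum by measurable
  have int: "integrable lborel (\<lambda>y. \<eta> y * ?F y x)" for x
  proof -
    have "integrable lborel (\<lambda>y. \<Sum>j\<le>M. (- 1) ^ j * real (M choose j) * (\<eta> y * g (x + (real j / 2 ^ n) *\<^sub>R y)))"
      using average_integrable[OF \<eta> gc] by (intro Bochner_Integration.integrable_sum integrable_mult_right)
    thus ?thesis by (simp add: iterated_diff_eq_sum sum_distrib_left mult_ac)
  qed
  have eq: "(\<lambda>x. g x - smoothing \<eta> M n g x) = (\<lambda>x. \<integral>y. ?F y x \<partial>?N)"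
    using \<eta>_nonneg by (simp add: smoothing_error_eq[OF gc] integral_density fun_eq_iff)
  show ?thesis unfolding eq
  proof (rule luxemburg_average[OF N])
    show "(\<lambda>(y, x). ?F y x) \<in> borel_measurable (?N \<Otimes>\<^sub>M lborel)" by measurable
    show "integrable ?N (\<lambda>y. ?F y x)" for x
      using int \<eta>_nonneg by (subst integrable_density) auto
    show "AE y in ?N. luxemburg_norm e (?F y) \<le> ennreal ((real CARD('d) / 2 ^ n) ^ M) * B"
    proof (subst AE_density)
      show "AE y in lborel. 0 < ennreal (\<eta> y) \<longrightarrow> luxemburg_norm e (?F y) \<le> ennreal ((real CARD('d) / 2 ^ n) ^ M) * B"
      proof (intro AE_I2 impI)
        fix y assume "0 < ennreal (\<eta> y)"
        hence y: "norm y \<le> 1" using test_function_support[OF \<eta>, of y] by (cases "1 < norm y") auto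
        have "luxemburg_norm e (?F y) \<le> ennreal ((real CARD('d) * norm ((1 / 2 ^ n) *\<^sub>R y)) ^ M) * B"
          by (rule luxemburg_iterated_diff[OF g B])
        also have "\<dots> \<le> ennreal ((real CARD('d) / 2 ^ n) ^ M) * B"
          using y by (intro mult_right_mono ennreal_leI power_mono) (auto simp: divide_le_cancel mult_le_cancel_left2)
        finally show "luxemburg_norm e (?F y) \<le> ennreal ((real CARD('d) / 2 ^ n) ^ M) * B" .
      qed
    qed simp
  qed
qed

end

context young_mollifier
begin

section \<open>The two estimates at one scale\<close>

text \<open>
  For \<open>g\<close> controlled in the dual norm only, \<open>\<partial>\<^sub>w\<close> is moved onto the kernel; each derivative and
  each order of the dual norm costs a factor \<open>2\<^sup>n\<close>, and the passage from \<open>L\<^sup>1\<close> to the Luxemburg norm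
  costs \<open>\<beta>(2\<^sup>n\<^sup>d)\<close>.
\<close>

lemma luxemburg_average_dual:
  fixes w :: "'d list"
  assumes w: "length w \<le> q"
  shows "\<exists>C>0. \<forall>h n g D. 0 < h \<longrightarrow> 1 / h \<le> 2 ^ Suc n \<longrightarrow> C_k (length w) g \<longrightarrow> dual_bound k g D \<longrightarrow> 0 \<le> D \<longrightarrow>
    luxemburg_norm e (average \<eta> h (word_deriv w g))
      \<le> ennreal (C * (2 ^ (n * (q + k)) * young_beta e (2 ^ (n * CARD('d))) * D))"
proof -
  define G where "G = word_deriv (rev w) \<eta>"
  have G: "G \<in> test_functions" unfolding G_def by (rule word_deriv_test_function[OF \<eta>])
  obtain C1 where C1: "0 < C1" "\<And>h r g D x. 0 < h \<Longrightarrow> 1 / h \<le> r \<Longrightarrow> 1 \<le> r \<Longrightarrow> dual_bound k g D \<Longrightarrow>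
      \<bar>\<integral>y. G y * g (x + h *\<^sub>R y) \<partial>lborel\<bar> \<le> C1 * r ^ (k + CARD('d)) * D"
    using smoothing_sup_bound[OF G, of k] by blast
  obtain C2 where C2: "0 < C2" "\<And>h r g D. 0 < h \<Longrightarrow> 1 / h \<le> r \<Longrightarrow> 1 \<le> r \<Longrightarrow> dual_bound k g D \<Longrightarrow>
      (\<integral>\<^sup>+x. ennreal \<bar>\<integral>y. G y * g (x + h *\<^sub>R y) \<partial>lborel\<bar> \<partial>lborel) \<le> ennreal (C2 * r ^ k * D)"
    using smoothing_L1_bound[OF G, of k] by blast
  define K where "K = max C1 C2"
  have K: "0 < K" "C1 \<le> K" "C2 \<le> K" using C1 by (auto simp: K_def)
  define E where "E = K * 2 ^ (q + k + CARD('d))"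
  show ?thesis
  proof (intro exI[of _ E] conjI allI impI)
    show "0 < E" using K by (simp add: E_def)
    fix h D :: real and n and g :: "real^'d::{finite,linorder} \<Rightarrow> real"
    assume h: "0 < h" "1 / h \<le> 2 ^ Suc n" and g: "C_k (length w) g" and D: "dual_bound k g D" "0 \<le> D"
    \<comment> \<open>The exponent \<open>n + 1\<close> covers both operators in the increment \<open>S\<^sub>n\<^sub>+\<^sub>1 - S\<^sub>n\<close>.\<close>
    define r :: real where "r = 2 ^ Suc n"
    have r: "1 \<le> r" "1 / h \<le> r" using h(2) unfolding r_def by (simp_all only: one_le_power)
    define H where "H x = (\<integral>y. G y * g (x + h *\<^sub>R y) \<partial>lborel)" for x
    have eq: "average \<eta> h (word_deriv w g) = (\<lambda>x. (- (1 / h)) ^ length w * H x)"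
      using integration_by_parts_word[OF \<eta> g, of h] h(1) by (simp add: average_def[abs_def] H_def G_def)
    have abs: "\<bar>(- (1 / h)) ^ length w\<bar> \<le> r ^ q"
      using power_le_power_of_inverse[OF h(1) r(2,1) w] h(1) by (simp add: power_abs)
    have sup: "\<bar>H x\<bar> \<le> C1 * r ^ (k + CARD('d)) * D" for x
      unfolding H_def by (rule C1(2)[OF h(1) r(2,1) D(1)])
    show "luxemburg_norm e (average \<eta> h (word_deriv w g))
      \<le> ennreal (E * (2 ^ (n * (q + k)) * young_beta e (2 ^ (n * CARD('d))) * D))"
    proof (cases "D = 0")
      case True
      hence "average \<eta> h (word_deriv w g) = (\<lambda>_. 0)" using sup by (simp add: eq)
      thus ?thesis by simp
    next
      case False
      define A where "A = E * 2 ^ (n * (q + k)) * D"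
      have A: "0 < A" using False D K by (simp add: A_def E_def)
      have Dpos: "0 < D" using False D by simp
      have pw: "r ^ (q + k + c) = 2 ^ (q + k + c) * 2 ^ (n * (q + k)) * 2 ^ (n * c)" for c
        by (simp add: r_def power_add power_mult_distrib algebra_simps flip: power_mult)
      have "luxemburg_norm e (average \<eta> h (word_deriv w g)) \<le> ennreal (A * young_beta e (2 ^ (n * CARD('d))))"
      proof (rule luxemburg_interpolation)
        have "continuous_on UNIV (word_deriv w g)" using g by (rule word_deriv_continuous) simp
        thus m: "average \<eta> h (word_deriv w g) \<in> borel_measurable borel" by (rule average_measurable[OF \<eta>])
        show "0 < A" by (rule A)
        show "\<bar>average \<eta> h (word_deriv w g) x\<bar> \<le> A * 2 ^ (n * CARD('d))" for x
        proof -
          have "\<bar>average \<eta> h (word_deriv w g) x\<bar> \<le> r ^ q * (C1 * r ^ (k + CARD('d)) * D)"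
            unfolding eq abs_mult using abs sup r by (intro mult_mono) auto
          also have "\<dots> = C1 * (r ^ (q + k + CARD('d)) * D)" by (simp add: power_add)
          also have "\<dots> \<le> K * (r ^ (q + k + CARD('d)) * D)"
            using K Dpos r by (intro mult_right_mono) auto
          also have "\<dots> = A * 2 ^ (n * CARD('d))" unfolding pw by (simp add: A_def E_def)
          finally show ?thesis .
        qed
        have Hm: "H \<in> borel_measurable borel"
          using dual_bound_def[of k g D] D(1) G unfolding H_def
          by (auto intro!: lborel.borel_measurable_lebesgue_integral dest: test_function_measurable)
        have "(\<integral>\<^sup>+x. ennreal \<bar>average \<eta> h (word_deriv w g) x\<bar> \<partial>lborel)
            \<le> (\<integral>\<^sup>+x. ennreal (r ^ q) * ennreal \<bar>H x\<bar> \<partial>lborel)"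
          unfolding eq abs_mult using abs r
          by (intro nn_integral_mono) (auto simp: mult_right_mono simp flip: ennreal_mult intro!: ennreal_leI)
        also have "\<dots> = ennreal (r ^ q) * (\<integral>\<^sup>+x. ennreal \<bar>H x\<bar> \<partial>lborel)"
          using Hm by (intro nn_integral_cmult) measurable
        also have "\<dots> \<le> ennreal (r ^ q) * ennreal (C2 * r ^ k * D)"
          unfolding H_def by (intro mult_left_mono C2(2)[OF h(1) r(2,1) D(1)]) simp
        also have "\<dots> = ennreal (C2 * (r ^ (q + k + 0) * D))"
          using r C2 Dpos by (simp add: power_add mult_ac flip: ennreal_mult)
        also have "\<dots> \<le> ennreal A"
        proof (rule ennreal_leI)
          have "C2 * (r ^ (q + k + 0) * D) \<le> K * (r ^ (q + k + 0) * D)"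
            using K Dpos r by (intro mult_right_mono) auto
          also have "\<dots> = K * 2 ^ (q + k) * (2 ^ (n * (q + k)) * D)" unfolding pw by simp
          also have "\<dots> \<le> K * 2 ^ (q + k + CARD('d)) * (2 ^ (n * (q + k)) * D)"
            using K Dpos by (intro mult_right_mono mult_left_mono power_increasing) auto
          also have "\<dots> = A" by (simp add: A_def E_def)
          finally show "C2 * (r ^ (q + k + 0) * D) \<le> A" .
        qed
        finally show "(\<integral>\<^sup>+x. ennreal \<bar>average \<eta> h (word_deriv w g) x\<bar> \<partial>lborel) \<le> ennreal A" .
      qed simp
      thus ?thesis by (simp add: A_def mult_ac)
    qed
  qed
qed

text \<open>Since the sum defining \<open>S\<^sub>n\<close> starts at \<open>j = 1\<close>, all radii are at least \<open>2\<^sup>-\<^sup>n\<close>.\<close>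

lemma luxemburg_smoothing_dual:
  fixes w :: "'d list"
  assumes w: "length w \<le> q"
  shows "\<exists>C>0. \<forall>n n' f p \<mu> \<nu>. n \<le> n' \<longrightarrow> n' \<le> Suc n \<longrightarrow> C_k (length w) f \<longrightarrow> C_k (length w) p \<longrightarrow>
      is_density_of f \<mu> \<longrightarrow> is_density_of p \<nu> \<longrightarrow>
    luxemburg_norm e (smoothing \<eta> M n' (word_deriv w (\<lambda>x. f x - p x)))
      \<le> ennreal C * (ennreal (2 ^ (n * (q + k)) * young_beta e (2 ^ (n * CARD('d)))) * dist_k k \<mu> \<nu>)"
proof -
  obtain C where C: "0 < C" "\<And>h n g D. 0 < h \<Longrightarrow> 1 / h \<le> 2 ^ Suc n \<Longrightarrow> C_k (length w) g \<Longrightarrow> dual_bound k g D \<Longrightarrow> 0 \<le> D \<Longrightarrow>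
    luxemburg_norm e (average \<eta> h (word_deriv w g))
      \<le> ennreal (C * (2 ^ (n * (q + k)) * young_beta e (2 ^ (n * CARD('d))) * D))"
    using luxemburg_average_dual[OF w, of k] by blast
  define c where "c = (\<Sum>j=1..M. real (M choose j))"
  have c: "0 \<le> c" unfolding c_def by (rule sum_nonneg) simp
  show ?thesis
  proof (intro exI[of _ "(c + 1) * C"] conjI allI impI)
    show "0 < (c + 1) * C" using C c by simp
    fix n n' :: nat and f p :: "real^'d::{finite,linorder} \<Rightarrow> real" and \<mu> \<nu>
    assume n': "n \<le> n'" "n' \<le> Suc n" and f: "C_k (length w) f" "is_density_of f \<mu>" and p: "C_k (length w) p" "is_density_of p \<nu>"
    define b where "b = 2 ^ (n * (q + k)) * young_beta e (2 ^ (n * CARD('d)))"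
    have b: "0 < b" unfolding b_def by (intro mult_pos_pos young_beta_pos) auto
    show "luxemburg_norm e (smoothing \<eta> M n' (word_deriv w (\<lambda>x. f x - p x)))
      \<le> ennreal ((c + 1) * C) * (ennreal (2 ^ (n * (q + k)) * young_beta e (2 ^ (n * CARD('d)))) * dist_k k \<mu> \<nu>)"
      unfolding b_def[symmetric]
    proof (cases "dist_k k \<mu> \<nu>")
      case top
      have "ennreal ((c + 1) * C) * top = top" "ennreal b * top = top"
        using C c b by (auto intro!: ennreal_mult_top simp: ennreal_eq_0_iff not_le)
      thus "luxemburg_norm e (smoothing \<eta> M n' (word_deriv w (\<lambda>x. f x - p x))) \<le> ennreal ((c + 1) * C) * (ennreal b * dist_k k \<mu> \<nu>)"
        by (simp add: top)
    next
      case (real D)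
      have db: "dual_bound k (\<lambda>x. f x - p x) D"
        using real by (intro dual_bound_dist_k[OF f(2) p(2)]) auto
      have C': "C_k (length w) (\<lambda>x. f x - p x)" by (rule C_k_diff[OF f(1) p(1)])
      let ?g = "word_deriv w (\<lambda>x. f x - p x)"
      have cont: "continuous_on UNIV ?g" using C' by (rule word_deriv_continuous) simp
      have av: "luxemburg_norm e (average \<eta> (real j / 2 ^ n') ?g) \<le> ennreal (C * (b * D))" if "j \<in> {1..M}" for j
      proof -
        have j: "1 \<le> real j" using that by simp
        have "1 / (real j / 2 ^ n') = 2 ^ n' / real j" by simp
        also have "\<dots> \<le> 2 ^ n' / 1" using j by (intro divide_left_mono) auto
        also have "\<dots> \<le> 2 ^ Suc n" unfolding div_by_1 using n' by (intro power_increasing) auto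
        finally have "1 / (real j / 2 ^ n') \<le> 2 ^ Suc n" .
        moreover have "0 < real j / 2 ^ n'" using j by simp
        ultimately show ?thesis unfolding b_def by (intro C(2) C' db real) auto
      qed
      have "luxemburg_norm e (smoothing \<eta> M n' ?g)
          = luxemburg_norm e (\<lambda>x. \<Sum>j=1..M. (- 1) ^ j * real (M choose j) * average \<eta> (real j / 2 ^ n') ?g x)"
        unfolding smoothing_def by (rule luxemburg_uminus)
      also have "\<dots> \<le> (\<Sum>j=1..M. luxemburg_norm e (\<lambda>x. (- 1) ^ j * real (M choose j) * average \<eta> (real j / 2 ^ n') ?g x))"
        using average_measurable[OF \<eta> cont] by (intro luxemburg_sum) auto
      also have "\<dots> \<le> (\<Sum>j=1..M. ennreal (real (M choose j) * (C * (b * D))))"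
      proof (rule sum_mono)
        fix j assume j: "j \<in> {1..M}"
        have "luxemburg_norm e (\<lambda>x. (- 1) ^ j * real (M choose j) * average \<eta> (real j / 2 ^ n') ?g x)
            \<le> ennreal \<bar>(- 1) ^ j * real (M choose j)\<bar> * luxemburg_norm e (average \<eta> (real j / 2 ^ n') ?g)"
          by (rule luxemburg_cmult)
        also have "\<dots> \<le> ennreal (real (M choose j)) * ennreal (C * (b * D))"
          by (intro mult_mono av[OF j]) (auto simp: abs_mult power_abs)
        also have "\<dots> = ennreal (real (M choose j) * (C * (b * D)))"
          using C b real by (simp flip: ennreal_mult)
        finally show "luxemburg_norm e (\<lambda>x. (- 1) ^ j * real (M choose j) * average \<eta> (real j / 2 ^ n') ?g x)
            \<le> ennreal (real (M choose j) * (C * (b * D)))" .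
      qed
      also have "\<dots> = ennreal (c * (C * (b * D)))"
        using C b real by (subst sum_ennreal) (auto simp: c_def sum_distrib_right)
      also have "\<dots> \<le> ennreal ((c + 1) * (C * (b * D)))"
        using C b real by (intro ennreal_leI mult_right_mono) auto
      also have "\<dots> = ennreal ((c + 1) * C) * (ennreal b * dist_k k \<mu> \<nu>)"
        using C b c real by (simp add: mult_ac flip: ennreal_mult)
      finally show "luxemburg_norm e (smoothing \<eta> M n' ?g) \<le> ennreal ((c + 1) * C) * (ennreal b * dist_k k \<mu> \<nu>)" .
    qed
  qed
qed

text \<open>Only the weights with \<open>\<gamma> = 0\<close> are needed, and mixed derivatives are reordered.\<close>

lemma luxemburg_word_deriv_le_norm_kle:
  fixes p :: "real^'c::{finite,linorder} \<Rightarrow> real"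
  assumes p: "C_k K p" and v: "length v \<le> K"
  shows "luxemburg_norm e (word_deriv v p) \<le> norm_kle K l e p"
proof -
  obtain \<alpha> where \<alpha>: "(\<Sum>i\<in>UNIV. \<alpha> i) = length v" "word_deriv v p = multi_deriv \<alpha> p"
    using word_deriv_eq_multi_deriv[OF C_k_mono[OF p v]] by blast
  let ?z = "(\<lambda>_. 0) :: 'c \<Rightarrow> nat"
  have z: "?z \<in> multi_indices l" by (simp add: multi_indices_def)
  have \<alpha>': "\<alpha> \<in> multi_indices K" using \<alpha>(1) v by (simp add: multi_indices_def)
  have "luxemburg_norm e (word_deriv v p) = luxemburg_norm e (\<lambda>x. multi_monom ?z x * multi_deriv \<alpha> p x)"
    by (simp add: \<alpha>(2) multi_monom_def)
  also have "\<dots> \<le> (\<Sum>\<gamma>\<in>multi_indices l. luxemburg_norm e (\<lambda>x. multi_monom \<gamma> x * multi_deriv \<alpha> p x))"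
    by (rule member_le_sum[OF z]) (auto simp: finite_multi_indices)
  also have "\<dots> \<le> (\<Sum>\<alpha>\<in>multi_indices K. \<Sum>\<gamma>\<in>multi_indices l. luxemburg_norm e (\<lambda>x. multi_monom \<gamma> x * multi_deriv \<alpha> p x))"
    by (rule member_le_sum[OF \<alpha>']) (auto simp: finite_multi_indices)
  also have "\<dots> = norm_kle K l e p" using p by (simp add: norm_kle_def)
  finally show ?thesis .
qed

lemma luxemburg_smoothing_error_norm_kle:
  fixes w :: "'d list"
  assumes p: "C_k (M + q) p" and w: "length w \<le> q" and n: "n \<le> n'"
  shows "luxemburg_norm e (\<lambda>x. word_deriv w p x - smoothing \<eta> M n' (word_deriv w p) x)
    \<le> ennreal (real CARD('d) ^ M) * (ennreal (1 / 2 ^ (n * M)) * norm_kle (M + q) l e p)"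
proof -
  have "luxemburg_norm e (\<lambda>x. word_deriv w p x - smoothing \<eta> M n' (word_deriv w p) x)
     \<le> ennreal ((real CARD('d) / 2 ^ n') ^ M) * norm_kle (M + q) l e p"
  proof (rule luxemburg_smoothing_error)
    show "C_k M (word_deriv w p)" using w by (intro C_k_word_deriv C_k_mono[OF p]) simp
    fix v :: "'d list" assume "length v = M"
    thus "luxemburg_norm e (word_deriv v (word_deriv w p)) \<le> norm_kle (M + q) l e p"
      using luxemburg_word_deriv_le_norm_kle[OF p, of "v @ w" l] w by simp
  qed
  also have "\<dots> \<le> ennreal (real CARD('d) ^ M * (1 / 2 ^ (n * M))) * norm_kle (M + q) l e p"
  proof (intro mult_right_mono ennreal_leI)
    have "(1 / 2 ^ n') ^ M \<le> (1 / 2 ^ n :: real) ^ M"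
      using n by (intro power_mono divide_left_mono power_increasing) auto
    hence "real CARD('d) ^ M * (1 / 2 ^ n') ^ M \<le> real CARD('d) ^ M * (1 / 2 ^ n) ^ M"
      by (intro mult_left_mono) auto
    thus "(real CARD('d) / 2 ^ n') ^ M \<le> real CARD('d) ^ M * (1 / 2 ^ (n * M))"
      by (simp add: power_divide power_mult)
  qed simp
  also have "\<dots> = ennreal (real CARD('d) ^ M) * (ennreal (1 / 2 ^ (n * M)) * norm_kle (M + q) l e p)"
    by (subst ennreal_mult) (auto simp: mult.assoc)
  finally show ?thesis .
qed

section \<open>Summation over the scales\<close>

text \<open>
  The telescoping sum of the increments, with \<open>W = \<partial>\<^sub>w f\<close> split at scale \<open>n\<close> into \<open>u n = \<partial>\<^sub>w f\<^sub>n\<close> and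
  \<open>v n = \<partial>\<^sub>w (f - f\<^sub>n)\<close>; \<open>P\<close> and \<open>Q\<close> are the terms of the two series.
\<close>

lemma luxemburg_word_deriv_le_interp_pi:
  fixes w :: "'d list"
  assumes m: "1 \<le> m" and w: "length w \<le> q"
  shows "\<exists>C>0. \<forall>f (\<mu>s :: nat \<Rightarrow> (real^'d::{finite,linorder}) set \<Rightarrow> real). C_k (2 * m + q) f \<longrightarrow> integrable lborel f \<longrightarrow> (\<forall>n. \<mu>s n \<in> ac_signed_measures) \<longrightarrow>
    luxemburg_norm e (word_deriv w f) \<le> ennreal C * interp_pi q k m e (measure_with_density f) \<mu>s"
proof -
  define M where "M = 2 * m"
  obtain C2 where C2: "0 < C2" "\<And>n n' f p \<mu> \<nu>. n \<le> n' \<Longrightarrow> n' \<le> Suc n \<Longrightarrow> C_k (length w) f \<Longrightarrow> C_k (length w) p \<Longrightarrow>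
      is_density_of f \<mu> \<Longrightarrow> is_density_of p \<nu> \<Longrightarrow>
    luxemburg_norm e (smoothing \<eta> M n' (word_deriv w (\<lambda>x. f x - p x)))
      \<le> ennreal C2 * (ennreal (2 ^ (n * (q + k)) * young_beta e (2 ^ (n * CARD('d)))) * dist_k k \<mu> \<nu>)"
    using luxemburg_smoothing_dual[OF w, of M k] by blast
  define C1 where "C1 = real CARD('d) ^ M"
  have C1: "0 < C1" by (simp add: C1_def)
  define C0 where "C0 = 2 * C1 + 2 * C2 + 1"
  have C0: "0 < C0" using C1 C2 by (simp add: C0_def)
  show ?thesis
  proof (intro exI[of _ "2 * C0"] conjI allI impI)
    show "0 < 2 * C0" using C0 by simp
    fix f :: "real^'d::{finite,linorder} \<Rightarrow> real" and \<mu>s :: "nat \<Rightarrow> (real^'d::{finite,linorder}) set \<Rightarrow> real"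
    assume f: "C_k (2 * m + q) f" "integrable lborel f" and \<mu>s: "\<forall>n. \<mu>s n \<in> ac_signed_measures"
    define P where "P n = ennreal (2 ^ (n * (q + k)) * young_beta e (2 ^ (n * CARD('d)))) * dist_k k (measure_with_density f) (\<mu>s n)" for n
    define p where "p n = density_of (\<mu>s n)" for n
    define Q where "Q n = ennreal (1 / 2 ^ (2 * n * m)) * norm_kle (2 * m + q) (2 * m) e (p n)" for n
    have pi: "interp_pi q k m e (measure_with_density f) \<mu>s = (\<Sum>n. P n) + (\<Sum>n. Q n)"
      by (simp add: interp_pi_def P_def Q_def p_def)
    show "luxemburg_norm e (word_deriv w f) \<le> ennreal (2 * C0) * interp_pi q k m e (measure_with_density f) \<mu>s"
    proof (cases "\<forall>n. C_k (2 * m + q) (p n)")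
      case False
      \<comment> \<open>A density that is not smooth enough makes the second series infinite.\<close>
      then obtain n where "\<not> C_k (2 * m + q) (p n)" by blast
      hence "Q n = \<infinity>" by (simp add: Q_def norm_kle_def ennreal_mult_top)
      moreover have "Q n \<le> (\<Sum>n. Q n)" using sum_le_suminf[of Q "{n}"] by simp
      ultimately have "(\<Sum>n. Q n) = \<infinity>" by (simp add: top_unique)
      thus ?thesis using C0 by (simp add: pi ennreal_mult_top)
    next
      case True
      have p: "C_k (M + q) (p n)" "is_density_of (p n) (\<mu>s n)" for n
        using True density_of_is_density \<mu>s by (auto simp: p_def M_def)
      have fd: "is_density_of f (measure_with_density f)" using f(2) by (simp add: is_density_of_def)
      have Cw: "C_k (length w) f" "C_k (length w) (p n)" for n
        using w by (auto intro: C_k_mono[OF f(1)] C_k_mono[OF p(1)])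
      define W where "W = word_deriv w f"
      define u where "u n = word_deriv w (p n)" for n
      define v where "v n = word_deriv w (\<lambda>x. f x - p n x)" for n
      have cont: "continuous_on UNIV W" "continuous_on UNIV (u n)" "continuous_on UNIV (v n)" for n
        unfolding W_def u_def v_def using Cw by (auto intro!: word_deriv_continuous C_k_diff)
      note meas [measurable] = cont[THEN borel_measurable_continuous_onI] cont[THEN smoothing_measurable[OF \<eta>]]
      have split: "W = (\<lambda>x. u n x + v n x)" for n
        unfolding W_def u_def v_def using Cw by (simp add: word_deriv_diff)
      have Ssplit: "smoothing \<eta> M n' W x = smoothing \<eta> M n' (u n) x + smoothing \<eta> M n' (v n) x" for n n' x
        unfolding split[of n] by (rule smoothing_add[OF \<eta> cont(2,3)])
      have err: "luxemburg_norm e (\<lambda>x. u n x - smoothing \<eta> M n' (u n) x) \<le> ennreal C1 * Q n" if "n \<le> n'" for n n'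
        using luxemburg_smoothing_error_norm_kle[OF p(1)[of n] w that, where l = "2 * m"]
        by (simp add: u_def C1_def Q_def M_def mult_ac)
      have dual: "luxemburg_norm e (smoothing \<eta> M n' (v n)) \<le> ennreal C2 * P n" if "n \<le> n'" "n' \<le> Suc n" for n n'
        unfolding v_def P_def by (rule C2(2)[OF that Cw fd p(2)])
      have comb: "ennreal C1 * Q n + ennreal C1 * Q n + (ennreal C2 * P n + ennreal C2 * P n) + Q n \<le> ennreal C0 * (P n + Q n)" for n
      proof -
        have "ennreal C0 = ennreal C1 + ennreal C1 + (ennreal C2 + ennreal C2) + 1"
          using C1 C2 by (simp add: C0_def flip: ennreal_plus ennreal_1)
        thus ?thesis by (auto simp: algebra_simps intro!: add_mono)
      qed
      \<comment> \<open>Twice the approximation error of \<open>u n\<close> and twice the smoothing of \<open>v n\<close>, at the scales \<open>n\<close> and \<open>n + 1\<close>.\<close>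
      have step: "luxemburg_norm e (\<lambda>x. smoothing \<eta> M (Suc n) W x - smoothing \<eta> M n W x) \<le> ennreal C0 * (P n + Q n)" for n
      proof -
        have "(\<lambda>x. smoothing \<eta> M (Suc n) W x - smoothing \<eta> M n W x) =
          (\<lambda>x. ((u n x - smoothing \<eta> M n (u n) x) - (u n x - smoothing \<eta> M (Suc n) (u n) x))
             + (smoothing \<eta> M (Suc n) (v n) x - smoothing \<eta> M n (v n) x))"
          by (simp add: Ssplit[where n = n] fun_eq_iff)
        hence "luxemburg_norm e (\<lambda>x. smoothing \<eta> M (Suc n) W x - smoothing \<eta> M n W x)
          \<le> luxemburg_norm e (\<lambda>x. (u n x - smoothing \<eta> M n (u n) x) - (u n x - smoothing \<eta> M (Suc n) (u n) x))
           + luxemburg_norm e (\<lambda>x. smoothing \<eta> M (Suc n) (v n) x - smoothing \<eta> M n (v n) x)"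
          by (simp only:) (rule luxemburg_add; measurable)
        also have "\<dots> \<le> (luxemburg_norm e (\<lambda>x. u n x - smoothing \<eta> M n (u n) x) + luxemburg_norm e (\<lambda>x. u n x - smoothing \<eta> M (Suc n) (u n) x))
           + (luxemburg_norm e (smoothing \<eta> M (Suc n) (v n)) + luxemburg_norm e (smoothing \<eta> M n (v n)))"
          by (intro add_mono luxemburg_diff) measurable
        also have "\<dots> \<le> (ennreal C1 * Q n + ennreal C1 * Q n) + (ennreal C2 * P n + ennreal C2 * P n)"
          by (intro add_mono err dual) auto
        also have "\<dots> \<le> ennreal C0 * (P n + Q n)" by (rule order_trans[OF _ comb]) simp
        finally show ?thesis .
      qed
      \<comment> \<open>The additional \<open>Q 0\<close> in the constant bounds \<open>u 0\<close> itself, the scale factor being 1.\<close>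
      have base: "luxemburg_norm e (smoothing \<eta> M 0 W) \<le> ennreal C0 * (P 0 + Q 0)"
      proof -
        have "smoothing \<eta> M 0 W = (\<lambda>x. (u 0 x - (u 0 x - smoothing \<eta> M 0 (u 0) x)) + smoothing \<eta> M 0 (v 0) x)"
          by (simp add: Ssplit[where n = 0] fun_eq_iff)
        hence "luxemburg_norm e (smoothing \<eta> M 0 W)
          \<le> luxemburg_norm e (\<lambda>x. u 0 x - (u 0 x - smoothing \<eta> M 0 (u 0) x)) + luxemburg_norm e (smoothing \<eta> M 0 (v 0))"
          by (simp only:) (rule luxemburg_add; measurable)
        also have "\<dots> \<le> (luxemburg_norm e (u 0) + luxemburg_norm e (\<lambda>x. u 0 x - smoothing \<eta> M 0 (u 0) x))
            + luxemburg_norm e (smoothing \<eta> M 0 (v 0))"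
          by (intro add_mono luxemburg_diff order_refl) measurable
        also have "\<dots> \<le> (Q 0 + ennreal C1 * Q 0) + ennreal C2 * P 0"
        proof (intro add_mono err dual)
          show "luxemburg_norm e (u 0) \<le> Q 0"
            using luxemburg_word_deriv_le_norm_kle[OF p(1)[of 0], where v = w and l = "2 * m"] w by (simp add: u_def Q_def M_def)
        qed auto
        also have "\<dots> \<le> ennreal C1 * Q 0 + ennreal C1 * Q 0 + (ennreal C2 * P 0 + ennreal C2 * P 0) + Q 0"
          by (auto simp: add_ac intro!: add_mono add_increasing2)
        also have "\<dots> \<le> ennreal C0 * (P 0 + Q 0)" by (rule comb)
        finally show ?thesis .
      qed
      have sums: "(\<Sum>n<N. P n + Q n) \<le> (\<Sum>n. P n) + (\<Sum>n. Q n)" for N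
        unfolding sum.distrib by (intro add_mono sum_le_suminf) auto
      have bound: "luxemburg_norm e (smoothing \<eta> M N W) \<le> ennreal C0 * (P 0 + Q 0) + ennreal C0 * (\<Sum>n<N. P n + Q n)" for N
      proof (induction N)
        case (Suc N)
        have "luxemburg_norm e (\<lambda>x. smoothing \<eta> M N W x + (smoothing \<eta> M (Suc N) W x - smoothing \<eta> M N W x))
          \<le> luxemburg_norm e (smoothing \<eta> M N W) + luxemburg_norm e (\<lambda>x. smoothing \<eta> M (Suc N) W x - smoothing \<eta> M N W x)"
          by (rule luxemburg_add; measurable)
        also have "\<dots> \<le> (ennreal C0 * (P 0 + Q 0) + ennreal C0 * (\<Sum>n<N. P n + Q n)) + ennreal C0 * (P N + Q N)"
          by (intro add_mono Suc step)
        finally show ?case by (simp add: distrib_left add.assoc)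
      qed (simp add: base)
      have "luxemburg_norm e W \<le> ennreal (2 * C0) * ((\<Sum>n. P n) + (\<Sum>n. Q n))"
      proof (rule luxemburg_fatou)
        show "(\<lambda>N. smoothing \<eta> M N W x) \<longlonglongrightarrow> W x" for x
          using m by (intro smoothing_tendsto cont) (simp add: M_def)
        fix N
        have "ennreal C0 * (P 0 + Q 0) + ennreal C0 * (\<Sum>n<N. P n + Q n)
            \<le> ennreal C0 * ((\<Sum>n. P n) + (\<Sum>n. Q n)) + ennreal C0 * ((\<Sum>n. P n) + (\<Sum>n. Q n))"
          using sums[of 1] by (intro add_mono[OF mult_left_mono mult_left_mono[OF sums]]) simp_all
        also have "\<dots> = ennreal (2 * C0) * ((\<Sum>n. P n) + (\<Sum>n. Q n))"
        proof -
          have "ennreal (2 * C0) = ennreal C0 + ennreal C0" using C0 by (simp flip: ennreal_plus)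
          thus ?thesis by (simp only: distrib_right)
        qed
        finally show "luxemburg_norm e (smoothing \<eta> M N W) \<le> ennreal (2 * C0) * ((\<Sum>n. P n) + (\<Sum>n. Q n))"
          using bound[of N] by (rule order_trans[rotated])
      qed measurable
      thus ?thesis by (simp add: pi W_def)
    qed
  qed
qed

end

theorem proposition2p5:
  fixes q k m :: nat and e :: "real \<Rightarrow> real"
  assumes "m \<ge> 1" and "e \<in> young_class"
  shows "\<exists>C::real. C > 0 \<and>
    (\<forall>f :: real^'d::{finite,linorder} \<Rightarrow> real.
       C_k (2 * m + q) f \<longrightarrow> integrable lborel f \<longrightarrow>
       norm_ke q e f \<le> ennreal C * interp_rho q k m e (measure_with_density f))"
proof -
  obtain \<eta> :: "real^'d::{finite,linorder} \<Rightarrow> real"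
    where \<eta>: "\<eta> \<in> test_functions" "\<And>x. 0 \<le> \<eta> x" "integral\<^sup>L lborel \<eta> = 1"
    using mollifier_exists by blast
  interpret young_mollifier e \<eta> by unfold_locales (use assms \<eta> in auto)
  let ?I = "multi_indices q :: ('d \<Rightarrow> nat) set"
  have "\<forall>\<alpha>\<in>?I. \<exists>C>0. \<forall>f \<mu>s. C_k (2 * m + q) f \<longrightarrow> integrable lborel f \<longrightarrow> (\<forall>n. \<mu>s n \<in> ac_signed_measures) \<longrightarrow>
    luxemburg_norm e (multi_deriv \<alpha> f) \<le> ennreal C * interp_pi q k m e (measure_with_density f) \<mu>s"
    unfolding multi_deriv_eq_word_deriv
    by (intro ballI luxemburg_word_deriv_le_interp_pi[OF assms(1)]) (simp add: index_word_length_le)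
  then obtain c where c: "\<And>\<alpha>. \<alpha> \<in> ?I \<Longrightarrow> 0 < c \<alpha>" "\<And>\<alpha> f \<mu>s. \<alpha> \<in> ?I \<Longrightarrow> C_k (2 * m + q) f \<Longrightarrow> integrable lborel f \<Longrightarrow>
      (\<forall>n. \<mu>s n \<in> ac_signed_measures) \<Longrightarrow>
      luxemburg_norm e (multi_deriv \<alpha> f) \<le> ennreal (c \<alpha>) * interp_pi q k m e (measure_with_density f) \<mu>s"
    by metis
  define C where "C = (\<Sum>\<alpha>\<in>?I. c \<alpha>)"
  have "?I \<noteq> {}" using card_multi_indices_pos[where 'd = 'd, of q] by auto
  hence C: "0 < C" unfolding C_def using c(1) by (intro sum_pos finite_multi_indices) auto
  show ?thesis
  proof (intro exI[of _ C] conjI allI impI C)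
    fix f :: "real^'d::{finite,linorder} \<Rightarrow> real"
    assume f: "C_k (2 * m + q) f" "integrable lborel f"
    have le: "norm_ke q e f \<le> ennreal C * interp_pi q k m e (measure_with_density f) \<mu>s"
      if "\<forall>n. \<mu>s n \<in> ac_signed_measures" for \<mu>s
    proof -
      have "C_k q f" using f(1) by (rule C_k_mono) simp
      hence "norm_ke q e f = (\<Sum>\<alpha>\<in>?I. luxemburg_norm e (multi_deriv \<alpha> f))" by (simp add: norm_ke_def)
      also have "\<dots> \<le> (\<Sum>\<alpha>\<in>?I. ennreal (c \<alpha>) * interp_pi q k m e (measure_with_density f) \<mu>s)"
        by (intro sum_mono c(2) f that)
      also have "\<dots> = (\<Sum>\<alpha>\<in>?I. ennreal (c \<alpha>)) * interp_pi q k m e (measure_with_density f) \<mu>s"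
        by (rule sum_distrib_right[symmetric])
      also have "(\<Sum>\<alpha>\<in>?I. ennreal (c \<alpha>)) = ennreal C"
        unfolding C_def using c(1) by (intro sum_ennreal) (auto intro: less_imp_le)
      finally show ?thesis .
    qed
    have inv: "ennreal (1 / C) * (ennreal C * z) = z" "ennreal C * (ennreal (1 / C) * z) = z" for z
      using C by (simp_all flip: mult.assoc ennreal_mult)
    have "ennreal (1 / C) * norm_ke q e f \<le> interp_rho q k m e (measure_with_density f)"
      unfolding interp_rho_def
    proof (rule INF_greatest)
      fix \<mu>s :: "nat \<Rightarrow> (real^'d::{finite,linorder}) set \<Rightarrow> real"
      assume "\<mu>s \<in> {\<mu>s. \<forall>n. \<mu>s n \<in> ac_signed_measures}"
      from mult_left_mono[OF le, of \<mu>s "ennreal (1 / C)"] this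
      show "ennreal (1 / C) * norm_ke q e f \<le> interp_pi q k m e (measure_with_density f) \<mu>s"
        by (simp add: inv)
    qed
    from mult_left_mono[OF this, of "ennreal C"]
    show "norm_ke q e f \<le> ennreal C * interp_rho q k m e (measure_with_density f)"
      by (simp add: inv)
  qed
qed

end
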